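(* Let $\Gamma=\mathrm{SL}(2,\mathbb{Z})$ and suppose that the MODE $y'''+Q_2(z)y'+Q_3(z)y=0$ on $\Gamma$ satisfies (H1)--(H3) and $\kappa_\rho^{(1)}\in\mathbb{Z}$. Then the Bol representation $\hat\rho$ is irreducible if and only if $\{3\kappa_{\mathrm i}^{(1)},3\kappa_{\mathrm i}^{(2)},3\kappa_{\mathrm i}^{(3)}\}\equiv\{0,0,1\}\bmod 2$.
   Context: $\mathbb{H}$ is the upper half plane, $'=\frac{d}{dz}$, $q=e^{2\pi \mathrm i z}$, $\mathrm i=\sqrt{-1}$, $\rho=(-1+\sqrt3\,\mathrm i)/2$. A MODE on $\mathrm{SL}(2,\mathbb{Z})$ is an equation $y'''+Q_2(z)y'+Q_3(z)y=0$ on $\mathbb{H}$ such that $Q_2$ and $Q_3-\frac12Q_2'$ are meromorphic modular forms on $\mathrm{SL}(2,\mathbb{Z})$ of weights $4$ and $6$. Singular points are the poles of $Q_2,Q_3$. If $Q_j(z)=A_j(z-z_0)^{-j}+O((z-z_0)^{-j+1})$, the local exponents $\kappa_{z_0}^{(1)}\le\kappa_{z_0}^{(2)}\le\kappa_{z_0}^{(3)}$ at $z_0\in\mathbb{H}$ are the roots of $\kappa(\kappa-1)(\kappa-2)+A_2\kappa+A_3=0$ (so $0,1,2$ at a regular point). The local exponents $\kappa_\infty^{(1)}\le\kappa_\infty^{(2)}\le\kappa_\infty^{(3)}$ at the cusp $\infty$ are the roots of $\kappa^3+(2\pi \mathrm i)^{-2}Q_2(\infty)\kappa+(2\pi \mathrm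 i)^{-3}Q_3(\infty)=0$. A singular point is apparent if no solution has a logarithmic singularity there. Conditions: (H1) The equation is Fuchsian on $\mathbb{H}\cup\{\infty\}$: poles of $Q_j$ in $\mathbb{H}$ have order at most $j$, and $Q_2,Q_3$ are holomorphic at $\infty$. (H2) At any singular point $z_0\in\mathbb{H}$, $\kappa_{z_0}^{(1)}<\kappa_{z_0}^{(2)}<\kappa_{z_0}^{(3)}$ satisfy $\kappa_{z_0}^{(1)}\in\frac13\mathbb{Z}_{\le0}$, $\kappa_{z_0}^{(j)}-\kappa_{z_0}^{(1)}\in\mathbb{Z}$ for $j=2,3$, and $z_0$ is apparent. (H3) $\kappa_\infty^{(1)}\in\frac13\mathbb{Z}_{\le0}$ and $\kappa_\infty^{(j)}-\kappa_\infty^{(1)}\in\mathbb{Z}$ for $j=2,3$. Bol representation. Let $E_4,E_6$ be the normalized Eisenstein series, $\Delta=(E_4^3-E_6^2)/1728$. Let $\{z_1,\dots,z_m\}\sqcup\{\mathrm i,\rho,\infty\}$ denote the set of singular points of the MODE mod $\mathrm{SL}(2,\mathbb{Z})$ (with $z_1,\dots,z_m\in\mathbb{H}$ inequivalent and non-elliptic), $t_j=E_4(z_j)^3/E_6(z_j)^2$, $F_j=E_4^3-t_jE_6^2$, and $$F(z)=\Delta(z)^{-\kappa_\infty^{(1)}}E_4(z)^{-\kappa_\rho^{(1)}}E_6(z)^{-\kappa_{\mathrm i}^{(1)}}\prod_{j=1}^mF_j(z)^{-\kappa_{z_j}^{(1)}},\qquad \ell=-2-12\kappa_\infty^{(1)}-4\kappa_\rho^{(1)}-6\kappa_{\mathrm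 i}^{(1)}-12\sum_{j=1}^m\kappa_{z_j}^{(1)}.$$ Then $\ell\in\mathbb{Z}$, $F^3$ is a modular form of weight $3(\ell+2)$, and for each solution $y$ the (analytically continued) function $\hat y=Fy$ is single-valued and holomorphic on $\mathbb{H}$. For a fundamental system of solutions $Y=(y_1,y_2,y_3)^t$ and $\hat Y=FY$, the Bol representation is the homomorphism $\hat\rho:\mathrm{SL}(2,\mathbb{Z})\to\mathrm{GL}(3,\mathbb{C})$ defined by $(\hat Y|_\ell\gamma)(z)=\hat\rho(\gamma)\hat Y(z)$, where $(g|_\ell\gamma)(z)=(cz+d)^{-\ell}g(\gamma z)$ for $\gamma=\begin{pmatrix}a&b\\c&d\end{pmatrix}$. Congruences of sets are congruences of multisets, up to reordering. *)

theory Defs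
  imports
    "HOL-Complex_Analysis.Complex_Analysis"
    "HOL-Library.Real_Mod"
    "HOL-Algebra.Group"
begin

section \<open>The modular group and the linear group\<close>

definition uhp :: "complex set" where
  "uhp = {z. 0 < Im z}"

definition SL2Z :: "(int^2^2) monoid" where
  "SL2Z = \<lparr>carrier = {A. det A = 1}, monoid.mult = (**), one = mat 1\<rparr>"

definition GL3C :: "(complex^3^3) monoid" where
  "GL3C = \<lparr>carrier = {A. invertible A}, monoid.mult = (**), one = mat 1\<rparr>"

definition automorphy :: "int^2^2 \<Rightarrow> complex \<Rightarrow> complex" where
  "automorphy \<gamma> z = of_int (\<gamma>$2$1) * z + of_int (\<gamma>$2$2)"

definition moebius_act :: "int^2^2 \<Rightarrow> complex \<Rightarrow> complex" where
  "moebius_act \<gamma> z = (of_int (\<gamma>$1$1) * z + of_int (\<gamma>$1$2)) / automorphy \<gamma> z"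

definition SL2Z_equivalent :: "complex \<Rightarrow> complex \<Rightarrow> bool" where
  "SL2Z_equivalent z w \<longleftrightarrow> (\<exists>\<gamma>\<in>carrier SL2Z. w = moebius_act \<gamma> z)"

definition rho_pt :: complex where
  "rho_pt = (-1 + of_real (sqrt 3) * \<i>) / 2"


section \<open>Modular forms\<close>

definition to_q :: "complex \<Rightarrow> complex" where
  "to_q z = exp (2 * of_real pi * \<i> * z)"

definition at_ii_inf :: "complex filter" where
  "at_ii_inf = filtercomap Im at_top"

definition meromorphic_at_cusp :: "(complex \<Rightarrow> complex) \<Rightarrow> bool" where
  "meromorphic_at_cusp f \<longleftrightarrow>
     (\<exists>g. g meromorphic_on {0} \<and> (\<forall>\<^sub>F z in at_ii_inf. f z = g (to_q z)))"

definition holomorphic_at_cusp :: "(complex \<Rightarrow> complex) \<Rightarrow> bool" where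
  "holomorphic_at_cusp f \<longleftrightarrow>
     (\<exists>g. g analytic_on {0} \<and> (\<forall>\<^sub>F z in at_ii_inf. f z = g (to_q z)))"

definition value_at_cusp :: "(complex \<Rightarrow> complex) \<Rightarrow> complex" where
  "value_at_cusp f = Lim at_ii_inf f"

text \<open>The transformation law is an identity between meromorphic functions, so it is only
  required on punctured neighbourhoods: the value assigned to a function at a pole
  is immaterial.\<close>

definition meromorphic_modular_form :: "int \<Rightarrow> (complex \<Rightarrow> complex) \<Rightarrow> bool" where
  "meromorphic_modular_form k f \<longleftrightarrow>
     f meromorphic_on uhp \<and>
     (\<forall>\<gamma>\<in>carrier SL2Z. \<forall>z\<in>uhp. \<forall>\<^sub>F w in at z.
        f (moebius_act \<gamma> w) = automorphy \<gamma> w powi k * f w) \<and>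
     meromorphic_at_cusp f"

text \<open>The denominator is $2\zeta(k)$, so that the constant term of the $q$-expansion is $1$.\<close>

definition Eisenstein :: "nat \<Rightarrow> complex \<Rightarrow> complex" where
  "Eisenstein k z =
     (\<Sum>\<^sub>\<infinity>(m, n)\<in>(UNIV :: (int \<times> int) set) - {(0, 0)}. 1 / (of_int m * z + of_int n) ^ k) /
     (2 * (\<Sum>n. 1 / of_nat (Suc n) ^ k))"

definition Delta :: "complex \<Rightarrow> complex" where
  "Delta z = (Eisenstein 4 z ^ 3 - Eisenstein 6 z ^ 2) / 1728"


section \<open>Third order modular differential equations\<close>

text \<open>The equation is $y''' + Q_2 y' + Q_3 y = 0$ and is given by the pair $(Q_2, Q_3)$.
  That the $Q_j$ are nicely meromorphic only normalises their values: they have no removable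
  singularities, and the value at a pole is the dummy $0$.\<close>

definition MODE :: "(complex \<Rightarrow> complex) \<Rightarrow> (complex \<Rightarrow> complex) \<Rightarrow> bool" where
  "MODE Q2 Q3 \<longleftrightarrow>
     Q2 nicely_meromorphic_on uhp \<and> Q3 nicely_meromorphic_on uhp \<and>
     meromorphic_modular_form 4 Q2 \<and>
     meromorphic_modular_form 6 (\<lambda>z. Q3 z - deriv Q2 z / 2)"

definition singular_points ::
  "(complex \<Rightarrow> complex) \<Rightarrow> (complex \<Rightarrow> complex) \<Rightarrow> complex set" where
  "singular_points Q2 Q3 = {z \<in> uhp. is_pole Q2 z \<or> is_pole Q3 z}"

definition solves ::
  "(complex \<Rightarrow> complex) \<Rightarrow> (complex \<Rightarrow> complex) \<Rightarrow> complex set \<Rightarrow> (complex \<Rightarrow> complex) \<Rightarrow> bool"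
where
  "solves Q2 Q3 U y \<longleftrightarrow>
     y holomorphic_on U \<and>
     (\<forall>z\<in>U. (deriv ^^ 3) y z + Q2 z * deriv y z + Q3 z * y z = 0)"

definition leading_coefficient :: "nat \<Rightarrow> (complex \<Rightarrow> complex) \<Rightarrow> complex \<Rightarrow> complex" where
  "leading_coefficient j Q z0 = Lim (at z0) (\<lambda>z. (z - z0) ^ j * Q z)"

definition indicial_poly ::
  "(complex \<Rightarrow> complex) \<Rightarrow> (complex \<Rightarrow> complex) \<Rightarrow> complex \<Rightarrow> complex poly" where
  "indicial_poly Q2 Q3 z0 =
     [:0, 1:] * [:-1, 1:] * [:-2, 1:] +
     smult (leading_coefficient 2 Q2 z0) [:0, 1:] + [:leading_coefficient 3 Q3 z0:]"

definition indicial_poly_cusp ::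
  "(complex \<Rightarrow> complex) \<Rightarrow> (complex \<Rightarrow> complex) \<Rightarrow> complex poly" where
  "indicial_poly_cusp Q2 Q3 =
     [:value_at_cusp Q3 / (2 * of_real pi * \<i>) ^ 3,
       value_at_cusp Q2 / (2 * of_real pi * \<i>) ^ 2, 0, 1:]"

text \<open>\<open>ordered_root p j\<close> is the \<open>j\<close>-th root of \<open>p\<close> (\<open>j = 1, 2, \<dots>\<close>), counted with
  multiplicity, in increasing order. It is meaningful only if all roots of \<open>p\<close> are real;
  the conditions on exponents below therefore always include \<open>real_roots p\<close>.\<close>

definition real_roots :: "complex poly \<Rightarrow> bool" where
  "real_roots p \<longleftrightarrow> set_mset (proots p) \<subseteq> \<real>"

definition ordered_root :: "complex poly \<Rightarrow> nat \<Rightarrow> real" where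
  "ordered_root p j = sorted_list_of_multiset (image_mset Re (proots p)) ! (j - 1)"

definition local_exponent ::
  "(complex \<Rightarrow> complex) \<Rightarrow> (complex \<Rightarrow> complex) \<Rightarrow> complex \<Rightarrow> nat \<Rightarrow> real" where
  "local_exponent Q2 Q3 z0 = ordered_root (indicial_poly Q2 Q3 z0)"

definition cusp_exponent ::
  "(complex \<Rightarrow> complex) \<Rightarrow> (complex \<Rightarrow> complex) \<Rightarrow> nat \<Rightarrow> real" where
  "cusp_exponent Q2 Q3 = ordered_root (indicial_poly_cusp Q2 Q3)"

text \<open>No logarithms at \<open>z0\<close>: near \<open>z0\<close>, every solution \<open>y\<close> on a region \<open>U\<close> that carries a branch
  \<open>L\<close> of $\log(z - z_0)$ is a sum of terms $(z - z_0)^\kappa h_\kappa(z)$, where $\kappa$ runs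
  through the local exponents and $h_\kappa$ is holomorphic in a full neighbourhood of \<open>z0\<close>.\<close>

definition apparent ::
  "(complex \<Rightarrow> complex) \<Rightarrow> (complex \<Rightarrow> complex) \<Rightarrow> complex \<Rightarrow> bool" where
  "apparent Q2 Q3 z0 \<longleftrightarrow>
     (\<exists>r>0. ball z0 r \<subseteq> uhp \<and> (ball z0 r - {z0}) \<inter> singular_points Q2 Q3 = {} \<and>
        (\<forall>U L y. open U \<and> connected U \<and> U \<subseteq> ball z0 r - {z0} \<and>
           L holomorphic_on U \<and> (\<forall>z\<in>U. exp (L z) = z - z0) \<and> solves Q2 Q3 U y \<longrightarrow>
           (\<exists>h. (\<forall>\<kappa>. h \<kappa> holomorphic_on ball z0 r) \<and>
              (\<forall>z\<in>U. y z =
                 (\<Sum>\<kappa>\<in>set_mset (proots (indicial_poly Q2 Q3 z0)). exp (\<kappa> * L z) * h \<kappa> z)))))"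

definition third_nonpos_int :: "real \<Rightarrow> bool" where
  "third_nonpos_int x \<longleftrightarrow> (\<exists>n::int. n \<le> 0 \<and> x = of_int n / 3)"

definition H1 :: "(complex \<Rightarrow> complex) \<Rightarrow> (complex \<Rightarrow> complex) \<Rightarrow> bool" where
  "H1 Q2 Q3 \<longleftrightarrow>
     (\<forall>z\<in>uhp. is_pole Q2 z \<longrightarrow> zorder Q2 z \<ge> -2) \<and>
     (\<forall>z\<in>uhp. is_pole Q3 z \<longrightarrow> zorder Q3 z \<ge> -3) \<and>
     holomorphic_at_cusp Q2 \<and> holomorphic_at_cusp Q3"

definition H2 :: "(complex \<Rightarrow> complex) \<Rightarrow> (complex \<Rightarrow> complex) \<Rightarrow> bool" where
  "H2 Q2 Q3 \<longleftrightarrow>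
     (\<forall>z\<in>singular_points Q2 Q3.
        real_roots (indicial_poly Q2 Q3 z) \<and>
        local_exponent Q2 Q3 z 1 < local_exponent Q2 Q3 z 2 \<and>
        local_exponent Q2 Q3 z 2 < local_exponent Q2 Q3 z 3 \<and>
        third_nonpos_int (local_exponent Q2 Q3 z 1) \<and>
        (\<forall>j\<in>{2, 3}. local_exponent Q2 Q3 z j - local_exponent Q2 Q3 z 1 \<in> \<int>) \<and>
        apparent Q2 Q3 z)"

definition H3 :: "(complex \<Rightarrow> complex) \<Rightarrow> (complex \<Rightarrow> complex) \<Rightarrow> bool" where
  "H3 Q2 Q3 \<longleftrightarrow>
     real_roots (indicial_poly_cusp Q2 Q3) \<and>
     third_nonpos_int (cusp_exponent Q2 Q3 1) \<and>
     (\<forall>j\<in>{2, 3}. cusp_exponent Q2 Q3 j - cusp_exponent Q2 Q3 1 \<in> \<int>)"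


section \<open>The Bol representation\<close>

text \<open>\<open>Z\<close> plays the role of $\{z_1,\dots,z_m\}$.\<close>

definition singular_representatives ::
  "(complex \<Rightarrow> complex) \<Rightarrow> (complex \<Rightarrow> complex) \<Rightarrow> complex set \<Rightarrow> bool" where
  "singular_representatives Q2 Q3 Z \<longleftrightarrow>
     finite Z \<and> Z \<subseteq> singular_points Q2 Q3 \<and>
     (\<forall>z\<in>Z. \<not> SL2Z_equivalent z \<i> \<and> \<not> SL2Z_equivalent z rho_pt) \<and>
     (\<forall>z\<in>Z. \<forall>w\<in>Z. SL2Z_equivalent z w \<longrightarrow> z = w) \<and>
     (\<forall>z\<in>singular_points Q2 Q3. \<exists>w\<in>insert \<i> (insert rho_pt Z). SL2Z_equivalent z w)"

definition F_factor :: "complex \<Rightarrow> complex \<Rightarrow> complex" where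
  "F_factor w z =
     Eisenstein 4 z ^ 3 - (Eisenstein 4 w ^ 3 / Eisenstein 6 w ^ 2) * Eisenstein 6 z ^ 2"

text \<open>\<open>p\<close> is on \<open>U\<close> a branch of the possibly multivalued power $G^a$.\<close>

definition power_branch ::
  "complex set \<Rightarrow> (complex \<Rightarrow> complex) \<Rightarrow> real \<Rightarrow> (complex \<Rightarrow> complex) \<Rightarrow> bool" where
  "power_branch U G a p \<longleftrightarrow>
     (\<exists>L. L holomorphic_on U \<and> (\<forall>z\<in>U. exp (L z) = G z \<and> p z = exp (of_real a * L z)))"

text \<open>\<open>F\<close> is on \<open>U\<close> a branch of the multivalued function
  $\Delta^{-\kappa_\infty} E_4^{-\kappa_\rho} E_6^{-\kappa_{\mathrm i}} \prod_j F_j^{-\kappa_{z_j}}$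
  formed with the smallest exponents.\<close>

definition bol_factor_branch ::
  "(complex \<Rightarrow> complex) \<Rightarrow> (complex \<Rightarrow> complex) \<Rightarrow> complex set \<Rightarrow> complex set \<Rightarrow>
   (complex \<Rightarrow> complex) \<Rightarrow> bool" where
  "bol_factor_branch Q2 Q3 Z U F \<longleftrightarrow>
     (\<exists>p_inf p_rho p_i p.
        power_branch U Delta (- cusp_exponent Q2 Q3 1) p_inf \<and>
        power_branch U (Eisenstein 4) (- local_exponent Q2 Q3 rho_pt 1) p_rho \<and>
        power_branch U (Eisenstein 6) (- local_exponent Q2 Q3 \<i> 1) p_i \<and>
        (\<forall>w\<in>Z. power_branch U (F_factor w) (- local_exponent Q2 Q3 w 1) (p w)) \<and>
        (\<forall>z\<in>U. F z = p_inf z * p_rho z * p_i z * (\<Prod>w\<in>Z. p w z)))"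

definition bol_weight ::
  "(complex \<Rightarrow> complex) \<Rightarrow> (complex \<Rightarrow> complex) \<Rightarrow> complex set \<Rightarrow> real" where
  "bol_weight Q2 Q3 Z =
     -2 - 12 * cusp_exponent Q2 Q3 1 - 4 * local_exponent Q2 Q3 rho_pt 1
     - 6 * local_exponent Q2 Q3 \<i> 1 - 12 * (\<Sum>w\<in>Z. local_exponent Q2 Q3 w 1)"

definition fundamental_system ::
  "(complex \<Rightarrow> complex) \<Rightarrow> (complex \<Rightarrow> complex) \<Rightarrow> complex set \<Rightarrow> (complex \<Rightarrow> complex^3) \<Rightarrow> bool"
where
  "fundamental_system Q2 Q3 U Y \<longleftrightarrow>
     (\<forall>i. solves Q2 Q3 U (\<lambda>z. Y z $ i)) \<and>
     (\<forall>c::complex^3. (\<forall>z\<in>U. (\<Sum>i\<in>UNIV. c $ i * Y z $ i) = 0) \<longrightarrow> c = 0)"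

definition slash :: "int \<Rightarrow> (complex \<Rightarrow> complex^3) \<Rightarrow> int^2^2 \<Rightarrow> complex \<Rightarrow> complex^3" where
  "slash l G \<gamma> z = automorphy \<gamma> z powi (- l) *s G (moebius_act \<gamma> z)"

text \<open>The multivalued \<open>F\<close> and \<open>Y\<close> are given by branches on a region \<open>U\<close> free of singular
  points; \<open>Yhat\<close> is the holomorphic function on \<open>uhp\<close>, unique by the identity theorem,
  that continues \<open>F Y\<close>. Other choices of \<open>U\<close>, \<open>Z\<close>, \<open>F\<close>, \<open>Y\<close> lead to conjugate
  homomorphisms \<open>R\<close>.\<close>

definition bol_representation ::
  "(complex \<Rightarrow> complex) \<Rightarrow> (complex \<Rightarrow> complex) \<Rightarrow> (int^2^2 \<Rightarrow> complex^3^3) \<Rightarrow> bool" where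
  "bol_representation Q2 Q3 R \<longleftrightarrow>
     R \<in> hom SL2Z GL3C \<and>
     (\<exists>Z l U F Y Yhat.
        singular_representatives Q2 Q3 Z \<and>
        real_of_int l = bol_weight Q2 Q3 Z \<and>
        open U \<and> connected U \<and> U \<noteq> {} \<and> U \<subseteq> uhp - singular_points Q2 Q3 \<and>
        bol_factor_branch Q2 Q3 Z U F \<and>
        fundamental_system Q2 Q3 U Y \<and>
        (\<forall>i. (\<lambda>z. Yhat z $ i) holomorphic_on uhp) \<and>
        (\<forall>z\<in>U. Yhat z = F z *s Y z) \<and>
        (\<forall>\<gamma>\<in>carrier SL2Z. \<forall>z\<in>uhp. slash l Yhat \<gamma> z = R \<gamma> *v Yhat z))"

definition irreducible_rep :: "(int^2^2 \<Rightarrow> complex^3^3) \<Rightarrow> bool" where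
  "irreducible_rep R \<longleftrightarrow>
     (\<forall>W. vec.subspace W \<and> (\<forall>\<gamma>\<in>carrier SL2Z. \<forall>v\<in>W. R \<gamma> *v v \<in> W) \<longrightarrow> W = {0} \<or> W = UNIV)"

definition mset_cong :: "real multiset \<Rightarrow> real multiset \<Rightarrow> real \<Rightarrow> bool" where
  "mset_cong A B m \<longleftrightarrow> rel_mset (\<lambda>a b. [a = b] (rmod m)) A B"

end

theory Submission
  imports Defs "HOL-Computational_Algebra.Computational_Algebra"
begin

text \<open>Write \<open>S = mat22 0 (-1) 1 0\<close> and \<open>T = mat22 1 1 0 1\<close> for the standard generators of
$\mathrm{SL}(2,\mathbb{Z})$. Integrality of the smallest exponent at $\rho$ makes the weight
\<open>l\<close> even, so \<open>R\<close> is trivial on $-1$ and factors through $\mathrm{PSL}(2,\mathbb{Z})$: the matrices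
\<open>A = R S\<close> and \<open>B = R T\<close> satisfy $A^2 = 1$ and $(AB)^3 = 1$. The theorem is the combination
of three facts.

(1) Every eigenvalue $\mu$ of \<open>B\<close> satisfies $\mu^3 = 1$ (\<open>translation_eigenvalue_cusp\<close>). A
combination $f$ of the components of \<open>Yhat\<close> with $f(z+1) = \mu f(z)$ comes from a solution
$y = f/F$ whose cube is, near the cusp, $e^{2\pi\mathrm{i}\cdot 3\nu z}$ times a unit in $q$, with
$\nu$ an exponent at the cusp; the exponents at the cusp lie in $\frac13\mathbb{Z}$, and $F^3$ is
single-valued and periodic.

(2) Given (1), \<open>R\<close> is irreducible if and only if $A \neq 1$ (\<open>irreducible_iff_S_nontrivial\<close>).
This is linear algebra: (1) forces $\det A = 1$. If $A = 1$, then $B^3 = 1$ and an eigenvector of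
\<open>B\<close> spans an invariant line. If $A \neq 1$, then $A$ is $-1$ plus a matrix of rank one. So on an
invariant subspace or on its quotient $A$ is $-1$, hence $B^3 = (-AB)^3 = -1$ there, which
contradicts (1).

(3) $A = 1$ if and only if $\kappa_{\mathrm i}^{(j)} - \kappa_{\mathrm i}^{(1)}$ is even for
$j = 2, 3$. The involution $z \mapsto -1/z$ fixes $\mathrm i$ and has derivative $-1$ there, so a
combination $f$ of the components with $f|_lS = \varepsilon f$ that vanishes to order $n$ at
$\mathrm i$ has $\varepsilon = (-1)^n\,\mathrm{i}^{-l}$
(\<open>slash_S_eigenfunction_order\<close>). The orders of vanishing are the three numbers
$\kappa_{\mathrm i}^{(j)}$ shifted by a common constant (\<open>order_is_local_exponent\<close>), and a
three-dimensional space attains all three of them.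

Finally $\sum_j 3\kappa_{\mathrm i}^{(j)} = 9$ is odd and
$3\kappa_{\mathrm i}^{(j)} \equiv 3\kappa_{\mathrm i}^{(1)} + (\kappa_{\mathrm i}^{(j)} -
\kappa_{\mathrm i}^{(1)})$ modulo $2$, so the numbers $3\kappa_{\mathrm i}^{(j)}$ are
$\{0,0,1\}$ modulo $2$ unless both differences are even, when they are $\{1,1,1\}$.

The analytic steps avoid the multivalued functions \<open>F\<close> and \<open>y\<close>. With $F^3 = \Phi$ meromorphic on the
upper half plane, the logarithmic derivative $\psi = y'/y = h'/(3h)$, $h = f^3/\Phi = y^3$, is
meromorphic on the whole upper half plane and satisfies the Riccati form of the equation there
(\<open>riccati_continuation\<close>). Comparing leading terms in it gives the indicial equations, at $\mathrm i$
from the pole of $\psi$ and at the cusp from the constant term of $\psi$ as a power series in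
$q$. That $\psi$ is such a series needs moderate growth of $y$ at the cusp; on a half plane without
zeros and poles of $\Phi$ the function $y$ is single-valued, and a Gronwall estimate applies.\<close>

text \<open>The dollar sign denotes components of vectors and matrices throughout.\<close>

no_notation fps_nth (infixl "$" 75)


section \<open>Involutions and their products in dimension three\<close>

lemma rho_pt_root: "1 + rho_pt + rho_pt^2 = 0" "rho_pt^3 = 1"
proof -
  show *: "1 + rho_pt + rho_pt^2 = 0"
    unfolding rho_pt_def
    by (simp add: complex_eq_iff power2_eq_square field_simps)
  have "rho_pt^3 - 1 = (rho_pt - 1) * (1 + rho_pt + rho_pt^2)" by algebra
  with * show "rho_pt^3 = 1" by simp
qed

text \<open>The factorisation $X^3 - s^3 = (X - s)(X - s\rho)(X - s\rho^2)$ with $\rho$ a primitive cube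
root of unity, applied to a matrix.\<close>

lemma det_cube_minus_cube:
  fixes B :: "complex^3^3" and s :: complex
  shows "det (B ** B ** B - mat (s^3)) =
    det (B - mat s) * det (B - mat (s * rho_pt)) * det (B - mat (s * rho_pt^2))"
proof -
  let ?w = rho_pt
  have "(B - mat s) ** (B - mat (s * ?w)) ** (B - mat (s * ?w^2)) =
      B ** B ** B - mat (s * (1 + ?w + ?w^2)) ** B ** B
      + mat (s^2 * (?w + ?w^2 + ?w^3)) ** B - mat (s^3 * ?w^3)"
    by (simp add: matrix_matrix_mult_def mat_def vec_eq_iff sum_3 forall_3
          power2_eq_square power3_eq_cube algebra_simps)
  also have "?w + ?w^2 + ?w^3 = 0" using rho_pt_root by algebra
  finally have "B ** B ** B - mat (s^3) = (B - mat s) ** (B - mat (s * ?w)) ** (B - mat (s * ?w^2))"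
    using rho_pt_root by (simp add: mat_0)
  thus ?thesis by (simp add: det_mul)
qed

text \<open>The characteristic polynomial splits over the complex numbers; its constant term is the
determinant.\<close>

lemma det_eq_product_of_eigenvalues:
  fixes B :: "complex^3^3"
  obtains a b c where "det B = a * b * c"
    "det (B - mat a) = 0" "det (B - mat b) = 0" "det (B - mat c) = 0"
proof -
  define p where "p = [:- det B,
     B$1$1 * B$2$2 + B$1$1 * B$3$3 + B$2$2 * B$3$3
       - B$1$2 * B$2$1 - B$1$3 * B$3$1 - B$2$3 * B$3$2,
     - (B$1$1 + B$2$2 + B$3$3), 1:]"
  have p: "det (B - mat x) = - poly p x" for x
    by (simp add: p_def det_3 mat_def algebra_simps)
  have deg: "degree p = 3" "lead_coeff p = 1" "p \<noteq> 0"
    by (simp_all add: p_def eval_nat_numeral)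
  obtain A where A: "size A = 3" "p = (\<Prod>x\<in>#A. [:-x, 1:])"
  proof
    show "size (proots p) = 3" using deg by (simp add: size_proots_complex)
    show "p = (\<Prod>x\<in>#proots p. [:-x, 1:])"
      using complex_poly_decompose_multiset[of p] deg by simp
  qed
  from A(1) have "size A = Suc 2" by simp
  then obtain a A1 where A1: "A = add_mset a A1" by (metis size_eq_Suc_imp_eq_union)
  with A(1) have "size A1 = Suc 1" by simp
  then obtain b A2 where A2: "A1 = add_mset b A2" by (metis size_eq_Suc_imp_eq_union)
  with A1 A(1) have "size A2 = 1" by simp
  then obtain c where "A2 = {#c#}" by (metis size_1_singleton_mset)
  with A1 A2 have abc: "A = {#a, b, c#}" by simp
  have "- det B = - (a * b * c)"
    using A(2) abc by (auto simp: p_def)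
  moreover have "poly p x = 0" if "x \<in> {a, b, c}" for x
    using that unfolding A(2) abc by (auto simp: algebra_simps)
  ultimately show ?thesis using p that[of a b c] by auto
qed

lemma singular_iff_eigenvector:
  fixes B :: "complex^3^3"
  shows "det (B - mat \<mu>) = 0 \<longleftrightarrow> (\<exists>v. v \<noteq> 0 \<and> B *v v = \<mu> *s v)"
proof -
  have m: "mat \<mu> *v v = \<mu> *s v" for v :: "complex^3"
    by (simp add: matrix_vector_mult_def mat_def vec_eq_iff sum_3 forall_3)
  have "det (B - mat \<mu>) = 0 \<longleftrightarrow> \<not> invertible (B - mat \<mu>)"
    by (simp add: invertible_det_nz)
  also have "\<dots> \<longleftrightarrow> (\<exists>v. v \<noteq> 0 \<and> (B - mat \<mu>) *v v = 0)"
    by (auto simp: invertible_left_inverse matrix_left_invertible_ker)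
  also have "\<dots> \<longleftrightarrow> (\<exists>v. v \<noteq> 0 \<and> B *v v = \<mu> *s v)"
    by (simp add: matrix_vector_mult_diff_rdistrib m)
  finally show ?thesis .
qed

text \<open>Here $A = A^{-1} = \operatorname{adj} A$. Together, $\operatorname{adj} A = A$ and $A^2 = 1$ say that
$(1 + \operatorname{tr} A)(A - 1) = 0$, so the trace is $-1$; then all $2\times 2$ minors of
$A + 1$ vanish and $A + 1$ has rank one.\<close>

lemma involution_rank_one:
  fixes A :: "complex^3^3"
  assumes inv: "A ** A = mat 1" and det: "det A = 1" and ne: "A \<noteq> mat 1"
  obtains p w where "A = (\<chi> i j. p$i * w$j) - mat 1"
proof -
  define t where "t = A$1$1 + A$2$2 + A$3$3"
  \<comment> \<open>the adjugate of \<open>A\<close>\<close>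
  define C :: "complex^3^3" where "C = (\<chi> i j. if i = 1 then
      (if j = 1 then A$2$2 * A$3$3 - A$2$3 * A$3$2
       else if j = 2 then A$1$3 * A$3$2 - A$1$2 * A$3$3
       else A$1$2 * A$2$3 - A$1$3 * A$2$2)
     else if i = 2 then
      (if j = 1 then A$2$3 * A$3$1 - A$2$1 * A$3$3
       else if j = 2 then A$1$1 * A$3$3 - A$1$3 * A$3$1
       else A$1$3 * A$2$1 - A$1$1 * A$2$3)
     else
      (if j = 1 then A$2$1 * A$3$2 - A$2$2 * A$3$1
       else if j = 2 then A$1$2 * A$3$1 - A$1$1 * A$3$2
       else A$1$1 * A$2$2 - A$1$2 * A$2$1))"
  have "C ** A = mat (det A)"
    by (simp add: C_def matrix_matrix_mult_def mat_def vec_eq_iff sum_3 forall_3 det_3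
       algebra_simps)
  hence "(C ** A) ** A = A" using det by simp
  hence CA: "C = A" using inv by (simp flip: matrix_mul_assoc)
  have cof: "C$i$j = A$i$j" for i j using CA by simp
  have sq: "(A ** A)$i$j = (mat 1 :: complex^3^3)$i$j" for i j using inv by simp
  have cof': "A$2$2 * A$3$3 - A$2$3 * A$3$2 = A$1$1" "A$1$3 * A$3$2 - A$1$2 * A$3$3 = A$1$2"
    "A$1$2 * A$2$3 - A$1$3 * A$2$2 = A$1$3" "A$2$3 * A$3$1 - A$2$1 * A$3$3 = A$2$1"
    "A$1$1 * A$3$3 - A$1$3 * A$3$1 = A$2$2" "A$1$3 * A$2$1 - A$1$1 * A$2$3 = A$2$3"
    "A$2$1 * A$3$2 - A$2$2 * A$3$1 = A$3$1" "A$1$2 * A$3$1 - A$1$1 * A$3$2 = A$3$2"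
    "A$1$1 * A$2$2 - A$1$2 * A$2$1 = A$3$3"
    using cof[of 1 1] cof[of 1 2] cof[of 1 3] cof[of 2 1] cof[of 2 2] cof[of 2 3]
      cof[of 3 1] cof[of 3 2] cof[of 3 3] by (simp_all add: C_def)
  have sq': "A$1$1 * A$1$1 + A$1$2 * A$2$1 + A$1$3 * A$3$1 = 1"
    "A$1$1 * A$1$2 + A$1$2 * A$2$2 + A$1$3 * A$3$2 = 0"
    "A$1$1 * A$1$3 + A$1$2 * A$2$3 + A$1$3 * A$3$3 = 0"
    "A$2$1 * A$1$1 + A$2$2 * A$2$1 + A$2$3 * A$3$1 = 0"
    "A$2$1 * A$1$2 + A$2$2 * A$2$2 + A$2$3 * A$3$2 = 1"
    "A$2$1 * A$1$3 + A$2$2 * A$2$3 + A$2$3 * A$3$3 = 0"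
    "A$3$1 * A$1$1 + A$3$2 * A$2$1 + A$3$3 * A$3$1 = 0"
    "A$3$1 * A$1$2 + A$3$2 * A$2$2 + A$3$3 * A$3$2 = 0"
    "A$3$1 * A$1$3 + A$3$2 * A$2$3 + A$3$3 * A$3$3 = 1"
    using sq[of 1 1] sq[of 1 2] sq[of 1 3] sq[of 2 1] sq[of 2 2] sq[of 2 3]
      sq[of 3 1] sq[of 3 2] sq[of 3 3]
    by (simp_all add: matrix_matrix_mult_def mat_def sum_3)
  have "(1 + t) * (A$1$1 - 1) = 0" using sq'(1) cof'(5) cof'(9) unfolding t_def by algebra
  moreover have "(1 + t) * (A$2$2 - 1) = 0" using sq'(5) cof'(1) cof'(9) unfolding t_def by algebra
  moreover have "(1 + t) * (A$3$3 - 1) = 0" using sq'(9) cof'(1) cof'(5) unfolding t_def by algebra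
  moreover have "(1 + t) * A$1$2 = 0" using sq'(2) cof'(2) unfolding t_def by algebra
  moreover have "(1 + t) * A$1$3 = 0" using sq'(3) cof'(3) unfolding t_def by algebra
  moreover have "(1 + t) * A$2$1 = 0" using sq'(4) cof'(4) unfolding t_def by algebra
  moreover have "(1 + t) * A$2$3 = 0" using sq'(6) cof'(6) unfolding t_def by algebra
  moreover have "(1 + t) * A$3$1 = 0" using sq'(7) cof'(7) unfolding t_def by algebra
  moreover have "(1 + t) * A$3$2 = 0" using sq'(8) cof'(8) unfolding t_def by algebra
  moreover have "\<not> (A$1$1 - 1 = 0 \<and> A$2$2 - 1 = 0 \<and> A$3$3 - 1 = 0 \<and> A$1$2 = 0 \<and> A$1$3 = 0
     \<and> A$2$1 = 0 \<and> A$2$3 = 0 \<and> A$3$1 = 0 \<and> A$3$2 = 0)"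
    using ne by (auto simp: vec_eq_iff forall_3 mat_def)
  ultimately have "1 + t = 0" by auto
  hence t: "A$1$1 + A$2$2 + A$3$3 + 1 = 0" unfolding t_def by (simp add: add.commute)
  define M where "M = A + mat 1"
  \<comment> \<open>The principal minors of \<open>M\<close> are $\operatorname{tr} A + 1 = 0$, the others are differences of equal entries of $A$ and its adjugate.\<close>
  have minors: "M$i$j * M$k$l = M$i$l * M$k$j" for i j k l
  proof -
    have diag: "(a + 1) * (b + 1) = c * d" if "a * b - c * d = e" "a + b + e + 1 = 0"
      for a b c d e :: complex
    proof -
      have "(a + 1) * (b + 1) - c * d = (a * b - c * d - e) + (a + b + e + 1)"
        by (simp add: algebra_simps)
      thus ?thesis using that by simp
    qed
    have "M$1$1 * M$2$2 = M$1$2 * M$2$1"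
      using diag[OF cof'(9)] t by (simp add: M_def mat_def add_ac)
    moreover have "M$1$1 * M$3$3 = M$1$3 * M$3$1"
      using diag[OF cof'(5)] t by (simp add: M_def mat_def add_ac)
    moreover have "M$2$2 * M$3$3 = M$2$3 * M$3$2"
      using diag[OF cof'(1)] t by (simp add: M_def mat_def add_ac)
    moreover have "M$1$1 * M$2$3 = M$1$3 * M$2$1"
      using cof'(6) by (simp add: M_def mat_def algebra_simps)
    moreover have "M$1$1 * M$3$2 = M$1$2 * M$3$1"
      using cof'(8) by (simp add: M_def mat_def algebra_simps)
    moreover have "M$2$2 * M$1$3 = M$1$2 * M$2$3"
      using cof'(3) by (simp add: M_def mat_def algebra_simps)
    moreover have "M$2$2 * M$3$1 = M$2$1 * M$3$2"
      using cof'(7) by (simp add: M_def mat_def algebra_simps)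
    moreover have "M$3$3 * M$1$2 = M$1$3 * M$3$2"
      using cof'(2) by (simp add: M_def mat_def algebra_simps)
    moreover have "M$3$3 * M$2$1 = M$2$3 * M$3$1"
      using cof'(4) by (simp add: M_def mat_def algebra_simps)
    ultimately have "\<forall>i j k l. M$i$j * M$k$l = M$i$l * M$k$j"
      unfolding forall_3 by (simp add: mult.commute)
    thus ?thesis by blast
  qed
  have "M \<noteq> 0"
  proof
    assume "M = 0"
    hence "A$i$j = - (mat 1 :: complex^3^3)$i$j" for i j
      unfolding M_def by (simp add: vec_eq_iff add_eq_0_iff2)
    thus False using t det by (simp add: det_3 mat_def)
  qed
  then obtain a b where ab: "M$a$b \<noteq> 0" by (auto simp: vec_eq_iff)
  \<comment> \<open>a rank one matrix is the product of any nonzero column and a multiple of any nonzero row\<close>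
  show ?thesis
  proof
    show "A = (\<chi> i j. (\<chi> i. M$i$b)$i * (\<chi> j. M$a$j / M$a$b)$j) - mat 1"
      using ab minors by (simp add: M_def vec_eq_iff field_simps)
  qed
qed

text \<open>From the cubic relation $(\det A)^3(\det B)^3 = 1$; the eigenvalue condition gives
$(\det B)^3 = 1$, so $\det A$ is both a square root and a cube root of unity.\<close>

lemma involution_det_one:
  fixes A B :: "complex^3^3"
  assumes A: "A ** A = mat 1"
    and AB: "(A ** B) ** (A ** B) ** (A ** B) = mat 1"
    and eig: "\<And>\<mu>. det (B - mat \<mu>) = 0 \<Longrightarrow> \<mu> ^ 3 = 1"
  shows "det A = 1"
proof -
  have detB: "det B ^ 3 = 1"
    by (rule det_eq_product_of_eigenvalues[of B]) (use eig in \<open>simp add: power_mult_distrib\<close>)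
  have "det A ^ 2 = 1" using arg_cong[OF A, of det] by (simp add: det_mul power2_eq_square)
  moreover have "det A ^ 3 * det B ^ 3 = 1"
    using arg_cong[OF AB, of det] by (simp add: det_mul power3_eq_cube mult_ac)
  ultimately show "det A = 1" using detB by (simp add: power2_eq_square power3_eq_cube)
qed

text \<open>Let $A = -1 + p\,w^T$. If $w$ vanishes on \<open>W\<close>, then $A = -1$ on \<open>W\<close>; otherwise \<open>W\<close> contains $p$
and $A = -1$ on the quotient by \<open>W\<close>. Where $A = -1$, $AB = -B$ and thus $B^3 = -1$. So $B^3 + 1$
kills \<open>W\<close> in the first case and maps everything into \<open>W\<close> in the second one, but it is invertible
since $-1$ is not the cube of an eigenvalue of \<open>B\<close>.\<close>

lemma no_invariant_subspace:
  fixes A B :: "complex^3^3" and W :: "(complex^3) set"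
  assumes A: "A ** A = mat 1" "A \<noteq> mat 1"
    and AB: "(A ** B) ** (A ** B) ** (A ** B) = mat 1"
    and eig: "\<And>\<mu>. det (B - mat \<mu>) = 0 \<Longrightarrow> \<mu> ^ 3 = 1"
    and W: "vec.subspace W" "\<And>v. v \<in> W \<Longrightarrow> A *v v \<in> W" "\<And>v. v \<in> W \<Longrightarrow> B *v v \<in> W"
  shows "W = {0} \<or> W = UNIV"
proof (rule ccontr)
  assume contra: "\<not> (W = {0} \<or> W = UNIV)"
  have "det A = 1" using A(1) AB eig by (rule involution_det_one)
  then obtain p w where pw: "A = (\<chi> i j. p$i * w$j) - mat 1"
    using involution_rank_one A by blast
  define \<phi> where "\<phi> x = (\<Sum>j\<in>UNIV. w$j * x$j)" for x :: "complex^3"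
  have Ax: "A *v x = \<phi> x *s p - x" for x
    unfolding pw \<phi>_def
    by (simp add: matrix_vector_mult_diff_rdistrib)
       (simp add: matrix_vector_mult_def vec_eq_iff sum_distrib_left mult_ac sum_distrib_right)
  \<comment> \<open>$B^3 + 1$, in the form to which the factorisation of $X^3 - s^3$ applies\<close>
  define K where "K = B ** B ** B - mat ((-1)^3)"
  have "rho_pt^6 = 1" using power_mult[of rho_pt 3 2] rho_pt_root(2) by simp
  hence "det K \<noteq> 0"
    unfolding K_def det_cube_minus_cube using eig[of "-1"] eig[of "- rho_pt"] eig[of "- (rho_pt^2)"]
      rho_pt_root(2) by (auto simp flip: power_mult)
  hence K: "invertible K" by (simp add: invertible_det_nz)
  have Kx: "K *v x = B *v (B *v (B *v x)) + x" for x
    unfolding K_def by (simp add: matrix_vector_mult_diff_rdistrib matrix_vector_mul_assoc matrix_mul_assoc)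
       (simp add: matrix_vector_mult_def mat_def vec_eq_iff sum_3 forall_3)
  define C where "C = A ** B"
  have C3: "C *v (C *v (C *v x)) = x" for x
    using AB by (simp add: matrix_vector_mul_assoc C_def matrix_mul_assoc)
  have Cx: "C *v x = A *v (B *v x)" for x by (simp add: C_def matrix_vector_mul_assoc)
  note add = vec.subspace_add[OF W(1)] and diff = vec.subspace_diff[OF W(1)]
    and scale = vec.subspace_scale[OF W(1)]
  show False
  proof (cases "\<forall>x\<in>W. \<phi> x = 0")
    case True
    hence A': "A *v x = - x" if "x \<in> W" for x using that by (simp add: Ax)
    have C': "C *v x \<in> W" "C *v x = - (B *v x)" if "x \<in> W" for x
      using that A' W by (auto simp: Cx)
    have neg: "M *v (- x) = - (M *v x)" for M :: "complex^3^3" and x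
      by (metis matrix_vector_mult_0_right matrix_vector_mult_diff_distrib diff_0)
    from contra W(1) obtain x where x: "x \<in> W" "x \<noteq> 0" using vec.subspace_0 by blast
    have "x = - (B *v (B *v (B *v x)))"
      using C3[of x] C'(1) C'(2) x W(3) by (simp add: neg)
    hence "K *v x = 0" unfolding Kx by (metis add.right_inverse add.commute)
    with K x show False by (auto simp: invertible_left_inverse matrix_left_invertible_ker)
  next
    case False
    then obtain y where y: "y \<in> W" "\<phi> y \<noteq> 0" by blast
    have "inverse (\<phi> y) *s (A *v y + y) \<in> W" by (intro add scale W y)
    hence p: "p \<in> W" using y by (simp add: Ax)
    have Ax': "A *v x + x \<in> W" for x using p scale by (simp add: Ax)
    have "K *v x \<in> W" for x
    proof -
      \<comment> \<open>modulo \<open>W\<close>, $C$ is $-B$\<close>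
      have 1: "C *v x + B *v x \<in> W" for x unfolding Cx by (rule Ax')
      have 2: "C *v (C *v x) - B *v (B *v x) \<in> W"
        using diff[OF 1[of "C *v x"] W(3)[OF 1[of x]]]
        by (simp add: matrix_vector_right_distrib)
      have "C *v (C *v (C *v x)) + B *v (B *v (B *v x)) \<in> W"
        using diff[OF 1[of "C *v (C *v x)"] W(3)[OF 2]]
        by (simp add: matrix_vector_mult_diff_distrib)
      thus ?thesis by (simp add: C3 Kx add.commute)
    qed
    moreover have "\<exists>x. K *v x = y" for y
      using K by (metis invertible_right_inverse matrix_vector_mul_assoc matrix_vector_mul_lid)
    ultimately have "W = UNIV" by (metis UNIV_eq_I)
    with contra show False by blast
  qed
qed

lemma cube_root_of_identity_eigenvector:
  fixes B :: "complex^3^3"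
  assumes "B ** B ** B = mat 1"
  obtains \<mu> v where "v \<noteq> 0" "B *v v = \<mu> *s v"
proof -
  have "det (B ** B ** B - mat (1^3)) = 0" using assms by (simp flip: mat_0 add: det_0)
  then obtain \<mu> where "det (B - mat \<mu>) = 0" unfolding det_cube_minus_cube by auto
  thus ?thesis using that by (auto simp: singular_iff_eigenvector)
qed


section \<open>Generators of the modular group and irreducibility\<close>

definition mat22 :: "int \<Rightarrow> int \<Rightarrow> int \<Rightarrow> int \<Rightarrow> int^2^2" where
  "mat22 a b c d = vector [vector [a, b], vector [c, d]]"

lemma mat22_nth [simp]:
  "mat22 a b c d $ 1 $ 1 = a" "mat22 a b c d $ 1 $ 2 = b"
  "mat22 a b c d $ 2 $ 1 = c" "mat22 a b c d $ 2 $ 2 = d"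
  by (simp_all add: mat22_def)

lemma mat22_eqI: "A = mat22 (A$1$1) (A$1$2) (A$2$1) (A$2$2)"
  by (simp add: vec_eq_iff forall_2)

lemma mat22_mult:
  "mat22 a b c d ** mat22 a' b' c' d' =
     mat22 (a * a' + b * c') (a * b' + b * d') (c * a' + d * c') (c * b' + d * d')"
  by (simp add: vec_eq_iff forall_2 matrix_matrix_mult_def sum_2)

lemma det_mat22: "det (mat22 a b c d) = a * d - b * c"
  by (simp add: det_2)

text \<open>The Euclidean algorithm on the first column: multiplication by $T^{-k}$ and $S$ replaces the
lower left entry $c$ by the remainder of the upper left entry modulo $c$.\<close>

lemma SL2Z_generated:
  assumes S: "P (mat22 0 (-1) 1 0)" and T: "P (mat22 1 1 0 1)" and T': "P (mat22 1 (-1) 0 1)"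
    and mult: "\<And>A B. det A = 1 \<Longrightarrow> det B = 1 \<Longrightarrow> P A \<Longrightarrow> P B \<Longrightarrow> P (A ** B)"
    and A: "det A = 1"
  shows "P A"
proof -
  let ?S = "mat22 0 (-1) 1 0"
  have S2: "P (mat22 (-1) 0 0 (-1))"
    using mult[OF _ _ S S] by (simp add: mat22_mult det_mat22)
  have one: "P (mat22 1 0 0 1)"
    using mult[OF _ _ S2 S2] by (simp add: mat22_mult det_mat22)
  have Tpow: "P (mat22 1 k 0 1)" for k
  proof (induction k rule: int_induct[where k = 0])
    case base show ?case by (rule one)
  next
    case (step1 i) thus ?case using mult[OF _ _ T step1(2)] by (simp add: mat22_mult det_mat22 add.commute)
  next
    case (step2 i) thus ?case using mult[OF _ _ T' step2(2)] by (simp add: mat22_mult det_mat22)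
  qed
  have "P (mat22 a b c d)" if "a * d - b * c = 1" for a b c d
    using that
  proof (induction "nat \<bar>c\<bar>" arbitrary: a b c d rule: less_induct)
    case less
    show ?case
    proof (cases "c = 0")
      case True
      with less.prems have "a = 1 \<and> d = 1 \<or> a = -1 \<and> d = -1"
        using pos_zmult_eq_1_iff_lemma zmult_eq_1_iff by auto
      thus ?thesis
      proof
        assume "a = 1 \<and> d = 1" thus ?thesis using Tpow[of b] True by simp
      next
        assume *: "a = -1 \<and> d = -1"
        show ?thesis using mult[OF _ _ S2 Tpow[of "-b"]] * True by (simp add: mat22_mult det_mat22)
      qed
    next
      case False
      define k r where "k = a div c" and "r = a mod c"
      have a: "a = k * c + r" by (simp add: k_def r_def)
      have "nat \<bar>r\<bar> < nat \<bar>c\<bar>" using abs_mod_less[OF False, of a] by (simp add: r_def)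
      moreover have "(-c) * (b - k * d) - (-d) * r = 1" using less.prems unfolding a
        by (simp add: algebra_simps)
      ultimately have "P (mat22 (-c) (-d) r (b - k * d))" by (rule less.hyps)
      \<comment> \<open>Since $S^{-1} = -S$, undo the reduction by $S$, $-1$ and $T^k$ in turn.\<close>
      hence "P (?S ** mat22 (-c) (-d) r (b - k * d))"
        using less.prems by (intro mult S) (auto simp: det_mat22 a algebra_simps)
      hence "P (mat22 (-r) (k*d-b) (-c) (-d))" by (simp add: mat22_mult)
      hence "P (mat22 (-1) 0 0 (-1) ** mat22 (-r) (k*d-b) (-c) (-d))"
        using less.prems by (intro mult S2) (auto simp: det_mat22 a algebra_simps)
      hence "P (mat22 r (b-k*d) c d)" by (simp add: mat22_mult)
      hence "P (mat22 1 k 0 1 ** mat22 r (b-k*d) c d)"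
        using less.prems by (intro mult Tpow) (auto simp: det_mat22 a algebra_simps)
      thus ?thesis by (simp add: mat22_mult a add.commute)
    qed
  qed
  from this[of "A$1$1" "A$2$2" "A$1$2" "A$2$1"] A show ?thesis
    by (subst mat22_eqI) (simp add: det_2)
qed

lemma SL2Z_relations:
  fixes R :: "int^2^2 \<Rightarrow> complex^3^3"
  assumes R_mult: "\<And>\<gamma> \<delta>. \<lbrakk>det \<gamma> = 1; det \<delta> = 1\<rbrakk> \<Longrightarrow> R (\<gamma> ** \<delta>) = R \<gamma> ** R \<delta>"
    and neg_one: "R (mat22 (-1) 0 0 (-1)) = mat 1"
  defines "A \<equiv> R (mat22 0 (-1) 1 0)" and "B \<equiv> R (mat22 1 1 0 1)"
  shows "A ** A = mat 1" "(A ** B) ** (A ** B) ** (A ** B) = mat 1"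
proof -
  have det1: "det (mat22 0 (-1) 1 0) = 1" "det (mat22 1 1 0 1) = 1" by (simp_all add: det_mat22)
  show "A ** A = mat 1"
    using R_mult[OF det1(1) det1(1)] neg_one by (simp add: A_def mat22_mult)
  have AB: "A ** B = R (mat22 0 (-1) 1 1)"
    using R_mult[OF det1(1,2)] by (simp add: A_def B_def mat22_mult)
  have "R (mat22 0 (-1) 1 1) ** R (mat22 0 (-1) 1 1) = R (mat22 (-1) (-1) 1 0)"
    using R_mult[of "mat22 0 (-1) 1 1" "mat22 0 (-1) 1 1"] by (simp add: det_mat22 mat22_mult)
  moreover have "R (mat22 (-1) (-1) 1 0) ** R (mat22 0 (-1) 1 1) = R (mat22 (-1) 0 0 (-1))"
    using R_mult[of "mat22 (-1) (-1) 1 0" "mat22 0 (-1) 1 1"] by (simp add: det_mat22 mat22_mult)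
  ultimately show "(A ** B) ** (A ** B) ** (A ** B) = mat 1" unfolding AB using neg_one by simp
qed

text \<open>If \<open>S\<close> acts trivially, then the relation $(ST)^3 = 1$ makes the matrix of \<open>T\<close> a cube root of the
identity; it has an eigenvector, whose line is invariant under both generators. The other direction
is \<open>no_invariant_subspace\<close>.\<close>

lemma irreducible_iff_S_nontrivial:
  fixes R :: "int^2^2 \<Rightarrow> complex^3^3"
  assumes R_mult: "\<And>\<gamma> \<delta>. \<lbrakk>det \<gamma> = 1; det \<delta> = 1\<rbrakk> \<Longrightarrow> R (\<gamma> ** \<delta>) = R \<gamma> ** R \<delta>"
    and neg_one: "R (mat22 (-1) 0 0 (-1)) = mat 1"
    and eigT: "\<And>\<mu>. det (R (mat22 1 1 0 1) - mat \<mu>) = 0 \<Longrightarrow> \<mu> ^ 3 = 1"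
  shows "irreducible_rep R \<longleftrightarrow> R (mat22 0 (-1) 1 0) \<noteq> mat 1"
proof -
  define A where "A = R (mat22 0 (-1) 1 0)"
  define B where "B = R (mat22 1 1 0 1)"
  have A2: "A ** A = mat 1" and AB3: "(A ** B) ** (A ** B) ** (A ** B) = mat 1"
    unfolding A_def B_def using SL2Z_relations[of R] R_mult neg_one by blast+
  have eigB: "\<mu> ^ 3 = 1" if "det (B - mat \<mu>) = 0" for \<mu>
    using eigT that unfolding B_def by blast
  have det1: "det (mat22 0 (-1) 1 0) = 1" "det (mat22 1 1 0 1) = 1" "det (mat22 1 (-1) 0 1) = 1"
    "det (mat22 (-1) 0 0 (-1)) = 1"
    by (simp_all add: det_mat22)
  have "irreducible_rep R \<longleftrightarrow> A \<noteq> mat 1"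
  proof
    assume irr: "irreducible_rep R"
    show "A \<noteq> mat 1"
    proof
      assume A1: "A = mat 1"
      hence B3: "B ** B ** B = mat 1" using AB3 by simp
      obtain \<mu> v where v: "v \<noteq> 0" "B *v v = \<mu> *s v" by (rule cube_root_of_identity_eigenvector[OF B3])
      have \<mu>: "\<mu> \<noteq> 0"
      proof
        assume "\<mu> = 0"
        hence "B *v (B *v (B *v v)) = 0" using v(2) by simp
        hence "v = 0" using B3 by (simp add: matrix_vector_mul_assoc matrix_mul_assoc)
        with v(1) show False by contradiction
      qed
      have line: "\<exists>\<alpha>. R \<gamma> *v v = \<alpha> *s v" if "det \<gamma> = 1" for \<gamma>
      proof (rule SL2Z_generated[OF _ _ _ _ that])
        show "\<exists>\<alpha>. R (mat22 0 (-1) 1 0) *v v = \<alpha> *s v"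
          using A1 by (intro exI[of _ 1]) (simp add: A_def)
        show "\<exists>\<alpha>. R (mat22 1 1 0 1) *v v = \<alpha> *s v" using v(2) by (auto simp: B_def)
        have "R (mat22 1 (-1) 0 1) ** B = R (mat22 1 0 0 1)"
          using R_mult[OF det1(3,2)] by (simp add: B_def mat22_mult)
        also have "\<dots> = mat 1"
          using R_mult[OF det1(4) det1(4)] neg_one by (simp add: mat22_mult)
        finally have "R (mat22 1 (-1) 0 1) *v (B *v v) = v" by (simp add: matrix_vector_mul_assoc)
        hence "\<mu> *s (R (mat22 1 (-1) 0 1) *v v) = v" unfolding v(2) by (simp add: vector_scalar_commute)
        hence "R (mat22 1 (-1) 0 1) *v v = inverse \<mu> *s v" using \<mu>
          by (metis vector_smult_assoc left_inverse vector_smult_lid)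
        thus "\<exists>\<alpha>. R (mat22 1 (-1) 0 1) *v v = \<alpha> *s v" by blast
        show "\<exists>\<alpha>. R (\<gamma> ** \<delta>) *v v = \<alpha> *s v"
          if asm: "det \<gamma> = 1" "det \<delta> = 1" "\<exists>\<alpha>. R \<gamma> *v v = \<alpha> *s v" "\<exists>\<alpha>. R \<delta> *v v = \<alpha> *s v" for \<gamma> \<delta>
        proof -
          obtain x y where "R \<gamma> *v v = x *s v" "R \<delta> *v v = y *s v" using asm by blast
          hence "R (\<gamma> ** \<delta>) *v v = (y * x) *s v"
            using R_mult[OF asm(1,2)] by (simp add: vector_scalar_commute flip: matrix_vector_mul_assoc)
          thus ?thesis by blast
        qed
      qed
      define W where "W = range (\<lambda>\<alpha>. \<alpha> *s v)"
      have "vec.subspace W"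
        unfolding vec.subspace_def W_def
        by (auto simp: image_iff intro: exI[of _ 0] simp flip: vector_sadd_rdistrib)
      moreover have "R \<gamma> *v w \<in> W" if asm: "\<gamma> \<in> carrier SL2Z" "w \<in> W" for \<gamma> w
      proof -
        obtain \<alpha> where "w = \<alpha> *s v" using asm(2) by (auto simp: W_def)
        moreover obtain \<beta> where "R \<gamma> *v v = \<beta> *s v" using line[of \<gamma>] asm(1) by (auto simp: SL2Z_def)
        ultimately have "R \<gamma> *v w = (\<alpha> * \<beta>) *s v" by (simp add: vector_scalar_commute)
        thus ?thesis unfolding W_def by (rule range_eqI)
      qed
      ultimately have "W = {0} \<or> W = UNIV" using irr unfolding irreducible_rep_def by blast
      thus False
      proof
        assume "W = {0}"
        moreover have "1 *s v \<in> W" unfolding W_def by (rule rangeI)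
        ultimately show False using v(1) by simp
      next
        assume "W = UNIV"
        hence "axis 1 1 \<in> W" "axis 2 1 \<in> W" by simp_all
        then obtain x y where xy: "axis 1 1 = x *s v" "axis 2 1 = y *s v" unfolding W_def by blast
        have "x * v $ 1 = 1" "x * v $ 2 = 0" "y * v $ 2 = 1"
          using arg_cong[OF xy(1), of "\<lambda>u. u $ 1"] arg_cong[OF xy(1), of "\<lambda>u. u $ 2"]
            arg_cong[OF xy(2), of "\<lambda>u. u $ 2"] by (simp_all add: axis_def)
        thus False by auto
      qed
    qed
  next
    assume A1: "A \<noteq> mat 1"
    show "irreducible_rep R" unfolding irreducible_rep_def
    proof (intro allI impI)
      fix W assume W: "vec.subspace W \<and> (\<forall>\<gamma>\<in>carrier SL2Z. \<forall>v\<in>W. R \<gamma> *v v \<in> W)"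
      show "W = {0} \<or> W = UNIV"
      proof (rule no_invariant_subspace[OF A2 A1 AB3 eigB])
        show "A *v v \<in> W" "B *v v \<in> W" if "v \<in> W" for v
          using W that det1 unfolding A_def B_def by (auto simp: SL2Z_def)
      qed (use W in auto)
    qed
  qed
  thus ?thesis unfolding A_def .
qed


section \<open>Periodic functions on half planes and q-expansions\<close>

lemma open_uhp: "open uhp"
  unfolding uhp_def by (rule open_halfspace_Im_gt)

lemma convex_uhp: "convex uhp"
  unfolding uhp_def by (rule convex_halfspace_Im_gt)

definition upper_halfplane :: "real \<Rightarrow> complex set" where
  "upper_halfplane M = {z. M < Im z}"

lemma open_upper_halfplane: "open (upper_halfplane M)"
  unfolding upper_halfplane_def by (rule open_halfspace_Im_gt)

lemma convex_upper_halfplane: "convex (upper_halfplane M)"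
  unfolding upper_halfplane_def by (rule convex_halfspace_Im_gt)

lemma isCont_eq_zero_if_eventually_zero:
  fixes k :: "complex \<Rightarrow> complex"
  assumes "isCont k z" "\<forall>\<^sub>F w in at z. k w = 0"
  shows "k z = 0"
proof -
  have "(k \<longlongrightarrow> 0) (at z)" using assms(2) by (rule tendsto_eventually)
  with assms(1) show ?thesis using LIM_unique by (auto simp: isCont_def)
qed

lemma isCont_holomorphic: "k holomorphic_on S \<Longrightarrow> open S \<Longrightarrow> z \<in> S \<Longrightarrow> isCont k z"
  using continuous_on_eq_continuous_at holomorphic_on_imp_continuous_on by blast

lemma norm_to_q: "norm (to_q z) = exp (- 2 * pi * Im z)"
  by (simp add: to_q_def)

lemma norm_to_q_less_iff: "norm (to_q z) < exp (- 2 * pi * M) \<longleftrightarrow> M < Im z"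
  by (simp add: norm_to_q)

lemma to_q_nonzero [simp]: "to_q z \<noteq> 0"
  by (simp add: to_q_def)

lemma to_q_add_of_int: "to_q (z + of_int n) = to_q z"
  unfolding to_q_def by (simp add: exp_eq algebra_simps)

lemma to_q_eq_iff: "to_q z = to_q w \<longleftrightarrow> (\<exists>n::int. z = w + of_int n)"
proof
  assume "to_q z = to_q w"
  then obtain n :: int where "2 * of_real pi * \<i> * z = 2 * of_real pi * \<i> * w + (of_int (2 * n) * pi) * \<i>"
    unfolding to_q_def exp_eq by blast
  hence "(2 * of_real pi * \<i>) * z = (2 * of_real pi * \<i>) * (w + of_int n)"
    by (simp add: algebra_simps)
  thus "\<exists>n::int. z = w + of_int n"
    by (metis mult_cancel_left complex_i_not_zero mult_eq_0_iff of_real_eq_0_iff pi_neq_zero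
        zero_neq_numeral)
qed (auto simp: to_q_add_of_int)

lemma to_q_surj: "q \<noteq> 0 \<Longrightarrow> to_q (Ln q / (2 * of_real pi * \<i>)) = q"
  by (simp add: to_q_def)

lemma has_field_derivative_to_q:
  "(to_q has_field_derivative 2 * of_real pi * \<i> * to_q z) (at z)"
  unfolding to_q_def by (auto intro!: derivative_eq_intros)

lemma deriv_q_series:
  assumes "P holomorphic_on ball 0 r" "to_q z \<in> ball 0 r"
  shows "deriv (\<lambda>z. P (to_q z)) z = 2 * of_real pi * \<i> * to_q z * deriv P (to_q z)"
proof -
  have "(P has_field_derivative deriv P (to_q z)) (at (to_q z))"
    using assms by (intro holomorphic_derivI[OF _ open_ball])
  from DERIV_chain2[OF this has_field_derivative_to_q] show ?thesis
    by (intro DERIV_imp_deriv) (simp add: mult_ac)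
qed

lemma periodic_upper_halfplane_add_of_int:
  assumes "\<And>z. M < Im z \<Longrightarrow> f (z + 1) = f (z :: complex)" "M < Im z"
  shows "f (z + of_int n) = f z"
proof (induction n rule: int_induct[where k = 0])
  case (step1 i) thus ?case using assms(1)[of "z + of_int i"] assms(2) by (simp add: add_ac)
next
  case (step2 i) thus ?case using assms(1)[of "z + of_int (i - 1)"] assms(2) by (simp add: add_ac)
qed auto

text \<open>The function $g(q) = f(\log q / 2\pi\mathrm i)$ does not depend on the branch of the
logarithm because $f$ is periodic; near any $q_0 \neq 0$ it is therefore given by a holomorphic
branch, also on the cut of the principal one.\<close>

lemma holomorphic_periodic_factors_through_to_q:
  assumes hol: "f holomorphic_on upper_halfplane M"
    and per: "\<And>z. M < Im z \<Longrightarrow> f (z + 1) = f z"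
  obtains g where "g holomorphic_on ball 0 (exp (- 2 * pi * M)) - {0}"
    "\<And>z. M < Im z \<Longrightarrow> f z = g (to_q z)"
proof
  define g where "g q = f (Ln q / (2 * of_real pi * \<i>))" for q
  have shift: "f z = f w" if "to_q z = to_q w" "M < Im w" for z w
    using that periodic_upper_halfplane_add_of_int[where f = f and M = M, OF per] by (auto simp: to_q_eq_iff)
  show "f z = g (to_q z)" if z: "M < Im z" for z
  proof -
    have "to_q (Ln (to_q z) / (2 * of_real pi * \<i>)) = to_q z"
      by (simp add: to_q_def)
    thus ?thesis unfolding g_def using shift z by metis
  qed
  define D where "D = ball (0::complex) (exp (- 2 * pi * M)) - {0}"
  have "\<exists>e>0. g holomorphic_on ball q0 e" if q0: "q0 \<in> D" for q0
  proof -
    have "open D" by (auto simp: D_def)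
    then obtain e1 where e1: "e1 > 0" "ball q0 e1 \<subseteq> D" using q0 openE by blast
    have q0': "q0 \<noteq> 0" using q0 by (simp add: D_def)
    define e where "e = min e1 (norm q0)"
    \<comment> \<open>a branch of $\log q/2\pi\mathrm i$ near \<open>q0\<close>: there $q/q_0$ avoids the cut\<close>
    define L where "L q = (Ln (q / q0) + Ln q0) / (2 * of_real pi * \<i>)" for q
    have ball: "ball q0 e \<subseteq> D" using e1 by (auto simp: e_def)
    have nonneg: "q / q0 \<notin> \<real>\<^sub>\<le>\<^sub>0" if "q \<in> ball q0 e" for q
    proof
      assume "q / q0 \<in> \<real>\<^sub>\<le>\<^sub>0"
      hence "Re (q / q0) \<le> 0" by (auto elim!: nonpos_Reals_cases)
      hence "1 \<le> norm (q / q0 - 1)" using complex_Re_le_cmod[of "1 - q / q0"]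
        by (simp add: norm_minus_commute)
      also have "q / q0 - 1 = (q - q0) / q0" using q0' by (simp add: field_simps)
      finally have "norm q0 \<le> norm (q - q0)" using q0' by (simp add: norm_divide field_simps)
      thus False using that by (auto simp: e_def dist_norm norm_minus_commute)
    qed
    have qL: "to_q (L q) = q" if "q \<in> D" for q
    proof -
      have "q \<noteq> 0" using that by (simp add: D_def)
      thus ?thesis using q0' by (simp add: to_q_def L_def exp_add)
    qed
    have ImL: "M < Im (L q)" if "q \<in> D" for q
      using qL[OF that] that norm_to_q_less_iff[of "L q" M] by (simp add: D_def)
    have "f \<circ> L holomorphic_on ball q0 e"
    proof (rule holomorphic_on_compose_gen[OF _ hol])
      show "L holomorphic_on ball q0 e" unfolding L_def
        using q0' nonneg by (intro holomorphic_intros) auto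
      show "L ` ball q0 e \<subseteq> upper_halfplane M"
        using ImL ball by (auto simp: upper_halfplane_def)
    qed
    moreover have "g q = (f \<circ> L) q" if "q \<in> ball q0 e" for q
    proof -
      have q: "q \<in> D" using that ball by blast
      hence "to_q (Ln q / (2 * of_real pi * \<i>)) = q"
        by (simp add: to_q_def D_def)
      hence "to_q (Ln q / (2 * of_real pi * \<i>)) = to_q (L q)" using qL[OF q] by (rule trans[OF _ sym])
      from shift[OF this ImL[OF q]] show ?thesis unfolding g_def o_def .
    qed
    ultimately have "g holomorphic_on ball q0 e" by (subst holomorphic_cong[OF refl]) auto
    moreover have "e > 0" using e1 q0' by (simp add: e_def)
    ultimately show ?thesis by blast
  qed
  hence "g analytic_on D" unfolding analytic_on_def by blast
  thus "g holomorphic_on ball 0 (exp (- 2 * pi * M)) - {0}"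
    unfolding D_def by (rule analytic_imp_holomorphic)
qed

text \<open>A growth bound that is exponential in $\operatorname{Im} z$ is a polynomial bound in $1/|q|$, so that the function
of $q$ has at most a pole at $q = 0$; splitting off the exact power of $q$ leaves a zero-free
factor. The bound is only asked for in a strip of width one, which suffices by
periodicity.\<close>

lemma periodic_moderate_growth_q_expansion:
  assumes hol: "f holomorphic_on upper_halfplane M"
    and per: "\<And>z. M < Im z \<Longrightarrow> f (z + 1) = f z"
    and growth: "\<And>z. \<lbrakk>M' \<le> Im z; 0 \<le> Re z; Re z \<le> 1\<rbrakk> \<Longrightarrow> norm (f z) \<le> C * exp (K * Im z)"
    and nz: "M < Im z0" "f z0 \<noteq> 0"
  obtains m :: int and G r where "r > 0" "G holomorphic_on ball 0 r" "\<And>q. q \<in> ball 0 r \<Longrightarrow> G q \<noteq> 0"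
    "\<And>z. to_q z \<in> ball 0 r \<Longrightarrow> M < Im z \<and> f z = to_q z powi m * G (to_q z)"
proof -
  define R where "R = exp (- 2 * pi * M)"
  obtain g where g: "g holomorphic_on ball 0 R - {0}" "\<And>z. M < Im z \<Longrightarrow> f z = g (to_q z)"
    using holomorphic_periodic_factors_through_to_q[OF hol per] unfolding R_def by metis
  \<comment> \<open>Since $|q| = e^{-2\pi\operatorname{Im} z}$, the factor $q^N$ compensates the growth $e^{K\operatorname{Im} z}$.\<close>
  define N where "N = nat \<lceil>K / (2 * pi)\<rceil>"
  have N: "K \<le> 2 * pi * real N"
  proof -
    have "K / (2 * pi) \<le> real N" unfolding N_def by linarith
    thus ?thesis by (simp add: field_simps)
  qed
  \<comment> \<open>above this height $K\operatorname{Im} z \le 2\pi N\operatorname{Im} z$\<close>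
  define M1 where "M1 = max (max M' M) 0"
  have bound: "norm (q ^ N * g q) \<le> \<bar>C\<bar>" if q: "q \<noteq> 0" "norm q < exp (- 2 * pi * M1)" for q
  proof -
    define z1 where "z1 = Ln q / (2 * of_real pi * \<i>)"
    \<comment> \<open>the preimage of $q$ in the strip where the growth bound holds\<close>
    define z where "z = z1 + of_int (- \<lfloor>Re z1\<rfloor>)"
    have qz: "to_q z = q" unfolding z_def to_q_add_of_int using q by (simp add: to_q_def z1_def)
    have Im: "M1 < Im z" using q qz norm_to_q_less_iff[of z M1] by simp
    have "Re z = Re z1 - of_int \<lfloor>Re z1\<rfloor>" by (simp add: z_def)
    hence Re: "0 \<le> Re z" "Re z \<le> 1" by linarith+
    have "norm (g q) = norm (f z)" using g(2)[of z] Im qz by (simp add: M1_def)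
    also have "\<dots> \<le> C * exp (K * Im z)" using growth[of z] Im Re by (simp add: M1_def)
    also have "\<dots> \<le> \<bar>C\<bar> * exp (2 * pi * real N * Im z)"
      using N Im by (intro mult_mono) (auto simp: M1_def)
    finally have "norm (g q) \<le> \<bar>C\<bar> * exp (2 * pi * real N * Im z)" .
    moreover have "norm (q ^ N) = exp (- (2 * pi * real N * Im z))"
      unfolding norm_power qz[symmetric] norm_to_q by (simp add: exp_of_nat_mult[symmetric] mult_ac)
    ultimately have "norm (q ^ N * g q) \<le> exp (- (2 * pi * real N * Im z)) * (\<bar>C\<bar> * exp (2 * pi * real N * Im z))"
      unfolding norm_mult by (simp add: mult_left_mono)
    thus ?thesis by (simp add: exp_minus field_simps)
  qed
  have R: "R > 0" by (simp add: R_def)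
  have "\<forall>\<^sub>F q in at 0. norm (q ^ N * g q) \<le> \<bar>C\<bar>"
    unfolding eventually_at using bound by (intro exI[of _ "exp (- 2 * pi * M1)"]) auto
  hence "\<exists>h. h holomorphic_on ball 0 R \<and> (\<forall>q\<in>ball 0 R - {0}. h q = q ^ N * g q)"
    using g(1) R by (subst holomorphic_on_extend_bounded) (auto intro!: holomorphic_intros)
  then obtain h where h: "h holomorphic_on ball 0 R" "\<And>q. q \<in> ball 0 R - {0} \<Longrightarrow> h q = q ^ N * g q"
    by blast
  have q0: "to_q z0 \<in> ball 0 R - {0}" "g (to_q z0) \<noteq> 0"
    using nz g(2)[of z0] norm_to_q_less_iff[of z0 M] by (auto simp: R_def)
  hence h0: "h (to_q z0) \<noteq> 0" using h(2) by auto
  obtain k :: nat and G r where r: "r > 0" "r \<le> R" "G holomorphic_on ball 0 r"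
     "\<And>q. q \<in> ball 0 r \<Longrightarrow> G q \<noteq> 0" "\<And>q. q \<in> ball 0 r \<Longrightarrow> h q = q ^ k * G q"
  proof (cases "h 0 = 0")
    case True
    have nc: "\<not> h constant_on ball 0 R"
    proof
      assume "h constant_on ball 0 R"
      then obtain c where c: "\<And>q. q \<in> ball 0 R \<Longrightarrow> h q = c" unfolding constant_on_def by blast
      from c[of 0] c[of "to_q z0"] True h0 q0 R show False by auto
    qed
    have "0 \<in> ball (0::complex) R" using R by simp
    show ?thesis
    proof (rule holomorphic_factor_zero_nonconstant[OF h(1) open_ball connected_ball \<open>0 \<in> ball 0 R\<close> True nc])
      fix G r n
      assume *: "0 < r" "ball (0::complex) r \<subseteq> ball 0 R" "G holomorphic_on ball 0 r"
        "\<And>w. w \<in> ball 0 r \<Longrightarrow> h w = (w - 0) ^ n * G w" "\<And>w. w \<in> ball 0 r \<Longrightarrow> G w \<noteq> 0"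
      have "r \<le> R" using *(1,2) unfolding ball_subset_ball_iff by simp
      thus ?thesis using * by (intro that[of r G n]) auto
    qed
  next
    case False
    have "continuous_on (ball 0 R) h" using h(1) by (rule holomorphic_on_imp_continuous_on)
    hence "isCont h 0" using R by (simp add: continuous_on_eq_continuous_at)
    then obtain e where e: "e > 0" "\<And>q. dist q 0 < e \<Longrightarrow> h q \<noteq> 0"
      using False continuous_at_avoid[of 0 h 0] by (metis dist_commute)
    show ?thesis
    proof (rule that[of "min e R" h 0])
      show "h holomorphic_on ball 0 (min e R)"
        using h(1) by (rule holomorphic_on_subset) auto
    qed (use e R in auto)
  qed
  show ?thesis
  proof (rule that[OF r(1) r(3) r(4)])
    fix z assume z: "to_q z \<in> ball 0 r"
    hence zR: "to_q z \<in> ball 0 R" using r(2) by auto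
    hence M: "M < Im z" using norm_to_q_less_iff[of z M] by (simp add: R_def)
    have "to_q z ^ N * g (to_q z) = to_q z ^ k * G (to_q z)"
      using h(2)[of "to_q z"] zR r(5)[OF z] by simp
    hence "g (to_q z) = to_q z powi (int k - int N) * G (to_q z)"
      by (simp add: power_int_diff field_simps)
    thus "M < Im z \<and> f z = to_q z powi (int k - int N) * G (to_q z)" using M g(2) by simp
  qed auto
qed

lemma eventually_at_ii_inf: "(\<forall>\<^sub>F z in at_ii_inf. P z) \<longleftrightarrow> (\<exists>M. \<forall>z. M < Im z \<longrightarrow> P z)"
  unfolding at_ii_inf_def by (rule eventually_filtercomap_at_top_dense)

lemma at_ii_inf_neq_bot: "at_ii_inf \<noteq> bot"
proof
  assume "at_ii_inf = bot"
  hence "\<forall>\<^sub>F z in at_ii_inf. False" by simp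
  then obtain M where "\<And>z. M < Im z \<Longrightarrow> False" unfolding eventually_at_ii_inf by blast
  from this[of "Complex 0 (M + 1)"] show False by simp
qed

lemma to_q_tendsto_0: "(to_q \<longlongrightarrow> 0) at_ii_inf"
  unfolding tendsto_iff eventually_at_ii_inf
proof (intro allI impI)
  fix e :: real assume e: "0 < e"
  have "norm (to_q z) < e" if "- ln e / (2 * pi) < Im z" for z
  proof -
    have "- 2 * pi * Im z < ln e" using that by (simp add: field_simps)
    hence "exp (- 2 * pi * Im z) < exp (ln e)" by (simp only: exp_less_cancel_iff)
    thus ?thesis using e by (simp add: norm_to_q)
  qed
  thus "\<exists>M. \<forall>z. M < Im z \<longrightarrow> dist (to_q z) 0 < e" by auto
qed

lemma holomorphic_at_cuspE:
  assumes "holomorphic_at_cusp f"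
  obtains g M B r where "g holomorphic_on ball 0 r" "r > 0" "value_at_cusp f = g 0"
    "\<And>z. M < Im z \<Longrightarrow> f z = g (to_q z) \<and> to_q z \<in> ball 0 r \<and> norm (f z) \<le> B"
proof -
  obtain g where g: "g analytic_on {0}" "\<forall>\<^sub>F z in at_ii_inf. f z = g (to_q z)"
    using assms unfolding holomorphic_at_cusp_def by blast
  obtain r where r: "r > 0" "g holomorphic_on ball 0 r"
    using g(1) unfolding analytic_at_ball by blast
  have cont: "isCont g 0" using isCont_holomorphic[OF r(2)] r(1) by simp
  have lim: "((\<lambda>z. g (to_q z)) \<longlongrightarrow> g 0) at_ii_inf"
    by (rule isCont_tendsto_compose[OF cont to_q_tendsto_0])
  hence "(f \<longlongrightarrow> g 0) at_ii_inf"
    by (rule Lim_transform_eventually) (use g(2) in \<open>simp add: eq_commute\<close>)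
  hence val: "value_at_cusp f = g 0"
    unfolding value_at_cusp_def by (rule tendsto_Lim[OF at_ii_inf_neq_bot])
  have "\<forall>\<^sub>F z in at_ii_inf. dist (to_q z) 0 < r"
    using tendstoD[OF to_q_tendsto_0 r(1)] .
  moreover have "\<forall>\<^sub>F z in at_ii_inf. dist (g (to_q z)) (g 0) < 1"
    using tendstoD[OF lim, of 1] by simp
  ultimately have "\<forall>\<^sub>F z in at_ii_inf. f z = g (to_q z) \<and> to_q z \<in> ball 0 r \<and> norm (f z) \<le> norm (g 0) + 1"
    using g(2)
  proof eventually_elim
    case (elim z)
    have "norm (g (to_q z)) \<le> norm (g 0) + norm (g (to_q z) - g 0)" by norm
    thus ?case using elim by (simp add: dist_norm)
  qed
  then obtain M where "\<And>z. M < Im z \<Longrightarrow> f z = g (to_q z) \<and> to_q z \<in> ball 0 r \<and> norm (f z) \<le> norm (g 0) + 1"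
    unfolding eventually_at_ii_inf by blast
  thus ?thesis by (rule that[OF r(2,1) val])
qed


section \<open>Eisenstein series\<close>

lemma summable_on_inverse_square_int: "(\<lambda>n::int. 1 / (1 + (of_int n)^2) :: real) summable_on UNIV"
proof -
  have "summable (\<lambda>n::nat. 1 / (1 + (of_nat n)^2) :: real)"
  proof (rule summable_comparison_test')
    show "summable (\<lambda>n. inverse ((of_nat n)^2) :: real)"
      using inverse_power_summable[of 2] by simp
    show "norm (1 / (1 + (of_nat n)^2) :: real) \<le> inverse ((of_nat n)^2)" if "n \<ge> 1" for n
      using that by (simp add: field_simps add_pos_nonneg)
  qed
  hence nat: "(\<lambda>n::nat. 1 / (1 + (of_nat n)^2) :: real) summable_on UNIV"
    by (rule summable_nonneg_imp_summable_on) auto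
  let ?f = "\<lambda>n::int. 1 / (1 + (of_int n)^2) :: real"
  have "?f summable_on range int"
    by (subst summable_on_reindex) (use nat in \<open>auto simp: o_def inj_on_def\<close>)
  moreover have "?f summable_on range (\<lambda>n. - int n)"
    by (subst summable_on_reindex) (use nat in \<open>auto simp: o_def inj_on_def\<close>)
  ultimately have "?f summable_on (range int \<union> range (\<lambda>n. - int n))"
    by (rule summable_on_union)
  moreover have "range int \<union> range (\<lambda>n. - int n) = UNIV"
    by (auto simp: image_def) (metis int_cases2)
  ultimately show ?thesis by simp
qed

lemma summable_on_lattice:
  "(\<lambda>(m::int, n::int). 1 / ((1 + (of_int m)^2) * (1 + (of_int n)^2)) :: real) summable_on A"
proof (rule summable_on_subset_banach)
  let ?f = "\<lambda>n::int. 1 / (1 + (of_int n)^2) :: real"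
  have "(\<lambda>(m, n). ?f m * ?f n) summable_on (UNIV \<times> UNIV)"
  proof (rule summable_on_SigmaI)
    show "((\<lambda>y. case (x, y) of (m, n) \<Rightarrow> ?f m * ?f n) has_sum (?f x * infsum ?f UNIV)) UNIV" for x
      unfolding prod.case
      by (rule has_sum_cmult_right) (rule has_sum_infsum, rule summable_on_inverse_square_int)
    show "(\<lambda>x. ?f x * infsum ?f UNIV) summable_on UNIV"
      by (rule summable_on_cmult_left) (rule summable_on_inverse_square_int)
  qed auto
  thus "(\<lambda>(m::int, n::int). 1 / ((1 + (of_int m)^2) * (1 + (of_int n)^2)) :: real) summable_on UNIV"
    by simp
qed auto

text \<open>With $N = \max(|m|,|n|) \ge 1$ and $w = mz + n$, the imaginary part of $w$ controls $|m|$ and then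
its real part controls $|n|$, so $N \le K|w|$ with $K = 1/d + 1 + r/d$. Hence
$|w|^{-k} \le K^k N^{-4}$, and $(1 + m^2)(1 + n^2) \le 4N^4$.\<close>

lemma lattice_term_bound:
  fixes m n :: int and z :: complex
  assumes mn: "(m, n) \<noteq> (0, 0)" and z: "Im z \<ge> d" "\<bar>Re z\<bar> \<le> r" and d: "d > 0" and k: "k \<ge> 4"
  shows "norm (1 / (of_int m * z + of_int n) ^ k) \<le>
    4 * (1/d + 1 + r/d) ^ k * (1 / ((1 + (of_int m)^2) * (1 + (of_int n)^2)))"
proof -
  define w where "w = of_int m * z + of_int n"
  define K where "K = 1/d + 1 + r/d"
  define N :: real where "N = max \<bar>of_int m\<bar> \<bar>of_int n\<bar>"
  have r: "r \<ge> 0" using z(2) by linarith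
  have K: "K > 0" using d r by (auto simp: K_def intro!: add_pos_nonneg)
  have N: "N \<ge> 1" using mn by (auto simp: N_def le_max_iff_disj) 
  have "\<bar>of_int m\<bar> * d \<le> \<bar>of_int m\<bar> * Im z" using z by (intro mult_left_mono) auto
  also have "\<dots> = \<bar>Im w\<bar>" using z d by (simp add: w_def abs_mult)
  also have "\<dots> \<le> norm w" by (rule abs_Im_le_cmod)
  finally have m: "\<bar>of_int m\<bar> \<le> norm w / d" using d by (simp add: field_simps)
  have "\<bar>of_int n\<bar> = \<bar>Re w - of_int m * Re z\<bar>" by (simp add: w_def)
  also have "\<dots> \<le> \<bar>Re w\<bar> + \<bar>of_int m\<bar> * \<bar>Re z\<bar>" using abs_triangle_ineq4 by (simp add: abs_mult[symmetric])
  also have "\<dots> \<le> norm w + (norm w / d) * r"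
    using m z r d by (intro add_mono mult_mono abs_Re_le_cmod) auto
  finally have n: "\<bar>of_int n\<bar> \<le> norm w + norm w / d * r" .
  have nn: "0 \<le> norm w / d" "0 \<le> norm w / d * r" using d r by auto
  have "N \<le> norm w / d + norm w + norm w / d * r" unfolding N_def using m n nn by auto
  also have "\<dots> = K * norm w" by (simp add: K_def algebra_simps)
  finally have NK: "N \<le> K * norm w" .
  have Nk: "N ^ 4 \<le> (K * norm w) ^ k"
  proof -
    have "N ^ 4 \<le> N ^ k" using N k by (intro power_increasing) auto
    also have "\<dots> \<le> (K * norm w) ^ k" using NK N by (intro power_mono) auto
    finally show ?thesis .
  qed
  have sq: "1 + x^2 \<le> 2 * N^2" if "\<bar>x\<bar> \<le> N" for x
  proof -
    have "\<bar>x\<bar>^2 \<le> N^2" using that by (intro power_mono) auto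
    moreover have "1 \<le> N^2" using N by simp
    ultimately show ?thesis by simp
  qed
  have "(1 + (of_int m)^2) * (1 + (of_int n)^2) \<le> (2 * N^2) * (2 * N^2)"
    by (intro mult_mono sq) (auto simp: N_def)
  also have "\<dots> = 4 * N^4" by (simp add: power2_eq_square power4_eq_xxxx)
  also have "\<dots> \<le> 4 * (K^k * norm w ^ k)" using Nk by (simp add: power_mult_distrib)
  finally have main: "(1 + (of_int m)^2) * (1 + (of_int n)^2) \<le> 4 * (K^k * norm w ^ k)" .
  have "norm w ^ k > 0"
  proof -
    have "norm w \<noteq> 0" using NK N by auto
    thus ?thesis by simp
  qed
  moreover have "(1 + (of_int m)^2) * (1 + (of_int n)^2) > (0::real)" by (intro mult_pos_pos add_pos_nonneg) auto
  ultimately show ?thesis using main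
    by (simp add: norm_divide norm_power flip: w_def K_def) (simp add: field_simps)
qed

text \<open>Closed under polynomial expressions, so that with the Eisenstein series it contains
$\Delta$ and the functions $F_j$.\<close>

definition cusp_bounded_periodic :: "(complex \<Rightarrow> complex) \<Rightarrow> bool" where
  "cusp_bounded_periodic f \<longleftrightarrow> f holomorphic_on uhp \<and> (\<forall>z. f (z + 1) = f z) \<and>
     (\<exists>B. \<forall>z. Im z \<ge> 1 \<longrightarrow> norm (f z) \<le> B)"

text \<open>Locally uniform convergence by the Weierstrass test with the majorant \<open>lattice_term_bound\<close>; the
same majorant, with $d = r = 1$, bounds the function on a strip of width one. The period $1$ is the
substitution $(m, n) \mapsto (m, n + m)$ in the lattice sum.\<close>

lemma cusp_bounded_periodic_Eisenstein:
  assumes k: "k \<ge> 4"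
  shows "cusp_bounded_periodic (Eisenstein k)"
proof -
  define X where "X = (UNIV :: (int \<times> int) set) - {(0, 0)}"
  define t where "t = (\<lambda>(m, n) z. 1 / (of_int m * z + of_int n :: complex) ^ k)"
  define G where "G = (\<lambda>z. \<Sum>\<^sub>\<infinity>x\<in>X. t x z)"
  define c where "c = (2 * (\<Sum>n. 1 / of_nat (Suc n) ^ k) :: complex)"
  define M where "M d r = (\<lambda>(m, n). 4 * (1/d + 1 + r/d) ^ k * (1 / ((1 + (of_int m)^2) * (1 + (of_int n)^2))) :: real)"
    for d r :: real
  have E: "Eisenstein k z = G z / c" for z
    by (simp add: Eisenstein_def G_def c_def t_def X_def case_prod_unfold)
  have M: "M d r summable_on X" for d r
    using summable_on_cmult_right[OF summable_on_lattice[of X], of "4 * (1/d + 1 + r/d) ^ k"]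
    by (simp add: M_def case_prod_unfold)
  have bound: "norm (t x z) \<le> M d r x" if "x \<in> X" "Im z \<ge> d" "\<bar>Re z\<bar> \<le> r" "d > 0" for x z d r
    using lattice_term_bound[of "fst x" "snd x" d z r k] that k
    by (simp add: t_def M_def X_def case_prod_unfold prod_eq_iff)
  have per: "G (z + 1) = G z" for z
  proof -
    have "G (z + 1) = (\<Sum>\<^sub>\<infinity>x\<in>X. t ((\<lambda>(m, n). (m, n + m)) x) z)"
      unfolding G_def t_def by (intro infsum_cong) (auto simp: algebra_simps)
    also have "\<dots> = G z" unfolding G_def
    proof (rule infsum_reindex_bij_betw)
      show "bij_betw (\<lambda>(m, n). (m, n + m)) X X"
        by (rule bij_betwI[where g = "\<lambda>(m, n). (m, n - m)"]) (auto simp: X_def)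
    qed
    finally show ?thesis .
  qed
  have "G holomorphic_on uhp"
  proof -
    have "\<exists>r>0. G holomorphic_on ball z r" if z: "z \<in> uhp" for z
    proof -
      define r where "r = Im z / 2"
      have r: "r > 0" using z by (simp add: r_def uhp_def)
      have box: "Im w \<ge> r" "\<bar>Re w\<bar> \<le> \<bar>Re z\<bar> + r" if "w \<in> cball z r" for w
      proof -
        have "\<bar>Im (z - w)\<bar> \<le> r" "\<bar>Re (z - w)\<bar> \<le> r"
          using abs_Im_le_cmod[of "z - w"] abs_Re_le_cmod[of "z - w"] that by (auto simp: dist_norm)
        hence "\<bar>Im z - Im w\<bar> \<le> r" "\<bar>Re z - Re w\<bar> \<le> r" by simp_all
        moreover have "Im z = r + r" by (simp add: r_def)
        ultimately show "Im w \<ge> r" "\<bar>Re w\<bar> \<le> \<bar>Re z\<bar> + r" by linarith+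
      qed
      have nz: "of_int m * w + of_int n \<noteq> 0" if "w \<in> cball z r" "(m, n) \<noteq> (0, 0)" for w and m n :: int
        using box(1)[OF that(1)] r that(2) by (auto simp: complex_eq_iff)
      have hol: "t x holomorphic_on cball z r" if "x \<in> X" for x
        using that nz by (cases x) (auto simp: t_def X_def intro!: holomorphic_intros)
      have ul: "uniform_limit (cball z r) (\<lambda>Y w. \<Sum>x\<in>Y. t x w) G (finite_subsets_at_top X)"
        unfolding G_def
        by (rule Weierstrass_m_test_general[OF _ M[of r "\<bar>Re z\<bar> + r"]])
           (use bound box r in auto)
      have ev: "\<forall>\<^sub>F Y in finite_subsets_at_top X. continuous_on (cball z r) (\<lambda>w. \<Sum>x\<in>Y. t x w)
          \<and> (\<lambda>w. \<Sum>x\<in>Y. t x w) holomorphic_on ball z r"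
      proof (rule eventually_finite_subsets_at_top_weakI)
        fix Y assume Y: "finite Y" "Y \<subseteq> X"
        have "(\<lambda>w. \<Sum>x\<in>Y. t x w) holomorphic_on cball z r"
          by (intro holomorphic_on_sum hol) (use Y in auto)
        thus "continuous_on (cball z r) (\<lambda>w. \<Sum>x\<in>Y. t x w) \<and> (\<lambda>w. \<Sum>x\<in>Y. t x w) holomorphic_on ball z r"
          by (meson holomorphic_on_imp_continuous_on holomorphic_on_subset ball_subset_cball)
      qed
      have "G holomorphic_on ball z r"
        by (rule holomorphic_uniform_limit[OF ev ul]) auto
      thus ?thesis using r by blast
    qed
    thus ?thesis
      by (metis open_uhp analytic_on_def analytic_imp_holomorphic)
  qed
  moreover have "norm (G z) \<le> infsum (M 1 1) X" if "Im z \<ge> 1" for z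
  proof -
    \<comment> \<open>translate into the strip $0 \le \operatorname{Re} z \le 1$\<close>
    define z' where "z' = z + of_int (- \<lfloor>Re z\<rfloor>)"
    have "G z = G z'" unfolding z'_def
      by (rule periodic_upper_halfplane_add_of_int[where M = "Im z - 1", symmetric]) (simp_all add: per)
    also have "norm \<dots> \<le> infsum (M 1 1) X" unfolding G_def
    proof (rule norm_infsum_le)
      have z': "Im z' \<ge> 1" "\<bar>Re z'\<bar> \<le> 1"
        using \<open>Im z \<ge> 1\<close> by (simp_all add: z'_def) linarith
      have b: "norm (t x z') \<le> M 1 1 x" if "x \<in> X" for x
        by (rule bound[OF that z']) simp
      show "norm (t x z') \<le> M 1 1 x" if "x \<in> X" for x using b that .
      show "((\<lambda>x. t x z') has_sum (\<Sum>\<^sub>\<infinity>x\<in>X. t x z')) X"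
        by (rule has_sum_infsum, rule abs_summable_summable, rule Infinite_Sum.abs_summable_on_comparison_test'[OF M b])
      show "(M 1 1 has_sum infsum (M 1 1) X) X" using M by (rule has_sum_infsum)
    qed
    finally show ?thesis .
  qed
  hence "norm (G z / c) \<le> infsum (M 1 1) X / norm c" if "Im z \<ge> 1" for z
    using that by (auto simp: norm_divide intro!: divide_right_mono)
  moreover have "(\<lambda>z. G z / c) holomorphic_on uhp"
    using \<open>G holomorphic_on uhp\<close> by (simp add: divide_inverse holomorphic_on_mult)
  ultimately show ?thesis
    unfolding cusp_bounded_periodic_def E using per by auto
qed

lemma cusp_bounded_periodic_const: "cusp_bounded_periodic (\<lambda>_. c)"
  unfolding cusp_bounded_periodic_def by auto

lemma cusp_bounded_periodic_mult:
  assumes "cusp_bounded_periodic f" "cusp_bounded_periodic g"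
  shows "cusp_bounded_periodic (\<lambda>z. f z * g z)"
proof -
  obtain A B where AB: "\<And>z. Im z \<ge> 1 \<Longrightarrow> norm (f z) \<le> A" "\<And>z. Im z \<ge> 1 \<Longrightarrow> norm (g z) \<le> B"
    using assms unfolding cusp_bounded_periodic_def by blast
  have "norm (f z * g z) \<le> A * B" if "Im z \<ge> 1" for z
    unfolding norm_mult using AB that order_trans[OF norm_ge_zero AB(1)]
    by (intro mult_mono) auto
  thus ?thesis using assms unfolding cusp_bounded_periodic_def
    by (auto intro!: holomorphic_intros)
qed

lemma cusp_bounded_periodic_diff:
  assumes "cusp_bounded_periodic f" "cusp_bounded_periodic g"
  shows "cusp_bounded_periodic (\<lambda>z. f z - g z)"
proof -
  obtain A B where AB: "\<And>z. Im z \<ge> 1 \<Longrightarrow> norm (f z) \<le> A" "\<And>z. Im z \<ge> 1 \<Longrightarrow> norm (g z) \<le> B"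
    using assms unfolding cusp_bounded_periodic_def by blast
  have "norm (f z - g z) \<le> A + B" if "Im z \<ge> 1" for z
    using AB[OF that] norm_triangle_ineq4[of "f z" "g z"] by linarith
  thus ?thesis using assms unfolding cusp_bounded_periodic_def
    by (auto intro!: holomorphic_intros)
qed

lemma cusp_bounded_periodic_power:
  assumes "cusp_bounded_periodic f"
  shows "cusp_bounded_periodic (\<lambda>z. f z ^ n)"
  by (induction n) (simp_all add: cusp_bounded_periodic_const cusp_bounded_periodic_mult assms)

lemma cusp_bounded_periodic_Delta: "cusp_bounded_periodic Delta"
proof -
  have "Delta = (\<lambda>z. (Eisenstein 4 z ^ 3 - Eisenstein 6 z ^ 2) * (1 / 1728))"
    by (simp add: fun_eq_iff Delta_def)
  moreover have "cusp_bounded_periodic (\<lambda>z. (Eisenstein 4 z ^ 3 - Eisenstein 6 z ^ 2) * (1 / 1728))"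
    by (intro cusp_bounded_periodic_mult cusp_bounded_periodic_diff cusp_bounded_periodic_power
        cusp_bounded_periodic_const cusp_bounded_periodic_Eisenstein) auto
  ultimately show ?thesis by simp
qed

lemma cusp_bounded_periodic_F_factor: "cusp_bounded_periodic (F_factor w)"
  unfolding F_factor_def[abs_def]
  by (intro cusp_bounded_periodic_mult cusp_bounded_periodic_diff cusp_bounded_periodic_power
      cusp_bounded_periodic_const cusp_bounded_periodic_Eisenstein) auto


section \<open>The Riccati form of the equation\<close>

text \<open>For $\psi = y'/y$ this is $(y''' + Q_2 y' + Q_3 y)/y$.\<close>

definition riccati :: "(complex \<Rightarrow> complex) \<Rightarrow> (complex \<Rightarrow> complex) \<Rightarrow> (complex \<Rightarrow> complex) \<Rightarrow> complex \<Rightarrow> complex"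
  where "riccati Q2 Q3 \<psi> z =
    deriv (deriv \<psi>) z + 3 * \<psi> z * deriv \<psi> z + \<psi> z ^ 3 + Q2 z * \<psi> z + Q3 z"

text \<open>This is $y'/y$ expressed by the cube $h = y^3$, which is single-valued when $y$ is determined
only up to cube roots of unity.\<close>

definition third_logderiv :: "(complex \<Rightarrow> complex) \<Rightarrow> complex \<Rightarrow> complex" where
  "third_logderiv h z = deriv h z / (3 * h z)"

lemma deriv_cong_open:
  assumes "open U" "\<And>z. z \<in> U \<Longrightarrow> f z = g z" "z \<in> U"
  shows "deriv f z = deriv g z"
  using assms by (intro deriv_cong_ev eventually_nhds_in_open[THEN eventually_mono]) auto

lemma riccati_cong_open:
  assumes U: "open U" and eq: "\<And>z. z \<in> U \<Longrightarrow> \<psi> z = \<psi>' z" and z: "z \<in> U"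
  shows "riccati Q2 Q3 \<psi> z = riccati Q2 Q3 \<psi>' z"
proof -
  have "deriv \<psi> w = deriv \<psi>' w" if "w \<in> U" for w by (rule deriv_cong_open[OF U eq that])
  moreover from this have "deriv (deriv \<psi>) z = deriv (deriv \<psi>') z" by (rule deriv_cong_open[OF U _ z])
  ultimately show ?thesis using eq z by (simp add: riccati_def)
qed

lemma equation_eq_riccati:
  assumes U: "open U" and y: "y holomorphic_on U" "\<And>z. z \<in> U \<Longrightarrow> y z \<noteq> 0" and z: "z \<in> U"
    and \<psi>: "\<And>z. z \<in> U \<Longrightarrow> \<psi> z = deriv y z / y z"
  shows "(deriv ^^ 3) y z + Q2 z * deriv y z + Q3 z * y z = y z * riccati Q2 Q3 \<psi> z"
proof -
  have \<psi>hol: "\<psi> holomorphic_on U"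
    by (rule holomorphic_transform[of "\<lambda>z. deriv y z / y z"])
       (use U y \<psi> in \<open>auto intro!: holomorphic_intros holomorphic_deriv\<close>)
  have dy: "(y has_field_derivative \<psi> w * y w) (at w)" if "w \<in> U" for w
    using holomorphic_derivI[OF y(1) U that] \<psi>[OF that] y(2)[OF that] by simp
  have d\<psi>: "(\<psi> has_field_derivative deriv \<psi> w) (at w)" if "w \<in> U" for w
    using holomorphic_derivI[OF \<psi>hol U that] .
  have d\<psi>2: "(deriv \<psi> has_field_derivative deriv (deriv \<psi>) w) (at w)" if "w \<in> U" for w
    using holomorphic_derivI[OF holomorphic_deriv[OF \<psi>hol U] U that] .
  have 1: "deriv y w = \<psi> w * y w" if "w \<in> U" for w by (rule DERIV_imp_deriv[OF dy[OF that]])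
  have 2: "deriv (deriv y) w = (deriv \<psi> w + \<psi> w ^ 2) * y w" if "w \<in> U" for w
  proof -
    have "deriv (deriv y) w = deriv (\<lambda>w. \<psi> w * y w) w"
      using 1 by (rule deriv_cong_open[OF U _ that])
    also have "\<dots> = (deriv \<psi> w + \<psi> w ^ 2) * y w"
      by (rule DERIV_imp_deriv)
         (use dy[OF that] d\<psi>[OF that] in \<open>auto intro!: derivative_eq_intros
           simp: algebra_simps power2_eq_square\<close>)
    finally show ?thesis .
  qed
  have "deriv (deriv (deriv y)) z = deriv (\<lambda>w. (deriv \<psi> w + \<psi> w ^ 2) * y w) z"
    using 2 by (rule deriv_cong_open[OF U _ z])
  also have "\<dots> = (deriv (deriv \<psi>) z + 3 * \<psi> z * deriv \<psi> z + \<psi> z ^ 3) * y z"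
    by (rule DERIV_imp_deriv)
       (use dy[OF z] d\<psi>[OF z] d\<psi>2[OF z] in \<open>auto intro!: derivative_eq_intros
         simp: algebra_simps power2_eq_square power3_eq_cube\<close>)
  finally show ?thesis using 1[OF z] by (simp add: riccati_def eval_nat_numeral algebra_simps)
qed

lemma third_logderiv_cube:
  assumes U: "open U" "y holomorphic_on U" "z \<in> U" and h: "\<And>z. z \<in> U \<Longrightarrow> h z = y z ^ 3"
    and nz: "y z \<noteq> 0"
  shows "third_logderiv h z = deriv y z / y z"
proof -
  have "deriv h z = deriv (\<lambda>z. y z ^ 3) z" using h by (rule deriv_cong_open[OF U(1) _ U(3)])
  also have "\<dots> = 3 * y z ^ 2 * deriv y z"
    by (rule DERIV_imp_deriv)
       (use holomorphic_derivI[OF U(2,1,3)] in \<open>auto intro!: derivative_eq_intros\<close>)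
  finally show ?thesis
    using nz h[OF U(3)] by (simp add: third_logderiv_def power2_eq_square power3_eq_cube)
qed

text \<open>The order of vanishing appears both as the exponent of the linear factor and as the index of a
nonzero derivative; the latter form is linear in \<open>f\<close>.\<close>

lemma holomorphic_factor_at_zero:
  assumes f: "f holomorphic_on S" "open S" "connected S" and z0: "z0 \<in> S"
    and nz: "w0 \<in> S" "f w0 \<noteq> 0"
  obtains n :: nat and g r where "(deriv ^^ n) f z0 \<noteq> 0" "r > 0" "ball z0 r \<subseteq> S"
    "g holomorphic_on ball z0 r" "\<And>w. w \<in> ball z0 r \<Longrightarrow> g w \<noteq> 0"
    "\<And>w. w \<in> ball z0 r \<Longrightarrow> f w = (w - z0) ^ n * g w"
proof -
  define n where "n = (LEAST n. (deriv ^^ n) f z0 \<noteq> 0)"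
  have "\<exists>n. (deriv ^^ n) f z0 \<noteq> 0"
    using holomorphic_fun_eq_0_on_connected[OF f] nz z0 by metis
  hence n: "(deriv ^^ n) f z0 \<noteq> 0" unfolding n_def by (rule LeastI_ex)
  have less: "(deriv ^^ i) f z0 = 0" if "i < n" for i
    using that not_less_Least unfolding n_def by blast
  obtain e where e: "e > 0" "ball z0 e \<subseteq> S" using f(2) z0 openE by blast
  show ?thesis
  proof (cases "n = 0")
    case True
    have "continuous_on S f" using f(1) by (rule holomorphic_on_imp_continuous_on)
    hence "isCont f z0" using f(2) z0 by (simp add: continuous_on_eq_continuous_at)
    then obtain d where d: "d > 0" "\<And>w. dist z0 w < d \<Longrightarrow> f w \<noteq> 0"
      using continuous_at_avoid[of z0 f 0] n True by auto
    show ?thesis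
    proof (rule that[of 0 "min d e" f])
      show "f holomorphic_on ball z0 (min d e)"
        using f(1) by (rule holomorphic_on_subset) (use e in auto)
    qed (use d e n True in auto)
  next
    case False
    show ?thesis
    proof (rule holomorphic_factor_order_of_zero[OF f(1,2) z0 _ n])
      fix g r assume g: "0 < r" "g holomorphic_on ball z0 r"
        "\<And>w. w \<in> ball z0 r \<Longrightarrow> f w - f z0 = (w - z0) ^ n * g w"
        "\<And>w. w \<in> ball z0 r \<Longrightarrow> g w \<noteq> 0"
      have "f z0 = 0" using less[of 0] False by simp
      show ?thesis
      proof (rule that[OF n, of "min r e" g])
        show "g holomorphic_on ball z0 (min r e)" using g(2) by (rule holomorphic_on_subset) auto
        show "f w = (w - z0) ^ n * g w" if "w \<in> ball z0 (min r e)" for w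
          using g(3)[of w] that \<open>f z0 = 0\<close> by simp
        show "g w \<noteq> 0" if "w \<in> ball z0 (min r e)" for w
          using g(4)[of w] that by simp
        show "min r e > 0" using g(1) e by simp
        show "ball z0 (min r e) \<subseteq> S" using e by auto
      qed
    qed (use False less in auto)
  qed
qed

lemma holomorphic_nonzero_nearby:
  assumes "f holomorphic_on S" "open S" "connected S" "z \<in> S" "w0 \<in> S" "f w0 \<noteq> 0"
  shows "\<forall>\<^sub>F w in at z. f w \<noteq> 0"
proof (rule holomorphic_factor_at_zero[OF assms])
  fix n g r
  assume r: "r > 0" "\<And>w. w \<in> ball z r \<Longrightarrow> g w \<noteq> 0" "\<And>w. w \<in> ball z r \<Longrightarrow> f w = (w - z) ^ n * g w"
  have "\<forall>\<^sub>F w in at z. w \<in> ball z r - {z}" using r(1) by (intro eventually_at_in_open) auto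
  thus ?thesis by eventually_elim (use r in auto)
qed

text \<open>The left-hand side is meromorphic on the upper half plane and vanishes on an open set, where it
comes from the solution \<open>y\<close>.\<close>

lemma riccati_continuation:
  assumes mero: "h meromorphic_on uhp" "Q2 meromorphic_on uhp" "Q3 meromorphic_on uhp"
    and U: "open U" "U \<subseteq> uhp" and y: "solves Q2 Q3 U y" and nz: "z1 \<in> U" "y z1 \<noteq> 0"
    and h: "\<And>z. z \<in> U \<Longrightarrow> h z = y z ^ 3" and z0: "z0 \<in> uhp"
  shows "\<forall>\<^sub>F z in at z0. riccati Q2 Q3 (third_logderiv h) z = 0"
proof -
  let ?E = "riccati Q2 Q3 (third_logderiv h)"
  have yhol: "y holomorphic_on U" using y by (simp add: solves_def)
  define V where "V = {z \<in> U. y z \<noteq> 0}"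
  have V: "open V" "z1 \<in> V" "V \<subseteq> U"
  proof -
    have "V = U \<inter> y -` (- {0})" by (auto simp: V_def)
    thus "open V"
      using continuous_open_preimage[OF holomorphic_on_imp_continuous_on[OF yhol] U(1), of "- {0}"] by auto
  qed (use nz in \<open>auto simp: V_def\<close>)
  have E: "?E z = 0" if "z \<in> V" for z
  proof -
    have "third_logderiv h w = deriv y w / y w" if "w \<in> V" for w
      using that V(3) by (intro third_logderiv_cube[OF U(1) yhol _ h]) (auto simp: V_def)
    moreover have "y holomorphic_on V" using yhol V(3) by (rule holomorphic_on_subset)
    moreover have "y w \<noteq> 0" if "w \<in> V" for w using that by (simp add: V_def)
    ultimately have "y z * ?E z = (deriv ^^ 3) y z + Q2 z * deriv y z + Q3 z * y z"
      using equation_eq_riccati[OF V(1), of y z "third_logderiv h" Q2 Q3] that by simp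
    also have "\<dots> = 0" using y that V(3) by (auto simp: solves_def)
    finally show ?thesis using that by (simp add: V_def)
  qed
  have Emero: "?E meromorphic_on uhp"
  proof -
    have \<psi>: "third_logderiv h meromorphic_on uhp"
      unfolding third_logderiv_def[abs_def]
      by (intro meromorphic_on_divide meromorphic_on_mult meromorphic_on_const meromorphic_on_deriv mero)
    show ?thesis
      unfolding riccati_def[abs_def]
      by (intro meromorphic_on_add meromorphic_on_mult meromorphic_on_const meromorphic_on_power
          meromorphic_on_deriv \<psi> mero)
  qed
  have "connected uhp" using convex_uhp by (rule convex_connected)
  from meromorphic_imp_constant_or_avoid[OF Emero open_uhp this, of 0] show ?thesis
  proof
    assume "\<forall>\<^sub>\<approx>z\<in>uhp. ?E z = 0"
    thus ?thesis using z0 by (simp add: eventually_cosparse_open_eq open_uhp)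
  next
    assume "\<forall>\<^sub>\<approx>z\<in>uhp. ?E z \<noteq> 0"
    hence "\<forall>\<^sub>F z in at z1. ?E z \<noteq> 0"
      using nz U by (auto simp: eventually_cosparse_open_eq open_uhp)
    moreover have "\<forall>\<^sub>F z in at z1. z \<in> V" using V by (intro eventually_at_in_open') auto
    ultimately have "\<forall>\<^sub>F z in at z1. False" by eventually_elim (use E in auto)
    thus ?thesis by simp
  qed
qed

text \<open>Conversely, the Riccati equation gives the linear one off the zeros of \<open>y\<close>, and by continuity at the
zeros.\<close>

lemma riccati_solution:
  assumes Q: "Q2 holomorphic_on S" "Q3 holomorphic_on S" and S: "open S" "connected S"
    and y: "y holomorphic_on S" and nz: "z1 \<in> S" "y z1 \<noteq> 0"
    and h: "\<And>z. z \<in> S \<Longrightarrow> h z = y z ^ 3"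
    and ric: "\<And>z0. z0 \<in> S \<Longrightarrow> \<forall>\<^sub>F z in at z0. riccati Q2 Q3 (third_logderiv h) z = 0"
    and z: "z \<in> S"
  shows "(deriv ^^ 3) y z + Q2 z * deriv y z + Q3 z * y z = 0"
proof -
  define V where "V = {z \<in> S. y z \<noteq> 0}"
  have V: "open V"
  proof -
    have "V = S \<inter> y -` (- {0})" by (auto simp: V_def)
    thus ?thesis
      using continuous_open_preimage[OF holomorphic_on_imp_continuous_on[OF y] S(1), of "- {0}"] by auto
  qed
  have yV: "y holomorphic_on V" using y by (rule holomorphic_on_subset) (auto simp: V_def)
  have log: "third_logderiv h w = deriv y w / y w" if "w \<in> V" for w
    using that by (intro third_logderiv_cube[OF S(1) y _ h]) (auto simp: V_def)
  let ?D = "\<lambda>z. (deriv ^^ 3) y z + Q2 z * deriv y z + Q3 z * y z"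
  have D: "?D w = y w * riccati Q2 Q3 (third_logderiv h) w" if "w \<in> V" for w
    by (rule equation_eq_riccati[OF V yV _ that log]) (auto simp: V_def)
  have "?D holomorphic_on S"
    by (intro holomorphic_intros Q y S holomorphic_deriv)
  hence cont: "isCont ?D z" using S(1) z by (rule isCont_holomorphic)
  have "\<forall>\<^sub>F w in at z. y w \<noteq> 0" by (rule holomorphic_nonzero_nearby[OF y S z nz])
  moreover have "\<forall>\<^sub>F w in at z. w \<in> S" using S z by (intro eventually_at_in_open') auto
  ultimately have "\<forall>\<^sub>F w in at z. ?D w = 0" using ric[OF z]
  proof eventually_elim
    case (elim w)
    hence "w \<in> V" by (simp add: V_def)
    thus ?case using D[of w] elim by simp
  qed
  with cont show ?thesis by (rule isCont_eq_zero_if_eventually_zero)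
qed

text \<open>The logarithmic derivative has a simple pole with residue $\nu = m/3$. In the Riccati equation the
coefficient of $(z - z_0)^{-3}$ is $2\nu - 3\nu^2 + \nu^3 + A_2\nu + A_3$, which is the indicial
polynomial at $\nu$.\<close>

lemma riccati_pole_residue_indicial:
  assumes r: "r > 0" and g: "g holomorphic_on ball z0 r" "\<And>w. w \<in> ball z0 r \<Longrightarrow> g w \<noteq> 0"
    and h: "\<And>w. w \<in> ball z0 r - {z0} \<Longrightarrow> h w = (w - z0) powi m * g w"
    and ric: "\<forall>\<^sub>F z in at z0. riccati Q2 Q3 (third_logderiv h) z = 0"
    and A2: "((\<lambda>z. (z - z0) ^ 2 * Q2 z) \<longlongrightarrow> leading_coefficient 2 Q2 z0) (at z0)"
    and A3: "((\<lambda>z. (z - z0) ^ 3 * Q3 z) \<longlongrightarrow> leading_coefficient 3 Q3 z0) (at z0)"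
  shows "poly (indicial_poly Q2 Q3 z0) (of_int m / 3) = 0"
proof -
  define \<nu> :: complex where "\<nu> = of_int m / 3"
  define \<eta> where "\<eta> w = deriv g w / (3 * g w)" for w
  define D where "D = ball z0 r - {z0}"
  have D: "open D" by (auto simp: D_def)
  have \<eta>: "\<eta> holomorphic_on ball z0 r"
    unfolding \<eta>_def using g by (intro holomorphic_intros holomorphic_deriv) auto
  have \<psi>: "third_logderiv h w = \<nu> / (w - z0) + \<eta> w" if w: "w \<in> D" for w
  proof -
    have w': "w \<in> ball z0 r" "w \<noteq> z0" using w by (auto simp: D_def)
    have "deriv h w = deriv (\<lambda>w. (w - z0) powi m * g w) w"
      by (rule deriv_cong_open[OF D _ w]) (use h in \<open>auto simp: D_def\<close>)
    also have "\<dots> = of_int m * (w - z0) powi (m - 1) * g w + (w - z0) powi m * deriv g w"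
      by (rule DERIV_imp_deriv)
         (use w' in \<open>auto intro!: derivative_eq_intros holomorphic_derivI[OF g(1)]\<close>)
    finally have dh: "deriv h w = of_int m * ((w - z0) powi m / (w - z0)) * g w + (w - z0) powi m * deriv g w"
      using w' by (simp add: power_int_diff)
    have "(a * (P / u) * G + P * G') / (3 * (P * G)) = a / 3 / u + G' / (3 * G)"
      if "u \<noteq> 0" "P \<noteq> 0" "G \<noteq> 0" for a P u G G' :: complex
      using that by (simp add: field_simps)
    from this[of "w - z0" "(w - z0) powi m" "g w"] show ?thesis
      using h[of w] g(2)[OF w'(1)] w' dh by (simp add: third_logderiv_def \<nu>_def \<eta>_def)
  qed
  have pd: "((\<lambda>w. (w - z0) powi k) has_field_derivative of_int k * (w - z0) powi (k - 1)) (at w)"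
    if "w \<in> D" for w k
    using that by (auto intro!: derivative_eq_intros simp: D_def)
  define \<phi> where "\<phi> w = \<nu> * (w - z0) powi (-1) + \<eta> w" for w
  have \<psi>': "third_logderiv h w = \<phi> w" if "w \<in> D" for w
    using \<psi>[OF that] by (simp add: \<phi>_def power_int_minus divide_inverse)
  have d1: "deriv \<phi> w = - \<nu> * (w - z0) powi (-2) + deriv \<eta> w" if w: "w \<in> D" for w
    unfolding \<phi>_def
    by (rule DERIV_imp_deriv)
       (use DERIV_add[OF DERIV_cmult[OF pd[OF w, of "-1"], of \<nu>] holomorphic_derivI[OF \<eta> open_ball]] w
         in \<open>simp add: D_def\<close>)
  have d2: "deriv (deriv \<phi>) w = 2 * \<nu> * (w - z0) powi (-3) + deriv (deriv \<eta>) w" if w: "w \<in> D" for w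
  proof -
    have "deriv (deriv \<phi>) w = deriv (\<lambda>w. - \<nu> * (w - z0) powi (-2) + deriv \<eta> w) w"
      using d1 by (rule deriv_cong_open[OF D _ w])
    also have "\<dots> = 2 * \<nu> * (w - z0) powi (-3) + deriv (deriv \<eta>) w"
      by (rule DERIV_imp_deriv)
         (use DERIV_add[OF DERIV_cmult[OF pd[OF w, of "-2"], of "- \<nu>"]
            holomorphic_derivI[OF holomorphic_deriv[OF \<eta> open_ball] open_ball]] w
          in \<open>simp add: D_def mult_ac\<close>)
    finally show ?thesis .
  qed
  define H where "H z = 2 * \<nu> + (z - z0)^3 * deriv (deriv \<eta>) z
     + 3 * (\<nu> + (z - z0) * \<eta> z) * (- \<nu> + (z - z0)^2 * deriv \<eta> z)
     + (\<nu> + (z - z0) * \<eta> z)^3 + ((z - z0)^2 * Q2 z) * (\<nu> + (z - z0) * \<eta> z) + (z - z0)^3 * Q3 z" for z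
  have "\<forall>\<^sub>F z in at z0. z \<in> D"
    unfolding D_def using r by (intro eventually_at_in_open) auto
  hence "\<forall>\<^sub>F z in at z0. H z = 0" using ric
  proof eventually_elim
    case (elim z)
    have z: "z - z0 \<noteq> 0" using elim by (auto simp: D_def)
    have "0 = (z - z0)^3 * riccati Q2 Q3 \<phi> z"
      using elim riccati_cong_open[where \<psi> = "third_logderiv h" and \<psi>' = \<phi>, OF D \<psi>' elim(1), of Q2 Q3] by simp
    also have "\<dots> = H z"
    proof -
      have inv: "u^3 * (2 * a * u powi (-3) + e'' + 3 * (a * u powi (-1) + e) * (- a * u powi (-2) + e')
          + (a * u powi (-1) + e)^3 + b * (a * u powi (-1) + e) + c) =
        2 * a + u^3 * e'' + 3 * (a + u * e) * (- a + u^2 * e') + (a + u * e)^3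
          + (u^2 * b) * (a + u * e) + u^3 * c" if "u \<noteq> 0" for u a e e' e'' b c :: complex
      proof -
        define v where "v = inverse u"
        have v: "u powi (-1) = v" "u powi (-2) = v^2" "u powi (-3) = v^3"
          by (simp_all add: v_def power_int_minus power_inverse)
        have uv: "u * v = 1" using that by (simp add: v_def)
        show ?thesis unfolding v using uv by algebra
      qed
      show ?thesis unfolding riccati_def d1[OF elim(1)] d2[OF elim(1)] H_def
        using inv[OF z, of \<nu> "deriv (deriv \<eta>) z" "\<eta> z" "deriv \<eta> z" "Q2 z" "Q3 z"]
        by (simp add: \<phi>_def)
    qed
    finally show ?case by simp
  qed
  hence "(H \<longlongrightarrow> 0) (at z0)" by (rule tendsto_eventually)
  moreover have "(H \<longlongrightarrow> 2 * \<nu> + (z0 - z0)^3 * deriv (deriv \<eta>) z0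
     + 3 * (\<nu> + (z0 - z0) * \<eta> z0) * (- \<nu> + (z0 - z0)^2 * deriv \<eta> z0)
     + (\<nu> + (z0 - z0) * \<eta> z0)^3 + leading_coefficient 2 Q2 z0 * (\<nu> + (z0 - z0) * \<eta> z0)
     + leading_coefficient 3 Q3 z0) (at z0)"
  proof -
    have lim: "(k \<longlongrightarrow> k z0) (at z0)" if "k holomorphic_on ball z0 r" for k
      using continuous_on_eq_continuous_at[of "ball z0 r" k] holomorphic_on_imp_continuous_on[OF that] r
      by (auto intro: isContD)
    note lims = lim[OF \<eta>] lim[OF holomorphic_deriv[OF \<eta> open_ball]]
      lim[OF holomorphic_deriv[OF holomorphic_deriv[OF \<eta> open_ball] open_ball]]
    show ?thesis unfolding H_def by (intro tendsto_intros lims A2 A3)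
  qed
  ultimately have "2 * \<nu> + 3 * \<nu> * (- \<nu>) + \<nu>^3 + leading_coefficient 2 Q2 z0 * \<nu>
     + leading_coefficient 3 Q3 z0 = 0"
    using tendsto_unique[of "at z0"] by fastforce
  thus ?thesis
    unfolding \<nu>_def[symmetric] by (simp add: indicial_poly_def algebra_simps power3_eq_cube)
qed


section \<open>Solutions near the cusp\<close>

lemma norm_square_derivative_vertical:
  assumes u: "u holomorphic_on upper_halfplane M" and t: "M < t"
  shows "((\<lambda>t. (norm (u (Complex x t)))\<^sup>2) has_real_derivative
    2 * (u (Complex x t) \<bullet> (\<i> * deriv u (Complex x t)))) (at t)"
proof -
  have "((\<lambda>t. Complex x t) has_vector_derivative \<i>) (at t)"
    unfolding has_vector_derivative_complex_iff by (auto intro!: derivative_eq_intros)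
  moreover have "(u has_field_derivative deriv u (Complex x t)) (at (Complex x t))"
    using u open_upper_halfplane by (rule holomorphic_derivI) (use t in \<open>simp add: upper_halfplane_def\<close>)
  ultimately have "(u \<circ> (\<lambda>t. Complex x t) has_vector_derivative (\<i> * deriv u (Complex x t))) (at t)"
    by (rule field_vector_diff_chain_at)
  hence d: "((\<lambda>t. u (Complex x t)) has_derivative (\<lambda>h. h *\<^sub>R (\<i> * deriv u (Complex x t)))) (at t)"
    by (simp add: has_vector_derivative_def o_def)
  show ?thesis
    unfolding has_field_derivative_def power2_norm_eq_inner
    by (rule has_derivative_eq_rhs[OF has_derivative_inner[OF d d]])
       (simp add: fun_eq_iff inner_commute algebra_simps)
qed

text \<open>Gronwall's argument along vertical lines: with bounded coefficients,
$N = |y|^2 + |y'|^2 + |y''|^2$ satisfies $\partial N/\partial t \le K N$, where $t$ is the imaginary part, so $N e^{-Kt}$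
decreases.\<close>

lemma third_order_equation_growth:
  assumes y: "y holomorphic_on upper_halfplane M"
    and ode: "\<And>z. M < Im z \<Longrightarrow> (deriv ^^ 3) y z + Q2 z * deriv y z + Q3 z * y z = 0"
    and bounds: "\<And>z. M < Im z \<Longrightarrow> norm (Q2 z) \<le> B" "\<And>z. M < Im z \<Longrightarrow> norm (Q3 z) \<le> B"
    and t0: "M < t0"
  obtains C K where "\<And>z. \<lbrakk>t0 \<le> Im z; 0 \<le> Re z; Re z \<le> 1\<rbrakk> \<Longrightarrow> norm (y z) \<le> C * exp (K * Im z)"
proof -
  let ?H = "upper_halfplane M"
  define y1 y2 where "y1 = deriv y" and "y2 = deriv y1"
  have hol: "y1 holomorphic_on ?H" "y2 holomorphic_on ?H"
    unfolding y1_def y2_def by (intro holomorphic_deriv y open_upper_halfplane)+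
  define N where "N z = (norm (y z))\<^sup>2 + (norm (y1 z))\<^sup>2 + (norm (y2 z))\<^sup>2" for z
  define K where "K = 2 + 2 * B"
  have B: "B \<ge> 0" using order_trans[OF norm_ge_zero bounds(1)[of "Complex 0 t0"]] t0 by simp
  \<comment> \<open>the derivative of \<open>N\<close> in the direction of the imaginary axis\<close>
  define N' where "N' z = 2 * (y z \<bullet> (\<i> * y1 z)) + 2 * (y1 z \<bullet> (\<i> * y2 z)) + 2 * (y2 z \<bullet> (\<i> * deriv y2 z))" for z
  have dN: "((\<lambda>t. N (Complex x t)) has_real_derivative N' (Complex x t)) (at t)" if "M < t" for x t
    unfolding N_def N'_def
    using norm_square_derivative_vertical[OF y that, of x] norm_square_derivative_vertical[OF hol(1) that, of x]
      norm_square_derivative_vertical[OF hol(2) that, of x]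
    unfolding y1_def[symmetric] y2_def[symmetric] by (intro DERIV_add)
  have inner: "2 * (u \<bullet> (\<i> * v)) \<le> 2 * (norm u * norm v)" for u v :: complex
    using norm_cauchy_schwarz[of u "\<i> * v"] by (simp add: norm_mult)
  have N': "N' z \<le> K * N z" if z: "M < Im z" for z
  proof -
    have "deriv y2 z = (deriv ^^ 3) y z" by (simp add: y1_def y2_def eval_nat_numeral)
    moreover have "deriv y z = y1 z" by (simp add: y1_def)
    ultimately have "deriv y2 z + (Q2 z * y1 z + Q3 z * y z) = 0" using ode[OF z] by (simp only: add.assoc)
    hence "deriv y2 z = - (Q2 z * y1 z + Q3 z * y z)" by (simp only: eq_neg_iff_add_eq_0)
    hence "norm (deriv y2 z) \<le> norm (Q2 z) * norm (y1 z) + norm (Q3 z) * norm (y z)"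
      using norm_triangle_ineq[of "Q2 z * y1 z" "Q3 z * y z"]
      by (simp only: norm_minus_cancel norm_mult)
    also have "\<dots> \<le> B * norm (y1 z) + B * norm (y z)"
      by (intro add_mono mult_right_mono bounds z) auto
    finally have y3: "norm (deriv y2 z) \<le> B * norm (y1 z) + B * norm (y z)" .
    have sq: "2 * (a * b) \<le> a\<^sup>2 + b\<^sup>2" for a b :: real
      using sum_squares_bound[of a b] by (simp add: mult_ac)
    have "2 * (norm (y2 z) * norm (deriv y2 z)) \<le> 2 * (norm (y2 z) * (B * norm (y1 z) + B * norm (y z)))"
      using y3 by (intro mult_left_mono) auto
    also have "\<dots> = B * (2 * (norm (y2 z) * norm (y1 z))) + B * (2 * (norm (y2 z) * norm (y z)))"
      by (simp add: algebra_simps)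
    also have "\<dots> \<le> B * ((norm (y2 z))\<^sup>2 + (norm (y1 z))\<^sup>2) + B * ((norm (y2 z))\<^sup>2 + (norm (y z))\<^sup>2)"
      using B by (intro add_mono mult_left_mono sq)
    finally have "N' z \<le> ((norm (y z))\<^sup>2 + (norm (y1 z))\<^sup>2) + ((norm (y1 z))\<^sup>2 + (norm (y2 z))\<^sup>2)
        + (B * ((norm (y2 z))\<^sup>2 + (norm (y1 z))\<^sup>2) + B * ((norm (y2 z))\<^sup>2 + (norm (y z))\<^sup>2))"
      unfolding N'_def
      by (intro add_mono order_trans[OF inner sq]) (rule order_trans[OF inner])
    also have "\<dots> \<le> K * N z"
      using B by (simp add: K_def N_def algebra_simps)
    finally show ?thesis .
  qed
  have "continuous_on ?H N"
    unfolding N_def by (intro continuous_intros holomorphic_on_imp_continuous_on y hol)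
  hence "continuous_on ((\<lambda>x. Complex x t0) ` {0..1}) N"
    by (rule continuous_on_subset) (use t0 in \<open>auto simp: upper_halfplane_def\<close>)
  moreover have "compact ((\<lambda>x. Complex x t0) ` {0..1})"
    unfolding Complex_eq by (intro compact_continuous_image continuous_intros) auto
  ultimately have "bounded (N ` (\<lambda>x. Complex x t0) ` {0..1})"
    by (intro compact_imp_bounded[OF compact_continuous_image])
  then obtain C0 where "\<forall>v\<in>N ` (\<lambda>x. Complex x t0) ` {0..1}. norm v \<le> C0"
    unfolding bounded_iff by blast
  hence C0: "N (Complex x t0) \<le> C0" if "0 \<le> x" "x \<le> 1" for x
    using that by (auto simp: abs_le_iff)
  define C where "C = C0 * exp (- K * t0)"
  have main: "N (Complex x t) \<le> C * exp (K * t)" if x: "0 \<le> x" "x \<le> 1" and t: "t0 \<le> t" for x t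
  proof -
    have "N (Complex x t) * exp (- K * t) \<le> N (Complex x t0) * exp (- K * t0)"
    proof (rule DERIV_nonpos_imp_nonincreasing[OF t])
      fix s assume s: "t0 \<le> s" "s \<le> t"
      have "((\<lambda>t. N (Complex x t) * exp (- K * t)) has_real_derivative
          (N' (Complex x s) - K * N (Complex x s)) * exp (- K * s)) (at s)"
        using dN[of s x] s t0 by (auto intro!: derivative_eq_intros simp: algebra_simps)
      moreover have "(N' (Complex x s) - K * N (Complex x s)) * exp (- K * s) \<le> 0"
        using N'[of "Complex x s"] s t0 by (intro mult_nonpos_nonneg) auto
      ultimately show "\<exists>d. ((\<lambda>t. N (Complex x t) * exp (- K * t)) has_real_derivative d) (at s) \<and> d \<le> 0"
        by blast
    qed
    also have "\<dots> \<le> C" unfolding C_def using C0[OF x] by (intro mult_right_mono) auto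
    finally have "N (Complex x t) * exp (- K * t) \<le> C" .
    thus ?thesis by (simp add: exp_minus field_simps)
  qed
  show ?thesis
  proof
    fix z assume z: "t0 \<le> Im z" "0 \<le> Re z" "Re z \<le> 1"
    have N: "N z \<le> C * exp (K * Im z)" using main[OF z(2,3,1)] by simp
    have "0 \<le> N z" by (simp add: N_def)
    with N have "0 \<le> C * exp (K * Im z)" by linarith
    hence C: "C \<ge> 0" by (simp add: zero_le_mult_iff)
    have "(norm (y z))\<^sup>2 \<le> N z" by (simp add: N_def)
    also have "\<dots> \<le> (sqrt C * exp (K / 2 * Im z))\<^sup>2"
      using N C by (simp add: power_mult_distrib exp_double[symmetric])
    finally show "norm (y z) \<le> sqrt C * exp (K / 2 * Im z)"
      by (rule power2_le_imp_le) (use C in auto)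
  qed
qed

text \<open>Multiplication by an exponential makes $h$ periodic, so $h = e^{2\pi\mathrm i\cdot 3\nu z}G(q)$ with
$G(0) \neq 0$. Then $\psi = h'/(3h)$ is a power series in $q$ with constant term
$2\pi\mathrm i\,\nu$, and each derivative in $z$ produces a factor $q$. At $q = 0$ the Riccati
equation is therefore $(2\pi\mathrm i\,\nu)^3 + Q_2(\infty)\,2\pi\mathrm i\,\nu + Q_3(\infty) = 0$.\<close>

lemma riccati_cusp_exponent:
  fixes h :: "complex \<Rightarrow> complex"
  assumes Q: "holomorphic_at_cusp Q2" "holomorphic_at_cusp Q3"
    and h: "h holomorphic_on upper_halfplane M"
    and per: "\<And>z. M < Im z \<Longrightarrow> h (z + 1) = c * h z" and c: "c \<noteq> 0"
    and growth: "\<And>z. \<lbrakk>M' \<le> Im z; 0 \<le> Re z; Re z \<le> 1\<rbrakk> \<Longrightarrow> norm (h z) \<le> C * exp (K * Im z)"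
    and nz: "M < Im z1" "h z1 \<noteq> 0"
    and ric: "\<And>z0. M < Im z0 \<Longrightarrow> \<forall>\<^sub>F z in at z0. riccati Q2 Q3 (third_logderiv h) z = 0"
  obtains \<nu> where "poly (indicial_poly_cusp Q2 Q3) \<nu> = 0" "c = exp (2 * of_real pi * \<i> * (3 * \<nu>))"
proof -
  define \<tau> :: complex where "\<tau> = 2 * of_real pi * \<i>"
  have \<tau>: "\<tau> \<noteq> 0" by (simp add: \<tau>_def)
  have to_q: "to_q z = exp (\<tau> * z)" for z by (simp add: to_q_def \<tau>_def)
  \<comment> \<open>Any logarithm of \<open>c\<close> will do: the order \<open>m\<close> of the q-expansion below corrects the choice.\<close>
  define s where "s = Ln c / \<tau>"
  have s: "exp (\<tau> * s) = c" using c \<tau> by (simp add: s_def)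
  define k where "k z = exp (- \<tau> * s * z) * h z" for z
  have k: "k holomorphic_on upper_halfplane M" unfolding k_def by (intro holomorphic_intros h)
  have kper: "k (z + 1) = k z" if "M < Im z" for z
  proof -
    have "exp (- \<tau> * s * (z + 1)) * c = exp (- \<tau> * s * z)"
      unfolding s[symmetric] exp_add[symmetric] by (simp add: algebra_simps)
    thus ?thesis using per[OF that] by (simp add: k_def flip: mult.assoc)
  qed
  define A where "A = norm (\<tau> * s)"
  have kgrowth: "norm (k z) \<le> (exp A * \<bar>C\<bar>) * exp ((A + K) * Im z)"
    if z: "max M' 0 \<le> Im z" "0 \<le> Re z" "Re z \<le> 1" for z
  proof -
    have "norm z \<le> 1 + Im z" using cmod_le[of z] z by simp
    hence "norm (- \<tau> * s * z) \<le> A * (1 + Im z)"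
      unfolding norm_mult A_def by (simp add: mult_left_mono norm_mult)
    hence "norm (exp (- \<tau> * s * z)) \<le> exp (A * (1 + Im z))"
      using norm_exp[of "- \<tau> * s * z"] by (meson exp_le_cancel_iff order_trans)
    moreover have "norm (h z) \<le> \<bar>C\<bar> * exp (K * Im z)"
      using growth[of z] z by (smt (verit) exp_gt_zero mult_right_mono)
    ultimately have "norm (k z) \<le> exp (A * (1 + Im z)) * (\<bar>C\<bar> * exp (K * Im z))"
      unfolding k_def norm_mult by (intro mult_mono) auto
    thus ?thesis by (simp add: algebra_simps exp_add)
  qed
  have "k z1 \<noteq> 0" using nz by (simp add: k_def)
  have "\<exists>m G r. r > 0 \<and> G holomorphic_on ball 0 r \<and> (\<forall>q\<in>ball 0 r. G q \<noteq> 0) \<and>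
    (\<forall>z. to_q z \<in> ball 0 r \<longrightarrow> M < Im z \<and> k z = to_q z powi m * G (to_q z))"
  proof (rule periodic_moderate_growth_q_expansion[OF k kper kgrowth nz(1) \<open>k z1 \<noteq> 0\<close>])
    fix m :: int and G r
    assume "r > 0" "G holomorphic_on ball 0 r" "\<And>q. q \<in> ball 0 r \<Longrightarrow> G q \<noteq> 0"
      "\<And>z. to_q z \<in> ball 0 r \<Longrightarrow> M < Im z \<and> k z = to_q z powi m * G (to_q z)"
    thus ?thesis by (intro exI[of _ m] exI[of _ G] exI[of _ r]) simp
  qed
  then obtain m G r where r: "r > 0" and G: "G holomorphic_on ball 0 r" "\<And>q. q \<in> ball 0 r \<Longrightarrow> G q \<noteq> 0"
    and kG: "\<And>z. to_q z \<in> ball 0 r \<Longrightarrow> M < Im z \<and> k z = to_q z powi m * G (to_q z)"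
    by blast
  define \<nu> where "\<nu> = (s + of_int m) / 3"
  obtain g2 r2 M2 B2 where g2: "g2 holomorphic_on ball 0 r2" "r2 > 0" "value_at_cusp Q2 = g2 0"
    "\<And>z. M2 < Im z \<Longrightarrow> Q2 z = g2 (to_q z) \<and> to_q z \<in> ball 0 r2 \<and> norm (Q2 z) \<le> B2"
    using holomorphic_at_cuspE[OF Q(1)] by metis
  obtain g3 r3 M3 B3 where g3: "g3 holomorphic_on ball 0 r3" "r3 > 0" "value_at_cusp Q3 = g3 0"
    "\<And>z. M3 < Im z \<Longrightarrow> Q3 z = g3 (to_q z) \<and> to_q z \<in> ball 0 r3 \<and> norm (Q3 z) \<le> B3"
    using holomorphic_at_cuspE[OF Q(2)] by metis
  \<comment> \<open>a disc on which the expansions of \<open>h\<close>, \<open>Q2\<close> and \<open>Q3\<close> are all valid\<close>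
  define R where "R = min (min r (min r2 r3)) (min (exp (- 2 * pi * M2)) (exp (- 2 * pi * M3)))"
  have R: "R > 0" "R \<le> r" "R \<le> r2" "R \<le> r3" using r g2 g3 by (auto simp: R_def)
  have sub: "ball 0 R \<subseteq> ball (0::complex) r" "ball 0 R \<subseteq> ball (0::complex) r2" "ball 0 R \<subseteq> ball (0::complex) r3"
    using R by auto
  have Mz: "M2 < Im z" "M3 < Im z" if "to_q z \<in> ball 0 R" for z
    using that norm_to_q_less_iff[of z M2] norm_to_q_less_iff[of z M3] by (auto simp: R_def)
  have Ghol: "G holomorphic_on ball 0 R" using G(1) sub(1) by (rule holomorphic_on_subset)
  \<comment> \<open>$\psi$ and its first two derivatives in $z$ as functions of $q$\<close>
  define P where "P q = \<tau> * \<nu> + \<tau> * q * (deriv G q / (3 * G q))" for q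
  have P: "P holomorphic_on ball 0 R"
    unfolding P_def using G(2) sub(1) by (intro holomorphic_intros holomorphic_deriv Ghol) auto
  define P1 where "P1 q = \<tau> * q * deriv P q" for q
  have P1: "P1 holomorphic_on ball 0 R"
    unfolding P1_def by (intro holomorphic_intros holomorphic_deriv P) auto
  define P2 where "P2 q = \<tau> * q * deriv P1 q" for q
  have P2: "P2 holomorphic_on ball 0 R"
    unfolding P2_def by (intro holomorphic_intros holomorphic_deriv P1) auto
  define E where "E q = P2 q + 3 * P q * P1 q + P q ^ 3 + g2 q * P q + g3 q" for q
  have E: "E holomorphic_on ball 0 R"
    unfolding E_def using g2(1) g3(1) sub
    by (intro holomorphic_intros P P1 P2) (auto intro: holomorphic_on_subset)
  define D where "D = {z. to_q z \<in> ball 0 R}"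
  have D: "open D"
  proof -
    have "D = to_q -` ball 0 R" by (auto simp: D_def)
    moreover have "continuous_on UNIV to_q" unfolding to_q_def by (intro continuous_intros)
    ultimately show ?thesis using open_vimage[OF open_ball] by simp
  qed
  have DM: "M < Im z" if "z \<in> D" for z using kG[of z] that sub by (auto simp: D_def)
  have hG: "h z = exp (3 * \<tau> * \<nu> * z) * G (to_q z)" if z: "z \<in> D" for z
  proof -
    have "h z = exp (\<tau> * s * z) * k z" by (simp add: k_def exp_minus)
    also have "\<dots> = exp (\<tau> * s * z) * (exp (of_int m * (\<tau> * z)) * G (to_q z))"
    proof -
      have "to_q z \<in> ball 0 r" using z sub(1) unfolding D_def by blast
      thus ?thesis using kG[of z] exp_power_int[of "\<tau> * z" m] to_q[of z] by simp
    qed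
    also have "\<dots> = exp (3 * \<tau> * \<nu> * z) * G (to_q z)"
    proof -
      have "\<tau> * s * z + of_int m * (\<tau> * z) = 3 * \<tau> * \<nu> * z"
        by (simp add: \<nu>_def field_simps)
      thus ?thesis by (metis exp_add mult.assoc)
    qed
    finally show ?thesis .
  qed
  have \<psi>: "third_logderiv h z = P (to_q z)" if z: "z \<in> D" for z
  proof -
    have zR: "to_q z \<in> ball 0 R" using z by (simp add: D_def)
    have G0: "G (to_q z) \<noteq> 0" using G(2) zR sub by blast
    have dG: "((\<lambda>z. G (to_q z)) has_field_derivative deriv G (to_q z) * (\<tau> * to_q z)) (at z)"
      using DERIV_chain2[OF holomorphic_derivI[OF Ghol open_ball zR] has_field_derivative_to_q]
      by (simp add: \<tau>_def)
    have "deriv h z = deriv (\<lambda>z. exp (3 * \<tau> * \<nu> * z) * G (to_q z)) z"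
      by (rule deriv_cong_open[OF D hG z])
    also have "\<dots> = exp (3 * \<tau> * \<nu> * z) * (3 * \<tau> * \<nu> * G (to_q z) + deriv G (to_q z) * (\<tau> * to_q z))"
      by (rule DERIV_imp_deriv)
         (use dG in \<open>auto intro!: derivative_eq_intros simp: algebra_simps\<close>)
    finally show ?thesis
      unfolding third_logderiv_def hG[OF z] P_def using G0 by (simp add: field_simps)
  qed
  have d1: "deriv (\<lambda>z. P (to_q z)) z = P1 (to_q z)" if "z \<in> D" for z
    using deriv_q_series[OF P, of z] that by (simp add: D_def P1_def \<tau>_def)
  have d2: "deriv (deriv (\<lambda>z. P (to_q z))) z = P2 (to_q z)" if "z \<in> D" for z
  proof -
    have "deriv (deriv (\<lambda>z. P (to_q z))) z = deriv (\<lambda>z. P1 (to_q z)) z"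
      using d1 by (rule deriv_cong_open[OF D _ that])
    thus ?thesis using deriv_q_series[OF P1, of z] that by (simp add: D_def P2_def \<tau>_def)
  qed
  have ricE: "riccati Q2 Q3 (third_logderiv h) z = E (to_q z)" if z: "z \<in> D" for z
  proof -
    have "riccati Q2 Q3 (third_logderiv h) z = riccati Q2 Q3 (\<lambda>z. P (to_q z)) z"
      using \<psi> by (rule riccati_cong_open[OF D _ z])
    also have "\<dots> = E (to_q z)"
      unfolding riccati_def d1[OF z] d2[OF z] E_def
      using g2(4)[of z] g3(4)[of z] Mz[of z] z by (simp add: D_def)
    finally show ?thesis .
  qed
  have E0: "E q = 0" if q: "q \<in> ball 0 R - {0}" for q
  proof -
    define z where "z = Ln q / \<tau>"
    have z: "to_q z = q" using q to_q_surj[of q] by (simp add: z_def \<tau>_def)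
    hence zD: "z \<in> D" using q by (simp add: D_def)
    have "\<forall>\<^sub>F w in at z. w \<in> D" using D zD by (intro eventually_at_in_open') auto
    hence "\<forall>\<^sub>F w in at z. E (to_q w) = 0"
      using ric[OF DM[OF zD]] by eventually_elim (simp add: ricE)
    moreover have "isCont (\<lambda>w. E (to_q w)) z"
    proof (rule isCont_o2[where f = to_q and g = E])
      show "isCont to_q z" using has_field_derivative_to_q by (rule DERIV_isCont)
      show "isCont E (to_q z)" using isCont_holomorphic[OF E] zD by (simp add: D_def)
    qed
    ultimately show ?thesis using isCont_eq_zero_if_eventually_zero z by metis
  qed
  have "E 0 = 0"
  proof (rule isCont_eq_zero_if_eventually_zero[where k = E and z = 0])
    show "isCont E 0" using isCont_holomorphic[OF E] R by simp
    have "\<forall>\<^sub>F q in at 0. q \<in> ball 0 R - {0::complex}" using R by (intro eventually_at_in_open) auto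
    thus "\<forall>\<^sub>F q in at 0. E q = 0" by eventually_elim (rule E0)
  qed
  hence "(\<tau> * \<nu>) ^ 3 + g2 0 * (\<tau> * \<nu>) + g3 0 = 0"
    by (simp add: E_def P_def P1_def P2_def)
  hence "\<nu> ^ 3 + g2 0 / \<tau> ^ 2 * \<nu> + g3 0 / \<tau> ^ 3 = 0"
    using \<tau> by (simp add: field_simps power2_eq_square power3_eq_cube)
  hence "poly (indicial_poly_cusp Q2 Q3) \<nu> = 0"
    unfolding indicial_poly_cusp_def g2(3) g3(3) \<tau>_def
    by (simp add: algebra_simps power2_eq_square power3_eq_cube)
  moreover have "c = exp (2 * of_real pi * \<i> * (3 * \<nu>))"
  proof -
    have "exp (\<tau> * of_int m) = 1"
      unfolding \<tau>_def using exp_integer_2pi[of "of_int m"] by (simp add: mult_ac)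
    moreover have "\<tau> * (3 * \<nu>) = \<tau> * s + \<tau> * of_int m" by (simp add: \<nu>_def field_simps)
    ultimately show ?thesis unfolding s[symmetric] \<tau>_def[symmetric] by (simp add: exp_add)
  qed
  ultimately show ?thesis by (rule that)
qed

text \<open>On a half plane where $\Phi$ has no zeros it has a holomorphic cube root, so $y = f/\Phi^{1/3}$
is a solution there. It has moderate growth, and $h = y^3$ is multiplied by $\mu^3$ under
$z \mapsto z + 1$.\<close>

lemma translation_eigenvalue_cusp:
  assumes Q: "holomorphic_at_cusp Q2" "holomorphic_at_cusp Q3"
    and \<Phi>: "\<Phi> holomorphic_on upper_halfplane M0" "\<And>z. M0 < Im z \<Longrightarrow> \<Phi> z \<noteq> 0"
      "\<And>z. M0 < Im z \<Longrightarrow> \<Phi> (z + 1) = \<Phi> z"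
    and f: "f holomorphic_on uhp" "z0 \<in> uhp" "f z0 \<noteq> 0" "\<And>z. z \<in> uhp \<Longrightarrow> f (z + 1) = \<mu> * f z"
    and ric: "\<And>z0. z0 \<in> uhp \<Longrightarrow> \<forall>\<^sub>F z in at z0. riccati Q2 Q3 (third_logderiv (\<lambda>z. f z ^ 3 / \<Phi> z)) z = 0"
  obtains \<nu> where "poly (indicial_poly_cusp Q2 Q3) \<nu> = 0" "\<mu> ^ 3 = exp (2 * of_real pi * \<i> * (3 * \<nu>))"
proof -
  obtain g2 r2 M2 B2 where g2: "g2 holomorphic_on ball 0 r2"
    "\<And>z. M2 < Im z \<Longrightarrow> Q2 z = g2 (to_q z) \<and> to_q z \<in> ball 0 r2 \<and> norm (Q2 z) \<le> B2"
    using holomorphic_at_cuspE[OF Q(1)] by metis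
  obtain g3 r3 M3 B3 where g3: "g3 holomorphic_on ball 0 r3"
    "\<And>z. M3 < Im z \<Longrightarrow> Q3 z = g3 (to_q z) \<and> to_q z \<in> ball 0 r3 \<and> norm (Q3 z) \<le> B3"
    using holomorphic_at_cuspE[OF Q(2)] by metis
  define M where "M = max (max M0 0) (max M2 M3)"
  define H where "H = upper_halfplane M"
  have H: "open H" "convex H" "connected H" "H \<subseteq> uhp" "\<And>z. z \<in> H \<longleftrightarrow> M < Im z"
    unfolding H_def
    by (simp_all add: open_upper_halfplane convex_upper_halfplane convex_connected)
       (auto simp: upper_halfplane_def uhp_def M_def)
  have M: "M0 < Im z" "M2 < Im z" "M3 < Im z" if "M < Im z" for z using that by (auto simp: M_def)
  have to_q: "to_q holomorphic_on H" unfolding to_q_def by (intro holomorphic_intros)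
  have "g2 \<circ> to_q holomorphic_on H"
    using to_q g2(1) by (rule holomorphic_on_compose_gen) (use g2(2) M H in auto)
  hence Q2: "Q2 holomorphic_on H" by (rule holomorphic_transform) (use g2(2) M H in auto)
  have "g3 \<circ> to_q holomorphic_on H"
    using to_q g3(1) by (rule holomorphic_on_compose_gen) (use g3(2) M H in auto)
  hence Q3: "Q3 holomorphic_on H" by (rule holomorphic_transform) (use g3(2) M H in auto)
  have \<i>H: "Complex 0 (M + 1) \<in> H" by (simp add: H)
  have "\<exists>z1\<in>H. f z1 \<noteq> 0"
  proof (rule ccontr)
    assume "\<not> (\<exists>z1\<in>H. f z1 \<noteq> 0)"
    hence zero: "f z = 0" if "z \<in> H" for z using that by blast
    have "H \<noteq> {}" using \<i>H by blast
    from analytic_continuation_open[OF H(1) open_uhp this convex_connected[OF convex_uhp] H(4)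
        f(1) holomorphic_on_const zero f(2)]
    have "f z0 = 0" by simp
    with f(3) show False by contradiction
  qed
  then obtain z1 where z1: "z1 \<in> H" "f z1 \<noteq> 0" by blast
  have \<Phi>H: "\<Phi> holomorphic_on H"
    using \<Phi>(1) by (rule holomorphic_on_subset) (auto simp: H_def upper_halfplane_def M_def)
  have \<Phi>nz: "\<Phi> z \<noteq> 0" if "z \<in> H" for z using \<Phi>(2) M(1) H(5) that by blast
  have "\<exists>L. L holomorphic_on H \<and> (\<forall>z\<in>H. exp (L z) = \<Phi> z)"
    using holomorphic_logarithm_exists[OF H(2,1) \<Phi>H \<Phi>nz \<i>H] by metis
  then obtain L where L: "L holomorphic_on H" "\<And>z. z \<in> H \<Longrightarrow> exp (L z) = \<Phi> z"
    by blast
  define y where "y z = f z * exp (- L z / 3)" for z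
  have y: "y holomorphic_on H"
    unfolding y_def using H(4) f(1) L(1) by (intro holomorphic_intros) (auto intro: holomorphic_on_subset)
  have y1: "y z1 \<noteq> 0" using z1 by (simp add: y_def)
  define h where "h z = f z ^ 3 / \<Phi> z" for z
  have h: "h z = y z ^ 3" if "z \<in> H" for z
  proof -
    have "exp (- L z / 3) ^ 3 = exp (- L z)" by (simp flip: exp_of_nat_mult)
    hence "y z ^ 3 = f z ^ 3 * exp (- L z)" by (simp only: y_def power_mult_distrib)
    also have "exp (- L z) = inverse (\<Phi> z)" by (simp only: exp_minus L(2)[OF that])
    finally show ?thesis by (simp only: h_def divide_inverse)
  qed
  have ric': "\<forall>\<^sub>F z in at z0. riccati Q2 Q3 (third_logderiv h) z = 0" if "z0 \<in> H" for z0
    using ric[of z0] that H(4) unfolding h_def by blast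
  have ode: "(deriv ^^ 3) y z + Q2 z * deriv y z + Q3 z * y z = 0" if "M < Im z" for z
    by (rule riccati_solution[OF Q2 Q3 H(1,3) y z1(1) y1 h ric']) (use that H in auto)
  define B where "B = max B2 B3"
  have B: "norm (Q2 z) \<le> B" "norm (Q3 z) \<le> B" if "M < Im z" for z
    using g2(2)[of z] g3(2)[of z] M[OF that] by (auto simp: B_def)
  have "\<exists>C K. \<forall>z. M + 1 \<le> Im z \<and> 0 \<le> Re z \<and> Re z \<le> 1 \<longrightarrow> norm (y z) \<le> C * exp (K * Im z)"
  proof (rule third_order_equation_growth[OF y[unfolded H_def] ode B])
    fix C K
    assume "\<And>z. \<lbrakk>M + 1 \<le> Im z; 0 \<le> Re z; Re z \<le> 1\<rbrakk> \<Longrightarrow> norm (y z) \<le> C * exp (K * Im z)"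
    thus ?thesis by blast
  qed auto
  then obtain C K
    where growth: "\<And>z. \<lbrakk>M + 1 \<le> Im z; 0 \<le> Re z; Re z \<le> 1\<rbrakk> \<Longrightarrow> norm (y z) \<le> C * exp (K * Im z)"
    by blast
  have hgrowth: "norm (h z) \<le> C ^ 3 * exp ((3 * K) * Im z)" if "M + 1 \<le> Im z" "0 \<le> Re z" "Re z \<le> 1" for z
  proof -
    have "norm (h z) = norm (y z) ^ 3" using h[of z] that H(5)[of z] by (simp add: norm_power)
    also have "\<dots> \<le> (C * exp (K * Im z)) ^ 3" using growth[OF that] by (intro power_mono) auto
    also have "\<dots> = C ^ 3 * exp ((3 * K) * Im z)"
      by (simp add: power_mult_distrib mult.assoc flip: exp_of_nat_mult)
    finally show ?thesis .
  qed
  have hH: "h holomorphic_on upper_halfplane M"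
  proof (rule holomorphic_transform[of "\<lambda>z. y z ^ 3"])
    show "(\<lambda>z. y z ^ 3) holomorphic_on upper_halfplane M"
      using y unfolding H_def by (intro holomorphic_intros)
  qed (use h in \<open>simp add: H_def\<close>)
  have per: "h (z + 1) = \<mu> ^ 3 * h z" if "M < Im z" for z
  proof -
    have "z \<in> uhp" using that H by blast
    thus ?thesis using f(4)[of z] \<Phi>(3)[OF M(1)[OF that]] by (simp add: h_def power_mult_distrib)
  qed
  have "\<mu> \<noteq> 0"
  proof
    assume "\<mu> = 0"
    moreover have "z0 - 1 \<in> uhp" using f(2) by (simp add: uhp_def)
    ultimately have "f z0 = 0" using f(4)[of "z0 - 1"] by simp
    with f(3) show False by contradiction
  qed
  hence \<mu>: "\<mu> ^ 3 \<noteq> 0" by simp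
  have h1: "M < Im z1" "h z1 \<noteq> 0" using z1 y1 h H(5) by auto
  have ric'': "\<forall>\<^sub>F z in at z0. riccati Q2 Q3 (third_logderiv h) z = 0" if "M < Im z0" for z0
    using ric' H(5) that by blast
  show ?thesis
  proof (rule riccati_cusp_exponent[OF Q hH per \<mu> hgrowth h1 ric''])
    fix \<nu> assume "poly (indicial_poly_cusp Q2 Q3) \<nu> = 0" "\<mu> ^ 3 = exp (2 * of_real pi * \<i> * (3 * \<nu>))"
    thus ?thesis by (rule that)
  qed
qed


section \<open>Local exponents\<close>

lemma cubic_ordered_roots:
  fixes p :: "complex poly"
  assumes p: "p = [:c, b, a, 1:]" and real: "real_roots p"
  shows "p = [:- of_real (ordered_root p 1), 1:] * [:- of_real (ordered_root p 2), 1:]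
    * [:- of_real (ordered_root p 3), 1:]"
proof -
  have deg: "degree p = 3" "lead_coeff p = 1" by (simp_all add: p)
  define xs where "xs = sorted_list_of_multiset (image_mset Re (proots p))"
  have mset: "mset xs = image_mset Re (proots p)" by (simp add: xs_def)
  have "length xs = size (proots p)" by (metis mset size_image_mset size_mset)
  hence len: "length xs = 3" using deg by (simp add: size_proots_complex)
  have "xs = [xs ! 0, xs ! 1, xs ! 2]"
    using len by (intro nth_equalityI) (auto simp: less_Suc_eq numeral_eq_Suc nth_Cons split: nat.splits)
  hence xs: "xs = [ordered_root p 1, ordered_root p 2, ordered_root p 3]"
    unfolding ordered_root_def xs_def[symmetric] by simp
  have "image_mset (complex_of_real \<circ> Re) (proots p) = image_mset id (proots p)"
    using real by (intro image_mset_cong) (auto simp: real_roots_def)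
  hence "proots p = image_mset of_real (mset xs)"
    unfolding mset by (simp add: image_mset.compositionality o_def)
  hence "proots p = {#of_real (ordered_root p 1), of_real (ordered_root p 2), of_real (ordered_root p 3)#}"
    by (subst (asm) xs) simp
  moreover have "p = (\<Prod>x\<in>#proots p. [:- x, 1:])"
    using complex_poly_decompose_multiset[of p] by (metis deg(2) smult_1_left)
  moreover have "(\<Prod>x\<in>#{#a, b, c#}. [:- x, 1:]) = [:- a, 1:] * [:- b, 1:] * [:- c, 1:]" for a b c :: complex
    by (simp only: image_mset_add_mset image_mset_empty prod_mset.add_mset prod_mset.empty
        mult_1_right mult.assoc)
  ultimately show ?thesis by (simp only:)
qed

lemma cubic_root_is_ordered_root:
  fixes p :: "complex poly"
  assumes "p = [:c, b, a, 1:]" "real_roots p" "poly p x = 0"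
  shows "x \<in> {of_real (ordered_root p 1), of_real (ordered_root p 2), of_real (ordered_root p 3)}"
proof -
  have "poly ([:- of_real (ordered_root p 1), 1:] * [:- of_real (ordered_root p 2), 1:]
    * [:- of_real (ordered_root p 3), 1:]) x = 0"
    using assms(3) cubic_ordered_roots[OF assms(1,2)] by argo
  moreover have "poly ([:- a, 1:] * [:- b, 1:] * [:- c, 1:]) x = (x - a) * (x - b) * (x - c)"
    for a b c :: complex
    by (simp only: poly_mult) simp
  ultimately show ?thesis by (simp only: mult_eq_0_iff) auto
qed

lemma sum_ordered_roots:
  fixes p :: "complex poly"
  assumes "p = [:c, b, of_real a, 1:]" "real_roots p"
  shows "ordered_root p 1 + ordered_root p 2 + ordered_root p 3 = - a"
proof -
  define e1 e2 e3 where "e1 = ordered_root p 1" and "e2 = ordered_root p 2" and "e3 = ordered_root p 3"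
  have "[:c, b, of_real a, 1:] = [:- of_real e1, 1:] * [:- of_real e2, 1:] * [:- of_real e3, 1:]"
    using cubic_ordered_roots[OF assms] unfolding assms(1)[symmetric] e1_def e2_def e3_def .
  hence "complex_of_real a = - of_real e1 - of_real e2 - of_real e3"
    by (simp add: algebra_simps)
  hence "a = - e1 - e2 - e3" by (metis of_real_diff of_real_eq_iff of_real_minus)
  thus ?thesis unfolding e1_def e2_def e3_def by linarith
qed

lemma indicial_poly_cubic:
  "indicial_poly Q2 Q3 z = [:leading_coefficient 3 Q3 z, 2 + leading_coefficient 2 Q2 z, of_real (-3), 1:]"
  by (simp add: indicial_poly_def algebra_simps)

text \<open>A value of \<open>Lim\<close> says something only together with convergence, which follows from the bound on the
order of the pole.\<close>

lemma leading_coefficient_limit: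
  assumes Q: "Q nicely_meromorphic_on uhp" and z: "z \<in> uhp" and j: "j > 0"
    and ord: "is_pole Q z \<Longrightarrow> zorder Q z \<ge> - int j"
  shows "((\<lambda>w. (w - z) ^ j * Q w) \<longlongrightarrow> leading_coefficient j Q z) (at z)"
    and "\<not> is_pole Q z \<Longrightarrow> leading_coefficient j Q z = 0"
proof -
  have "\<exists>A. ((\<lambda>w. (w - z) ^ j * Q w) \<longlongrightarrow> A) (at z) \<and> (\<not> is_pole Q z \<longrightarrow> A = 0)"
  proof (cases "is_pole Q z")
    case False
    hence "Q analytic_on {z}"
      using Q z nicely_meromorphic_on_imp_analytic_at by blast
    hence "isCont Q z" using analytic_at_imp_isCont by blast
    hence "((\<lambda>w. (w - z) ^ j * Q w) \<longlongrightarrow> (z - z) ^ j * Q z) (at z)"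
      by (intro tendsto_intros) (simp add: isCont_def)
    thus ?thesis using j by (auto simp: power_0_left)
  next
    case True
    have iso: "isolated_singularity_at Q z" "not_essential Q z"
      using Q z unfolding nicely_meromorphic_on_def
      by (auto intro: meromorphic_on_isolated_singularity meromorphic_on_not_essential meromorphic_on_subset)
    have "\<exists>\<^sub>F w in at z. Q w \<noteq> 0"
      using True non_zero_neighbour_pole by (intro eventually_frequently) auto
    from zorder_exist[OF iso this] obtain r where r: "r > 0" "zor_poly Q z holomorphic_on cball z r"
      "\<forall>w\<in>cball z r - {z}. Q w = zor_poly Q z w * (w - z) powi zorder Q z \<and> zor_poly Q z w \<noteq> 0"
      by auto
    define n where "n = nat (zorder Q z + int j)"
    have n: "int n = zorder Q z + int j" using ord[OF True] by (simp add: n_def)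
    have ev: "\<forall>\<^sub>F w in at z. w \<in> ball z r - {z}" using r(1) by (intro eventually_at_in_open) auto
    have "continuous_on (ball z r) (zor_poly Q z)"
      using r(2) by (intro holomorphic_on_imp_continuous_on) (auto intro: holomorphic_on_subset)
    hence "isCont (zor_poly Q z) z" using r(1) by (simp add: continuous_on_eq_continuous_at)
    hence "((\<lambda>w. (w - z) ^ n * zor_poly Q z w) \<longlongrightarrow> (z - z) ^ n * zor_poly Q z z) (at z)"
      by (intro tendsto_intros) (simp add: isCont_def)
    moreover have "\<forall>\<^sub>F w in at z. (w - z) ^ n * zor_poly Q z w = (w - z) ^ j * Q w"
      using ev
    proof eventually_elim
      case (elim w)
      hence "Q w = zor_poly Q z w * (w - z) powi zorder Q z" "w - z \<noteq> 0" using r(3) by auto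
      moreover have "(w - z) ^ n = (w - z) powi (zorder Q z + int j)"
        unfolding n[symmetric] by simp
      ultimately show ?case by (simp add: power_int_add)
    qed
    ultimately have "((\<lambda>w. (w - z) ^ j * Q w) \<longlongrightarrow> (z - z) ^ n * zor_poly Q z z) (at z)"
      by (rule Lim_transform_eventually)
    thus ?thesis using True by blast
  qed
  then obtain A where A: "((\<lambda>w. (w - z) ^ j * Q w) \<longlongrightarrow> A) (at z)" "\<not> is_pole Q z \<Longrightarrow> A = 0" by blast
  have "leading_coefficient j Q z = A"
    unfolding leading_coefficient_def using A(1) by (intro tendsto_Lim) auto
  thus "((\<lambda>w. (w - z) ^ j * Q w) \<longlongrightarrow> leading_coefficient j Q z) (at z)"
    "\<not> is_pole Q z \<Longrightarrow> leading_coefficient j Q z = 0" using A by auto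
qed

lemma regular_local_exponents:
  assumes "leading_coefficient 2 Q2 z = 0" "leading_coefficient 3 Q3 z = 0"
  shows "real_roots (indicial_poly Q2 Q3 z)" "local_exponent Q2 Q3 z 1 = 0"
    "local_exponent Q2 Q3 z 2 = 1" "local_exponent Q2 Q3 z 3 = 2"
proof -
  have "proots (indicial_poly Q2 Q3 z) = proots ([:0, 1:] * [:-1, 1:] * [:-2, 1:])"
    using assms by (simp add: indicial_poly_def)
  also have "\<dots> = proots ([:0, 1:] * [:-1, 1:]) + proots [:-2, 1:]"
    by (rule proots_mult) auto
  also have "proots ([:0, 1:] * [:-1, 1:]) = proots [:0, 1:] + proots [:-1, 1 :: complex:]"
    by (rule proots_mult) auto
  also have "proots [:0, 1:] + proots [:-1, 1:] + proots [:-2, 1:] = {#0, 1, 2 :: complex#}"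
    by (simp only: proots_linear_factor) simp
  finally have *: "proots (indicial_poly Q2 Q3 z) = {#0, 1, 2#}" .
  show "real_roots (indicial_poly Q2 Q3 z)" using * by (simp add: real_roots_def)
  have "sorted_list_of_multiset {#0, 1, 2::real#} = [0, 1, 2]" by simp
  thus "local_exponent Q2 Q3 z 1 = 0" "local_exponent Q2 Q3 z 2 = 1" "local_exponent Q2 Q3 z 3 = 2"
    unfolding local_exponent_def ordered_root_def * by simp_all
qed

text \<open>At a regular point the exponents are $0, 1, 2$, so that these facts hold at every point of the upper half
plane, and singular and regular points need no distinction later on.\<close>

lemma local_exponents_structure:
  assumes M: "MODE Q2 Q3" and "H1 Q2 Q3" and H2: "H2 Q2 Q3" and z: "z \<in> uhp"
  defines "e \<equiv> local_exponent Q2 Q3 z"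
  shows "real_roots (indicial_poly Q2 Q3 z)"
    "\<exists>n::int. e 1 = of_int n / 3" "e 2 - e 1 \<in> \<int>" "e 3 - e 1 \<in> \<int>" "e 1 + e 2 + e 3 = 3"
proof -
  have *: "real_roots (indicial_poly Q2 Q3 z) \<and>
    (\<exists>n::int. e 1 = of_int n / 3) \<and> e 2 - e 1 \<in> \<int> \<and> e 3 - e 1 \<in> \<int>"
  proof (cases "z \<in> singular_points Q2 Q3")
    case True
    thus ?thesis using H2 unfolding H2_def e_def third_nonpos_int_def by auto
  next
    case False
    hence np: "\<not> is_pole Q2 z" "\<not> is_pole Q3 z" using z by (auto simp: singular_points_def)
    have "leading_coefficient 2 Q2 z = 0"
      by (rule leading_coefficient_limit(2)[of Q2]) (use M z np in \<open>auto simp: MODE_def\<close>)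
    moreover have "leading_coefficient 3 Q3 z = 0"
      by (rule leading_coefficient_limit(2)[of Q3]) (use M z np in \<open>auto simp: MODE_def\<close>)
    ultimately show ?thesis using regular_local_exponents[of Q2 z Q3] unfolding e_def
      by (auto intro: exI[of _ 0])
  qed
  thus "real_roots (indicial_poly Q2 Q3 z)"
    "\<exists>n::int. e 1 = of_int n / 3" "e 2 - e 1 \<in> \<int>" "e 3 - e 1 \<in> \<int>" by blast+
  show "e 1 + e 2 + e 3 = 3"
    using sum_ordered_roots[OF indicial_poly_cubic, of Q2 Q3 z] * unfolding e_def local_exponent_def by simp
qed

lemma cusp_root_third_integer:
  assumes "H3 Q2 Q3" "poly (indicial_poly_cusp Q2 Q3) \<nu> = 0"
  shows "\<exists>n::int. 3 * \<nu> = of_int n"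
proof -
  let ?e = "cusp_exponent Q2 Q3"
  have *: "real_roots (indicial_poly_cusp Q2 Q3)" "third_nonpos_int (?e 1)"
    "?e 2 - ?e 1 \<in> \<int>" "?e 3 - ?e 1 \<in> \<int>" using assms(1) by (auto simp: H3_def)
  obtain n where n: "?e 1 = of_int n / 3" using *(2) by (auto simp: third_nonpos_int_def)
  obtain a b where a: "?e 2 - ?e 1 = of_int a" and b: "?e 3 - ?e 1 = of_int b"
    using *(3,4) by (elim Ints_cases)
  have "3 * ?e 1 = of_int n" "3 * ?e 2 = of_int (n + 3 * a)" "3 * ?e 3 = of_int (n + 3 * b)"
    using n a b by (simp_all add: field_simps)
  moreover have "\<nu> \<in> {of_real (?e 1), of_real (?e 2), of_real (?e 3)}"
    using cubic_root_is_ordered_root[OF indicial_poly_cusp_def *(1) assms(2)]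
    by (simp add: cusp_exponent_def)
  ultimately have "\<exists>x::real. \<nu> = of_real x \<and> (\<exists>k::int. 3 * x = of_int k)" by blast
  then obtain x and k :: int where "\<nu> = of_real x" "3 * x = of_int k" by blast
  thus ?thesis by (metis of_real_mult of_real_numeral of_real_of_int_eq)
qed

text \<open>For an odd sum, the number of odd entries is one or three; it is three exactly when all
entries have the same parity.\<close>

lemma mset_cong_parity_iff:
  fixes n1 n2 n3 :: int
  assumes "odd (n1 + n2 + n3)"
  shows "mset_cong {#of_int n1, of_int n2, of_int n3#} {#0, 0, 1#} 2 \<longleftrightarrow>
    \<not> (even (n2 - n1) \<and> even (n3 - n1))"
proof -
  have cong: "[of_int n = of_int k] (rmod 2) \<longleftrightarrow> (even n \<longleftrightarrow> even k)" for n k :: int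
  proof -
    have "[of_int n = (of_int k :: real)] (rmod 2) \<longleftrightarrow> (\<exists>m::int. (of_int k :: real) = of_int n + of_int m * 2)"
      by (rule rcong_altdef)
    also have "\<dots> \<longleftrightarrow> (\<exists>m::int. k = n + m * 2)"
    proof -
      have "of_int n + of_int m * 2 = (of_int (n + m * 2) :: real)" for m by simp
      thus ?thesis by (simp only: of_int_eq_iff)
    qed
    also have "\<dots> \<longleftrightarrow> (even n \<longleftrightarrow> even k)"
    proof
      assume "even n \<longleftrightarrow> even k"
      hence "even (k - n)" by auto
      then obtain m where "k - n = 2 * m" by blast
      thus "\<exists>m. k = n + m * 2" by (intro exI[of _ m]) simp
    qed auto
    finally show ?thesis .
  qed
  let ?R = "\<lambda>a b. [a = b] (rmod (2::real))"
  have c0: "?R (of_int n) 0 \<longleftrightarrow> even n" for n using cong[of n 0] by simp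
  have c1: "?R (of_int n) 1 \<longleftrightarrow> odd n" for n using cong[of n 1] by simp
  show ?thesis
  proof
    assume "mset_cong {#of_int n1, of_int n2, of_int n3#} {#0, 0, 1#} 2"
    hence "rel_mset ?R {#of_int n1, of_int n2, of_int n3#} {#0, 0, 1#}" by (simp add: mset_cong_def)
    from msed_rel_invR[OF this] obtain N a
      where "{#of_int n1, of_int n2, of_int n3#} = add_mset a N" "?R a 0" by blast
    hence "a \<in># {#of_int n1, of_int n2, of_int n3#}" "?R a 0" by simp_all
    then obtain n where "n \<in> {n1, n2, n3}" "even n"
      using c0 by auto
    moreover have "odd n1" if "even (n2 - n1) \<and> even (n3 - n1)" using assms that by auto
    ultimately show "\<not> (even (n2 - n1) \<and> even (n3 - n1))" by auto
  next
    assume "\<not> (even (n2 - n1) \<and> even (n3 - n1))"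
    with assms consider "odd n1" "even n2" "even n3" | "even n1" "odd n2" "even n3"
      | "even n1" "even n2" "odd n3" by auto
    thus "mset_cong {#of_int n1, of_int n2, of_int n3#} {#0, 0, 1#} 2"
    proof cases
      case 1
      have "rel_mset ?R {#of_int n2, of_int n3, of_int n1#} {#0, 0, 1#}"
        using 1 by (intro rel_mset_Plus rel_mset_Zero) (simp_all add: c0 c1)
      thus ?thesis by (simp add: mset_cong_def add_mset_commute)
    next
      case 2
      have "rel_mset ?R {#of_int n1, of_int n3, of_int n2#} {#0, 0, 1#}"
        using 2 by (intro rel_mset_Plus rel_mset_Zero) (simp_all add: c0 c1)
      thus ?thesis by (simp add: mset_cong_def add_mset_commute)
    next
      case 3
      have "rel_mset ?R {#of_int n1, of_int n2, of_int n3#} {#0, 0, 1#}"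
        using 3 by (intro rel_mset_Plus rel_mset_Zero) (simp_all add: c0 c1)
      thus ?thesis by (simp add: mset_cong_def)
    qed
  qed
qed


section \<open>The cube of the Bol factor\<close>

text \<open>A class for $F^3$: a finite product of integer powers, possibly negative, of the functions \<open>G\<close>
with \<open>cusp_bounded_periodic G\<close> that do not vanish identically.
Such a product has no zeros or poles high up in the half plane.\<close>

definition cusp_regular :: "(complex \<Rightarrow> complex) \<Rightarrow> bool" where
  "cusp_regular \<Phi> \<longleftrightarrow> \<Phi> meromorphic_on uhp \<and>
     (\<exists>M. \<Phi> holomorphic_on upper_halfplane M \<and> (\<forall>z. M < Im z \<longrightarrow> \<Phi> z \<noteq> 0 \<and> \<Phi> (z + 1) = \<Phi> z))"

text \<open>The q-expansion of \<open>G\<close> has an isolated zero at $q = 0$, if any.\<close>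

lemma cusp_regular_powi:
  assumes G: "cusp_bounded_periodic G" and nz: "z0 \<in> uhp" "G z0 \<noteq> 0"
  shows "cusp_regular (\<lambda>z. G z powi n)"
proof -
  have Gh: "G holomorphic_on uhp" and per: "\<And>z. G (z + 1) = G z"
    using G by (auto simp: cusp_bounded_periodic_def)
  obtain B where B: "\<And>z. Im z \<ge> 1 \<Longrightarrow> norm (G z) \<le> B"
    using G unfolding cusp_bounded_periodic_def by blast
  have up: "upper_halfplane 0 = uhp" by (simp add: upper_halfplane_def uhp_def)
  have "\<exists>M>0. \<forall>z. M < Im z \<longrightarrow> G z \<noteq> 0"
  proof (rule periodic_moderate_growth_q_expansion[of G 0 1 B 0 z0])
    fix m :: int and g r
    assume r: "r > 0" and g: "\<And>q. q \<in> ball 0 r \<Longrightarrow> g q \<noteq> 0"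
      "\<And>z. to_q z \<in> ball 0 r \<Longrightarrow> 0 < Im z \<and> G z = to_q z powi m * g (to_q z)"
    have "G z \<noteq> 0" if z: "max 1 (- ln r / (2 * pi)) < Im z" for z
    proof -
      have "exp (- 2 * pi * (- ln r / (2 * pi))) = r" using r by simp
      hence "norm (to_q z) < r" using norm_to_q_less_iff[of z "- ln r / (2 * pi)"] z by simp
      hence "to_q z \<in> ball 0 r" by simp
      thus ?thesis using g by simp
    qed
    thus ?thesis by (intro exI[of _ "max 1 (- ln r / (2 * pi))"]) auto
  qed (use Gh up per B nz in \<open>auto simp: uhp_def\<close>)
  then obtain M where M: "M > 0" "\<And>z. M < Im z \<Longrightarrow> G z \<noteq> 0" by blast
  have "G meromorphic_on uhp"
    using Gh by (intro analytic_on_imp_meromorphic_on) (simp add: analytic_on_open open_uhp)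
  hence "(\<lambda>z. G z powi n) meromorphic_on uhp" by (rule meromorphic_on_powi)
  moreover have "(\<lambda>z. G z powi n) holomorphic_on upper_halfplane M"
  proof (rule holomorphic_on_power_int)
    show "G holomorphic_on upper_halfplane M"
      using Gh by (rule holomorphic_on_subset) (use M in \<open>auto simp: uhp_def upper_halfplane_def\<close>)
  qed (use M in \<open>auto simp: upper_halfplane_def\<close>)
  ultimately show ?thesis unfolding cusp_regular_def using M per by (auto intro!: exI[of _ M])
qed

lemma cusp_regular_mult:
  assumes "cusp_regular f" "cusp_regular g"
  shows "cusp_regular (\<lambda>z. f z * g z)"
proof -
  obtain A B where A: "f holomorphic_on upper_halfplane A" "\<And>z. A < Im z \<Longrightarrow> f z \<noteq> 0 \<and> f (z + 1) = f z"
    and B: "g holomorphic_on upper_halfplane B" "\<And>z. B < Im z \<Longrightarrow> g z \<noteq> 0 \<and> g (z + 1) = g z"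
    using assms unfolding cusp_regular_def by blast
  have "(\<lambda>z. f z * g z) holomorphic_on upper_halfplane (max A B)"
    by (intro holomorphic_intros holomorphic_on_subset[OF A(1)] holomorphic_on_subset[OF B(1)])
       (auto simp: upper_halfplane_def)
  moreover have "(\<lambda>z. f z * g z) meromorphic_on uhp"
    using assms unfolding cusp_regular_def by (intro meromorphic_on_mult) auto
  ultimately show ?thesis
    unfolding cusp_regular_def using A(2) B(2) by (auto intro!: exI[of _ "max A B"])
qed

lemma cusp_regular_const: "c \<noteq> 0 \<Longrightarrow> cusp_regular (\<lambda>_. c)"
  unfolding cusp_regular_def by auto

lemma cusp_regular_prod:
  assumes "finite A" "\<And>w. w \<in> A \<Longrightarrow> cusp_regular (g w)"
  shows "cusp_regular (\<lambda>z. \<Prod>w\<in>A. g w z)"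
  using assms by (induction A rule: finite_induct) (simp_all add: cusp_regular_const cusp_regular_mult)

lemma cusp_regular_nonzero_nearby:
  assumes "cusp_regular \<Phi>" "z0 \<in> uhp"
  shows "\<forall>\<^sub>F z in at z0. \<Phi> z \<noteq> 0"
proof -
  obtain M where M: "\<And>z. M < Im z \<Longrightarrow> \<Phi> z \<noteq> 0" and mero: "\<Phi> meromorphic_on uhp"
    using assms(1) unfolding cusp_regular_def by blast
  from meromorphic_imp_constant_or_avoid[OF mero open_uhp convex_connected[OF convex_uhp], of 0]
  show ?thesis
  proof
    assume *: "\<forall>\<^sub>\<approx>z\<in>uhp. \<Phi> z = 0"
    define w where "w = Complex 0 (max M 0 + 1)"
    have w: "w \<in> uhp" "w \<in> upper_halfplane M" by (auto simp: w_def uhp_def upper_halfplane_def)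
    have "\<forall>\<^sub>F z in at w. \<Phi> z = 0" using * w(1) by (simp add: eventually_cosparse_open_eq open_uhp)
    moreover have "\<forall>\<^sub>F z in at w. z \<in> upper_halfplane M"
      using w(2) open_upper_halfplane by (intro eventually_at_in_open') auto
    ultimately have "\<forall>\<^sub>F z in at w. False"
      by eventually_elim (use M in \<open>auto simp: upper_halfplane_def\<close>)
    thus ?thesis by simp
  next
    assume "\<forall>\<^sub>\<approx>z\<in>uhp. \<Phi> z \<noteq> 0"
    thus ?thesis using assms(2) by (simp add: eventually_cosparse_open_eq open_uhp)
  qed
qed

text \<open>The cube of $G^a$ is an integer power when $3a$ is an integer, so the branch of the logarithm
disappears.\<close>

lemma power_branch_cube:
  assumes "power_branch U G a p" "3 * a = of_int n"
  shows "z \<in> U \<Longrightarrow> G z \<noteq> 0" "z \<in> U \<Longrightarrow> p z \<noteq> 0" "z \<in> U \<Longrightarrow> p z ^ 3 = G z powi n"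
proof -
  obtain L where L: "\<And>z. z \<in> U \<Longrightarrow> exp (L z) = G z \<and> p z = exp (of_real a * L z)"
    using assms(1) unfolding power_branch_def by blast
  show "z \<in> U \<Longrightarrow> G z \<noteq> 0" "z \<in> U \<Longrightarrow> p z \<noteq> 0" using L[of z] by (metis exp_not_eq_zero)+
  assume z: "z \<in> U"
  have "p z ^ 3 = exp (of_real (3 * a) * L z)"
    using L[OF z] by (simp add: mult.assoc flip: exp_of_nat_mult)
  also have "\<dots> = exp (L z) powi n" unfolding assms(2) exp_power_int by simp
  finally show "p z ^ 3 = G z powi n" using L[OF z] by simp
qed

lemma bol_factor_cube:
  assumes F: "bol_factor_branch Q2 Q3 Z U F" and Z: "finite Z" and U: "U \<subseteq> uhp" "U \<noteq> {}"
    and int: "3 * cusp_exponent Q2 Q3 1 \<in> \<int>" "\<And>w. w \<in> insert \<i> (insert rho_pt Z) \<Longrightarrow> 3 * local_exponent Q2 Q3 w 1 \<in> \<int>"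
  obtains \<Phi> where "cusp_regular \<Phi>" "\<And>z. z \<in> U \<Longrightarrow> F z \<noteq> 0 \<and> F z ^ 3 = \<Phi> z"
proof -
  obtain p_inf p_rho p_i p where
    p: "power_branch U Delta (- cusp_exponent Q2 Q3 1) p_inf"
       "power_branch U (Eisenstein 4) (- local_exponent Q2 Q3 rho_pt 1) p_rho"
       "power_branch U (Eisenstein 6) (- local_exponent Q2 Q3 \<i> 1) p_i"
       "\<And>w. w \<in> Z \<Longrightarrow> power_branch U (F_factor w) (- local_exponent Q2 Q3 w 1) (p w)"
    and Feq: "\<And>z. z \<in> U \<Longrightarrow> F z = p_inf z * p_rho z * p_i z * (\<Prod>w\<in>Z. p w z)"
    using F unfolding bol_factor_branch_def by blast
  have "\<exists>n. \<forall>w\<in>insert \<i> (insert rho_pt Z). 3 * (- local_exponent Q2 Q3 w 1) = of_int (n w)"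
  proof (intro bchoice ballI)
    fix w assume "w \<in> insert \<i> (insert rho_pt Z)"
    hence "- (3 * local_exponent Q2 Q3 w 1) \<in> \<int>" using int(2)[of w] by (intro Ints_minus)
    thus "\<exists>n. 3 * (- local_exponent Q2 Q3 w 1) = of_int n" by (metis Ints_cases mult_minus_right)
  qed
  then obtain n where n: "\<And>w. w \<in> insert \<i> (insert rho_pt Z) \<Longrightarrow> 3 * (- local_exponent Q2 Q3 w 1) = of_int (n w)"
    by blast
  have "- (3 * cusp_exponent Q2 Q3 1) \<in> \<int>" using int(1) by (rule Ints_minus)
  then obtain k where k: "3 * (- cusp_exponent Q2 Q3 1) = of_int k" by (metis Ints_cases mult_minus_right)
  obtain z0 where z0: "z0 \<in> U" "z0 \<in> uhp" using U by blast
  note pinf = power_branch_cube[OF p(1) k] and prho = power_branch_cube[OF p(2) n[of rho_pt]]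
    and pi = power_branch_cube[OF p(3) n[of \<i>]] and pw = power_branch_cube[OF p(4) n]
  define \<Phi> where "\<Phi> z = Delta z powi k * Eisenstein 4 z powi n rho_pt * Eisenstein 6 z powi n \<i>
    * (\<Prod>w\<in>Z. F_factor w z powi n w)" for z
  have "cusp_regular \<Phi>"
    unfolding \<Phi>_def[abs_def]
  proof (intro cusp_regular_mult cusp_regular_prod Z)
    show "cusp_regular (\<lambda>z. Delta z powi k)"
      by (rule cusp_regular_powi[OF cusp_bounded_periodic_Delta z0(2)]) (use pinf z0 in auto)
    show "cusp_regular (\<lambda>z. Eisenstein 4 z powi n rho_pt)"
      by (rule cusp_regular_powi[OF cusp_bounded_periodic_Eisenstein z0(2)]) (use prho z0 in auto)
    show "cusp_regular (\<lambda>z. Eisenstein 6 z powi n \<i>)"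
      by (rule cusp_regular_powi[OF cusp_bounded_periodic_Eisenstein z0(2)]) (use pi z0 in auto)
    show "cusp_regular (\<lambda>z. F_factor w z powi n w)" if "w \<in> Z" for w
      by (rule cusp_regular_powi[OF cusp_bounded_periodic_F_factor z0(2)]) (use pw that z0 in auto)
  qed
  moreover have "F z \<noteq> 0 \<and> F z ^ 3 = \<Phi> z" if z: "z \<in> U" for z
  proof -
    have "(\<Prod>w\<in>Z. p w z) ^ 3 = (\<Prod>w\<in>Z. F_factor w z powi n w)"
      unfolding prod_power_distrib using pw z by (intro prod.cong) auto
    moreover have "(\<Prod>w\<in>Z. p w z) \<noteq> 0" using Z pw z by auto
    ultimately show ?thesis
      using Feq[OF z] pinf[of z] prho[of z] pi[of z] z by (simp add: \<Phi>_def power_mult_distrib)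
  qed
  ultimately show ?thesis by (rule that)
qed


section \<open>Linear combinations of the components of the Bol vector\<close>

text \<open>The bilinear pairing, without complex conjugation, so that \<open>\<lambda>z. cdot c (Yhat z)\<close> runs
through the span of the components of \<open>Yhat\<close>.\<close>

definition cdot :: "complex^3 \<Rightarrow> complex^3 \<Rightarrow> complex" where
  "cdot c v = (\<Sum>i\<in>UNIV. c $ i * v $ i)"

lemma cdot_matrix_vector_mult: "cdot c (A *v y) = cdot (transpose A *v c) y"
  by (simp add: cdot_def matrix_vector_mult_def transpose_def sum_3 algebra_simps)

lemma cdot_scale: "cdot c (a *s y) = a * cdot c y" "cdot (a *s c) y = a * cdot c y"
  by (simp_all add: cdot_def sum_3 algebra_simps)

text \<open>Applied to vectors of derivatives, this provides a combination of the components in which two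
prescribed Taylor coefficients vanish.\<close>

lemma exists_common_annihilator:
  fixes a b :: "complex^3"
  obtains c where "c \<noteq> 0" "cdot c a = 0" "cdot c b = 0"
proof -
  define M :: "complex^3^3" where "M = (\<chi> r. if r = 1 then a else if r = 2 then b else 0)"
  have "det (M - mat 0) = 0" by (simp add: mat_0 det_3 M_def)
  then obtain c where c: "c \<noteq> 0" "M *v c = 0" unfolding singular_iff_eigenvector by auto
  have "(M *v c) $ 1 = cdot c a" "(M *v c) $ 2 = cdot c b"
    by (simp_all add: M_def matrix_vector_mult_def cdot_def mult.commute)
  with c show ?thesis using that[of c] by simp
qed

lemma higher_deriv_cdot:
  assumes "\<And>i. (\<lambda>z. Y z $ i) holomorphic_on U" "open U" "z \<in> U"
  shows "(deriv ^^ n) (\<lambda>z. cdot c (Y z)) z = cdot c (\<chi> i. (deriv ^^ n) (\<lambda>z. Y z $ i) z)"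
proof -
  have hol: "(\<lambda>z. c $ i * Y z $ i) holomorphic_on U" for i using assms by (intro holomorphic_intros)
  have "(deriv ^^ n) (\<lambda>z. c $ 1 * Y z $ 1 + c $ 2 * Y z $ 2 + c $ 3 * Y z $ 3) z =
    c $ 1 * (deriv ^^ n) (\<lambda>z. Y z $ 1) z + c $ 2 * (deriv ^^ n) (\<lambda>z. Y z $ 2) z
      + c $ 3 * (deriv ^^ n) (\<lambda>z. Y z $ 3) z"
    by (subst higher_deriv_add[OF holomorphic_on_add[OF hol hol] hol assms(2,3)],
        subst higher_deriv_add[OF hol hol assms(2,3)])
       (simp add: higher_deriv_cmult[OF assms(1) assms(3) assms(2)])
  thus ?thesis by (simp add: cdot_def sum_3)
qed

lemma holomorphic_cdot:
  assumes "\<And>i. (\<lambda>z. Y z $ i) holomorphic_on U"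
  shows "(\<lambda>z. cdot c (Y z)) holomorphic_on U"
  unfolding cdot_def by (intro holomorphic_on_sum holomorphic_intros assms)

lemma solves_combination:
  assumes "fundamental_system Q2 Q3 U Y" "open U"
  shows "solves Q2 Q3 U (\<lambda>z. cdot c (Y z))"
proof -
  have sol: "solves Q2 Q3 U (\<lambda>z. Y z $ i)" for i using assms(1) by (simp add: fundamental_system_def)
  have hol: "(\<lambda>z. Y z $ i) holomorphic_on U" for i using sol[of i] by (simp add: solves_def)
  have "(deriv ^^ 3) (\<lambda>z. cdot c (Y z)) z + Q2 z * deriv (\<lambda>z. cdot c (Y z)) z + Q3 z * cdot c (Y z) = 0"
    if z: "z \<in> U" for z
  proof -
    have d3: "(deriv ^^ 3) (\<lambda>z. cdot c (Y z)) z = cdot c (\<chi> i. (deriv ^^ 3) (\<lambda>z. Y z $ i) z)"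
      by (rule higher_deriv_cdot[OF hol assms(2) z])
    have "(deriv ^^ 1) (\<lambda>z. cdot c (Y z)) z = cdot c (\<chi> i. (deriv ^^ 1) (\<lambda>z. Y z $ i) z)"
      by (rule higher_deriv_cdot[OF hol assms(2) z])
    hence d1: "deriv (\<lambda>z. cdot c (Y z)) z = cdot c (\<chi> i. deriv (\<lambda>z. Y z $ i) z)" by simp
    have "(deriv ^^ 3) (\<lambda>z. cdot c (Y z)) z + Q2 z * deriv (\<lambda>z. cdot c (Y z)) z + Q3 z * cdot c (Y z)
      = (\<Sum>i\<in>UNIV. c $ i * ((deriv ^^ 3) (\<lambda>z. Y z $ i) z + Q2 z * deriv (\<lambda>z. Y z $ i) z + Q3 z * Y z $ i))"
      unfolding d3 d1 by (simp add: cdot_def sum.distrib sum_distrib_left algebra_simps)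
    also have "\<dots> = 0"
      using sol z unfolding solves_def by (intro sum.neutral ballI) simp
    finally show ?thesis .
  qed
  thus ?thesis unfolding solves_def using holomorphic_cdot[OF hol] by blast
qed

text \<open>If $f$ has order $n$ and $\Phi$ has order $k$ at $z_0$, then $f^3/\Phi = y^3$ has order $3n - k$,
and a third of it is the exponent of $y$.\<close>

lemma order_is_local_exponent:
  assumes MODE: "MODE Q2 Q3" and H1: "H1 Q2 Q3" and z0: "z0 \<in> uhp" and \<Phi>: "cusp_regular \<Phi>"
    and f: "f holomorphic_on uhp" "w0 \<in> uhp" "f w0 \<noteq> 0"
    and ric: "\<forall>\<^sub>F z in at z0. riccati Q2 Q3 (third_logderiv (\<lambda>z. f z ^ 3 / \<Phi> z)) z = 0"
  obtains n :: nat and g r where "(deriv ^^ n) f z0 \<noteq> 0" "r > 0"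
    "g holomorphic_on ball z0 r" "\<And>w. w \<in> ball z0 r \<Longrightarrow> g w \<noteq> 0"
    "\<And>w. w \<in> ball z0 r \<Longrightarrow> f w = (w - z0) ^ n * g w"
    "poly (indicial_poly Q2 Q3 z0) (of_int (3 * int n - zorder \<Phi> z0) / 3) = 0"
proof -
  have mero: "\<Phi> meromorphic_on uhp" using \<Phi> by (simp add: cusp_regular_def)
  have iso: "isolated_singularity_at \<Phi> z0" "not_essential \<Phi> z0"
    using mero z0 by (auto intro: meromorphic_on_isolated_singularity meromorphic_on_not_essential meromorphic_on_subset)
  have "\<exists>\<^sub>F w in at z0. \<Phi> w \<noteq> 0"
    using cusp_regular_nonzero_nearby[OF \<Phi> z0] by (intro eventually_frequently) auto
  from zorder_exist[OF iso this] obtain r1 where r1: "r1 > 0" "zor_poly \<Phi> z0 holomorphic_on cball z0 r1"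
    "\<forall>w\<in>cball z0 r1 - {z0}. \<Phi> w = zor_poly \<Phi> z0 w * (w - z0) powi zorder \<Phi> z0 \<and> zor_poly \<Phi> z0 w \<noteq> 0"
    "zor_poly \<Phi> z0 z0 \<noteq> 0"
    by auto
  show ?thesis
  proof (rule holomorphic_factor_at_zero[OF f(1) open_uhp convex_connected[OF convex_uhp] z0 f(2,3)])
    fix n g r2
    assume n: "(deriv ^^ n) f z0 \<noteq> 0" and r2: "r2 > 0"
      and g: "g holomorphic_on ball z0 r2" "\<And>w. w \<in> ball z0 r2 \<Longrightarrow> g w \<noteq> 0"
      "\<And>w. w \<in> ball z0 r2 \<Longrightarrow> f w = (w - z0) ^ n * g w"
    define r where "r = min r1 r2"
    have r: "r > 0" "ball z0 r \<subseteq> cball z0 r1" "ball z0 r \<subseteq> ball z0 r2"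
      using r1 r2 by (auto simp: r_def)
    have znz: "zor_poly \<Phi> z0 w \<noteq> 0" if "w \<in> ball z0 r" for w
      using r1(3,4) r(2) that by (cases "w = z0") auto
    have root: "poly (indicial_poly Q2 Q3 z0) (of_int (3 * int n - zorder \<Phi> z0) / 3) = 0"
    proof (rule riccati_pole_residue_indicial[OF r(1) _ _ _ ric])
      show "(\<lambda>w. g w ^ 3 / zor_poly \<Phi> z0 w) holomorphic_on ball z0 r"
        using znz by (intro holomorphic_intros holomorphic_on_subset[OF g(1) r(3)]
            holomorphic_on_subset[OF r1(2) r(2)])
      show "g w ^ 3 / zor_poly \<Phi> z0 w \<noteq> 0" if "w \<in> ball z0 r" for w
        using g(2) znz that r(3) by auto
      show "f w ^ 3 / \<Phi> w = (w - z0) powi (3 * int n - zorder \<Phi> z0) * (g w ^ 3 / zor_poly \<Phi> z0 w)"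
        if w: "w \<in> ball z0 r - {z0}" for w
      proof -
        have fw: "f w = (w - z0) ^ n * g w" using g(3) w r(3) by blast
        have Pw: "\<Phi> w = zor_poly \<Phi> z0 w * (w - z0) powi zorder \<Phi> z0" using r1(3) w r(2) by blast
        have "w - z0 \<noteq> 0" using w by simp
        hence "(w - z0) powi (3 * int n - zorder \<Phi> z0) = ((w - z0) ^ n) ^ 3 / (w - z0) powi zorder \<Phi> z0"
          using power_int_of_nat[of "w - z0" "n * 3"]
          by (simp add: power_int_diff power_mult mult.commute)
        thus ?thesis unfolding fw Pw by (simp add: power_mult_distrib)
      qed
      show "((\<lambda>z. (z - z0) ^ 2 * Q2 z) \<longlongrightarrow> leading_coefficient 2 Q2 z0) (at z0)"
        by (rule leading_coefficient_limit(1)) (use MODE H1 z0 in \<open>auto simp: MODE_def H1_def\<close>)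
      show "((\<lambda>z. (z - z0) ^ 3 * Q3 z) \<longlongrightarrow> leading_coefficient 3 Q3 z0) (at z0)"
        by (rule leading_coefficient_limit(1)) (use MODE H1 z0 in \<open>auto simp: MODE_def H1_def\<close>)
    qed
    show ?thesis
      by (rule that, rule n, rule r2, rule g(1), erule g(2), erule g(3), rule root)
  qed
qed

text \<open>Since $-1/z - \mathrm i = (-\mathrm i/z)(z - \mathrm i)$, comparing the coefficients of
$(z - \mathrm i)^n$ on both sides gives the claim.\<close>

lemma slash_S_eigenfunction_order:
  assumes r: "r > 0" and g: "g holomorphic_on ball \<i> r" "g \<i> \<noteq> 0"
    and f: "\<And>w. w \<in> ball \<i> r \<Longrightarrow> f w = (w - \<i>) ^ n * g w"
    and eig: "\<And>z. z \<in> uhp \<Longrightarrow> z powi (- l) * f (- 1 / z) = \<epsilon> * f z"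
  shows "\<epsilon> = \<i> powi (- l) * (- 1) ^ n"
proof -
  define K where "K z = z powi (- l) * (- \<i> / z) ^ n * g (- 1 / z) - \<epsilon> * g z" for z
  have inv: "isCont (\<lambda>z. - 1 / z) \<i>" by (intro continuous_intros) auto
  have ii: "- 1 / \<i> = \<i>" by (simp add: complex_eq_iff)
  have gc: "isCont g \<i>" using isCont_holomorphic[OF g(1)] r by simp
  have gc': "isCont (\<lambda>z. g (- 1 / z)) \<i>"
    by (rule isCont_o2[where g = g, OF inv]) (use gc ii in simp)
  have pc: "isCont (\<lambda>z. z powi (- l)) \<i>"
  proof -
    have "(\<lambda>z. z powi (- l)) holomorphic_on (- {0})" by (intro holomorphic_on_power_int) auto
    thus ?thesis by (rule isCont_holomorphic) auto
  qed
  have cont: "isCont K \<i>" unfolding K_def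
    by (intro continuous_intros pc gc gc') auto
  have "((\<lambda>z. - 1 / z) \<longlongrightarrow> \<i>) (at \<i>)" using inv ii by (simp add: isCont_def)
  hence "\<forall>\<^sub>F z in at \<i>. - 1 / z \<in> ball \<i> r"
    using topological_tendstoD[of "\<lambda>z. - 1 / z" \<i> "at \<i>" "ball \<i> r"] r by simp
  moreover have "\<forall>\<^sub>F z in at \<i>. z \<in> (ball \<i> r \<inter> uhp) - {\<i>}"
    using r open_uhp by (intro eventually_at_in_open) (auto simp: uhp_def)
  ultimately have "\<forall>\<^sub>F z in at \<i>. K z = 0"
  proof eventually_elim
    case (elim z)
    have z: "z \<noteq> 0" "z - \<i> \<noteq> 0" using elim by (auto simp: uhp_def)
    have shift: "- 1 / z - \<i> = (- \<i> / z) * (z - \<i>)" using z by (simp add: field_simps)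
    have "z powi (- l) * (((- \<i> / z) * (z - \<i>)) ^ n * g (- 1 / z)) = \<epsilon> * ((z - \<i>) ^ n * g z)"
      using eig[of z] f[of z] f[of "- 1 / z"] elim unfolding shift by auto
    hence "(z - \<i>) ^ n * K z = 0"
      unfolding K_def power_mult_distrib by (simp add: algebra_simps)
    thus ?case using z by simp
  qed
  with cont have "K \<i> = 0" by (rule isCont_eq_zero_if_eventually_zero)
  hence "\<epsilon> * g \<i> = (\<i> powi (- l) * (- 1) ^ n) * g \<i>"
    unfolding K_def ii by auto
  thus ?thesis using g(2) by simp
qed

text \<open>Everything about the Bol representation that the proof of the theorem refers to, in terms of
single-valued functions.\<close>

lemma bol_setup:
  assumes MODE: "MODE Q2 Q3" and H1: "H1 Q2 Q3" and H2: "H2 Q2 Q3" and H3: "H3 Q2 Q3"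
    and rho: "local_exponent Q2 Q3 rho_pt 1 \<in> \<int>" and bol: "bol_representation Q2 Q3 R"
  obtains l :: int and \<Phi> Yhat where "even l" "cusp_regular \<Phi>"
    "\<And>i. (\<lambda>z. Yhat z $ i) holomorphic_on uhp"
    "\<And>c. c \<noteq> 0 \<Longrightarrow> \<exists>w\<in>uhp. cdot c (Yhat w) \<noteq> 0"
    "\<And>c z0. \<lbrakk>c \<noteq> 0; z0 \<in> uhp\<rbrakk> \<Longrightarrow>
       \<forall>\<^sub>F z in at z0. riccati Q2 Q3 (third_logderiv (\<lambda>z. cdot c (Yhat z) ^ 3 / \<Phi> z)) z = 0"
    "\<And>\<gamma> z. \<lbrakk>det \<gamma> = 1; z \<in> uhp\<rbrakk> \<Longrightarrow> slash l Yhat \<gamma> z = R \<gamma> *v Yhat z"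
proof -
  from bol obtain Z l U F Y Yhat where
    Z: "singular_representatives Q2 Q3 Z" and l: "real_of_int l = bol_weight Q2 Q3 Z" and
    U: "open U" "U \<noteq> {}" "U \<subseteq> uhp - singular_points Q2 Q3" and
    F: "bol_factor_branch Q2 Q3 Z U F" and Y: "fundamental_system Q2 Q3 U Y" and
    hol: "\<And>i. (\<lambda>z. Yhat z $ i) holomorphic_on uhp" and
    YF: "\<And>z. z \<in> U \<Longrightarrow> Yhat z = F z *s Y z" and
    slash: "\<And>\<gamma> z. \<lbrakk>\<gamma> \<in> carrier SL2Z; z \<in> uhp\<rbrakk> \<Longrightarrow> slash l Yhat \<gamma> z = R \<gamma> *v Yhat z"
    unfolding bol_representation_def by blast
  have Zfin: "finite Z" and Zsub: "Z \<subseteq> singular_points Q2 Q3"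
    using Z by (auto simp: singular_representatives_def)
  have Uuhp: "U \<subseteq> uhp" using U by blast
  have in_uhp: "w \<in> uhp" if "w \<in> insert \<i> (insert rho_pt Z)" for w
  proof -
    have "Im rho_pt > 0" by (simp add: rho_pt_def)
    thus ?thesis using that Zsub by (auto simp: uhp_def singular_points_def)
  qed
  have int3: "\<exists>n::int. 3 * local_exponent Q2 Q3 w 1 = of_int n" if "w \<in> insert \<i> (insert rho_pt Z)" for w
  proof -
    have "\<exists>n::int. local_exponent Q2 Q3 w 1 = of_int n / 3"
      by (rule local_exponents_structure(2)[OF MODE H1 H2 in_uhp[OF that]])
    then obtain n :: int where "local_exponent Q2 Q3 w 1 = of_int n / 3" ..
    thus ?thesis by (intro exI[of _ n]) simp
  qed
  have int3_cusp: "\<exists>n::int. 3 * cusp_exponent Q2 Q3 1 = of_int n"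
  proof -
    obtain n :: int where "cusp_exponent Q2 Q3 1 = of_int n / 3"
      using H3 unfolding H3_def third_nonpos_int_def by blast
    thus ?thesis by (intro exI[of _ n]) simp
  qed
  \<comment> \<open>Thirds of integers occur in the weight with factor $12$ or $6$, the integral exponent at $\rho$ with factor $4$.\<close>
  have l_even: "even l"
  proof -
    obtain k where k: "3 * cusp_exponent Q2 Q3 1 = of_int k" using int3_cusp by blast
    obtain r where r: "local_exponent Q2 Q3 rho_pt 1 = of_int r" using rho by (auto elim: Ints_cases)
    obtain a where a: "3 * local_exponent Q2 Q3 \<i> 1 = of_int a" using int3[of \<i>] by blast
    obtain n where n: "\<And>w. w \<in> Z \<Longrightarrow> 3 * local_exponent Q2 Q3 w 1 = of_int (n w)"
      using int3 by (metis insertCI)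
    have "3 * (\<Sum>w\<in>Z. local_exponent Q2 Q3 w 1) = of_int (\<Sum>w\<in>Z. n w)"
      unfolding sum_distrib_left of_int_sum using n by (intro sum.cong) auto
    hence "real_of_int l = of_int (- 2 - 4 * k - 4 * r - 2 * a - 4 * (\<Sum>w\<in>Z. n w))"
      unfolding l bol_weight_def using k r a by simp
    hence "l = - 2 - 4 * k - 4 * r - 2 * a - 4 * (\<Sum>w\<in>Z. n w)" by (simp only: of_int_eq_iff)
    thus ?thesis by simp
  qed
  have "\<exists>\<Phi>. cusp_regular \<Phi> \<and> (\<forall>z\<in>U. F z \<noteq> 0 \<and> F z ^ 3 = \<Phi> z)"
  proof (rule bol_factor_cube[OF F Zfin Uuhp U(2)])
    fix \<Phi> assume "cusp_regular \<Phi>" "\<And>z. z \<in> U \<Longrightarrow> F z \<noteq> 0 \<and> F z ^ 3 = \<Phi> z"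
    thus ?thesis by blast
  next
    show "3 * cusp_exponent Q2 Q3 1 \<in> \<int>" using int3_cusp by auto
    show "3 * local_exponent Q2 Q3 w 1 \<in> \<int>" if "w \<in> insert \<i> (insert rho_pt Z)" for w
      using int3[OF that] by auto
  qed
  then obtain \<Phi> where \<Phi>: "cusp_regular \<Phi>" "\<And>z. z \<in> U \<Longrightarrow> F z \<noteq> 0 \<and> F z ^ 3 = \<Phi> z"
    by blast
  have nz: "\<exists>w\<in>U. cdot c (Y w) \<noteq> 0" if "c \<noteq> 0" for c
  proof (rule ccontr)
    assume "\<not> (\<exists>w\<in>U. cdot c (Y w) \<noteq> 0)"
    hence "\<forall>z\<in>U. (\<Sum>i\<in>UNIV. c $ i * Y z $ i) = 0" by (auto simp: cdot_def)
    with Y that show False unfolding fundamental_system_def by blast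
  qed
  have "\<exists>w\<in>uhp. cdot c (Yhat w) \<noteq> 0" if c: "c \<noteq> 0" for c
  proof -
    obtain w where w: "w \<in> U" "cdot c (Y w) \<noteq> 0" using nz[OF c] by blast
    have "cdot c (Yhat w) \<noteq> 0" using YF[OF w(1)] \<Phi>(2)[OF w(1)] w(2) by (simp add: cdot_scale)
    thus ?thesis using w(1) Uuhp by blast
  qed
  moreover have "\<forall>\<^sub>F z in at z0. riccati Q2 Q3 (third_logderiv (\<lambda>z. cdot c (Yhat z) ^ 3 / \<Phi> z)) z = 0"
    if c: "c \<noteq> 0" and z0: "z0 \<in> uhp" for c z0
  proof -
    obtain w where w: "w \<in> U" "cdot c (Y w) \<noteq> 0" using nz[OF c] by blast
    have mero: "Q2 meromorphic_on uhp" "Q3 meromorphic_on uhp"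
      using MODE by (auto simp: MODE_def nicely_meromorphic_on_def)
    have "(\<lambda>z. cdot c (Yhat z)) meromorphic_on uhp"
      using holomorphic_cdot[OF hol] by (intro analytic_on_imp_meromorphic_on) (simp add: analytic_on_open open_uhp)
    hence h: "(\<lambda>z. cdot c (Yhat z) ^ 3 / \<Phi> z) meromorphic_on uhp"
      using \<Phi>(1) by (intro meromorphic_on_divide meromorphic_on_power) (auto simp: cusp_regular_def)
    show ?thesis
    proof (rule riccati_continuation[OF h mero U(1) Uuhp solves_combination[OF Y U(1)] w _ z0])
      fix z assume z: "z \<in> U"
      show "cdot c (Yhat z) ^ 3 / \<Phi> z = cdot c (Y z) ^ 3"
        using \<Phi>(2)[OF z] unfolding YF[OF z] cdot_scale power_mult_distrib
        by (metis nonzero_mult_div_cancel_left power_not_zero)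
    qed
  qed
  moreover have "slash l Yhat \<gamma> z = R \<gamma> *v Yhat z" if "det \<gamma> = 1" "z \<in> uhp" for \<gamma> z
    using slash that by (simp add: SL2Z_def)
  ultimately show ?thesis using l_even \<Phi>(1) hol by (intro that[of l \<Phi> Yhat]) blast+
qed


section \<open>The irreducibility criterion\<close>

theorem theorem1p3:
  fixes Q2 Q3 :: "complex \<Rightarrow> complex" and R :: "int^2^2 \<Rightarrow> complex^3^3"
  assumes "MODE Q2 Q3"
    and "H1 Q2 Q3" and "H2 Q2 Q3" and "H3 Q2 Q3"
    and "local_exponent Q2 Q3 rho_pt 1 \<in> \<int>"
    and "bol_representation Q2 Q3 R"
  shows "irreducible_rep R \<longleftrightarrow>
    mset_cong {#3 * local_exponent Q2 Q3 \<i> 1, 3 * local_exponent Q2 Q3 \<i> 2,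
                3 * local_exponent Q2 Q3 \<i> 3#} {#0, 0, 1#} 2"
proof -
  obtain l \<Phi> Yhat where l: "even l" and \<Phi>: "cusp_regular \<Phi>"
    and hol: "\<And>i. (\<lambda>z. Yhat z $ i) holomorphic_on uhp"
    and nz: "\<And>c. c \<noteq> 0 \<Longrightarrow> \<exists>w\<in>uhp. cdot c (Yhat w) \<noteq> 0"
    and ric: "\<And>c z0. \<lbrakk>c \<noteq> 0; z0 \<in> uhp\<rbrakk> \<Longrightarrow>
       \<forall>\<^sub>F z in at z0. riccati Q2 Q3 (third_logderiv (\<lambda>z. cdot c (Yhat z) ^ 3 / \<Phi> z)) z = 0"
    and slash: "\<And>\<gamma> z. \<lbrakk>det \<gamma> = 1; z \<in> uhp\<rbrakk> \<Longrightarrow> slash l Yhat \<gamma> z = R \<gamma> *v Yhat z"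
    using bol_setup[OF assms] by blast
  have R_mult: "R (\<gamma> ** \<delta>) = R \<gamma> ** R \<delta>" if "det \<gamma> = 1" "det \<delta> = 1" for \<gamma> \<delta>
    using assms(6) that unfolding bol_representation_def hom_def SL2Z_def GL3C_def by auto
  define A where "A = R (mat22 0 (-1) 1 0)"
  define B where "B = R (mat22 1 1 0 1)"
  have det1: "det (mat22 0 (-1) 1 0) = 1" "det (mat22 1 1 0 1) = 1"
    "det (mat22 (-1) 0 0 (-1)) = 1"
    by (simp_all add: det_mat22)
  \<comment> \<open>the components of \<open>Yhat\<close> are linearly independent\<close>
  have eq_one: "M = mat 1" if "\<And>z. z \<in> uhp \<Longrightarrow> M *v Yhat z = Yhat z" for M
  proof -
    have "transpose (M - mat 1) *v c = 0" for c
    proof (rule ccontr)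
      assume "transpose (M - mat 1) *v c \<noteq> 0"
      then obtain w where w: "w \<in> uhp" "cdot (transpose (M - mat 1) *v c) (Yhat w) \<noteq> 0"
        using nz by blast
      have "(M - mat 1) *v Yhat w = 0"
        using that[OF w(1)] by (simp add: matrix_vector_mult_diff_rdistrib)
      hence "cdot (transpose (M - mat 1) *v c) (Yhat w) = cdot c 0"
        by (metis cdot_matrix_vector_mult)
      with w(2) show False by (simp add: cdot_def)
    qed
    hence "transpose (M - mat 1) = 0" by (simp add: matrix_eq)
    hence "transpose (transpose (M - mat 1)) = transpose 0" by (rule arg_cong)
    also have "transpose 0 = (0 :: complex^3^3)" by (simp add: transpose_def vec_eq_iff)
    finally show ?thesis by (simp only: transpose_transpose right_minus_eq)
  qed
  have neg_one: "R (mat22 (-1) 0 0 (-1)) = mat 1"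
  proof (rule eq_one)
    fix z assume z: "z \<in> uhp"
    show "R (mat22 (-1) 0 0 (-1)) *v Yhat z = Yhat z"
      using slash[OF det1(3) z] l by (simp add: slash_def automorphy_def moebius_act_def power_int_minus_left)
  qed
  have A2: "A ** A = mat 1" and AB3: "(A ** B) ** (A ** B) ** (A ** B) = mat 1"
    unfolding A_def B_def using SL2Z_relations[of R] R_mult neg_one by blast+
  \<comment> \<open>\<open>R\<close> acts on coefficient vectors by transposes\<close>
  define A' where "A' = transpose A"
  have A_eq: "A = transpose A'" by (simp add: A'_def)
  have actA: "z powi (- l) * cdot c (Yhat (- 1 / z)) = cdot (A' *v c) (Yhat z)" if "z \<in> uhp" for c z
    using arg_cong[OF slash[OF det1(1) that], of "cdot c"]
    by (simp add: slash_def automorphy_def moebius_act_def cdot_scale cdot_matrix_vector_mult A'_def A_def)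
  have actB: "cdot c (Yhat (z + 1)) = cdot (transpose B *v c) (Yhat z)" if "z \<in> uhp" for c z
    using arg_cong[OF slash[OF det1(2) that], of "cdot c"]
    by (simp add: slash_def automorphy_def moebius_act_def cdot_scale cdot_matrix_vector_mult B_def)
  have eigB: "\<mu> ^ 3 = 1" if "det (B - mat \<mu>) = 0" for \<mu>
  proof -
    have "transpose (B - mat \<mu>) = transpose B - mat \<mu>"
      by (simp add: transpose_def mat_def vec_eq_iff)
    hence "det (transpose B - mat \<mu>) = 0" using that by (metis det_transpose)
    then obtain c where c: "c \<noteq> 0" "transpose B *v c = \<mu> *s c"
      unfolding singular_iff_eigenvector by blast
    obtain w where w: "w \<in> uhp" "cdot c (Yhat w) \<noteq> 0" using nz[OF c(1)] by blast
    obtain M where M: "\<Phi> holomorphic_on upper_halfplane M" "\<And>z. M < Im z \<Longrightarrow> \<Phi> z \<noteq> 0 \<and> \<Phi> (z + 1) = \<Phi> z"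
      using \<Phi> unfolding cusp_regular_def by blast
    have Q: "holomorphic_at_cusp Q2" "holomorphic_at_cusp Q3" using assms(2) by (auto simp: H1_def)
    show ?thesis
    proof (rule translation_eigenvalue_cusp[OF Q M(1) _ _ holomorphic_cdot[OF hol] w _ ric[OF c(1)]])
      show "\<Phi> z \<noteq> 0" "\<Phi> (z + 1) = \<Phi> z" if "M < Im z" for z using M(2)[OF that] by auto
      show "cdot c (Yhat (z + 1)) = \<mu> * cdot c (Yhat z)" if "z \<in> uhp" for z
        using actB[OF that] c(2) by (simp add: cdot_scale)
      fix \<nu> assume \<nu>: "poly (indicial_poly_cusp Q2 Q3) \<nu> = 0" "\<mu> ^ 3 = exp (2 * of_real pi * \<i> * (3 * \<nu>))"
      obtain n :: int where "3 * \<nu> = of_int n" using cusp_root_third_integer[OF assms(4) \<nu>(1)] by blast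
      thus "\<mu> ^ 3 = 1" unfolding \<nu>(2) using exp_integer_2pi[of "of_int n"] by (simp add: mult_ac)
    qed
  qed
  have detA: "det A = 1" by (rule involution_det_one[OF A2 AB3 eigB])
  define e where "e = local_exponent Q2 Q3 \<i>"
  have i: "\<i> \<in> uhp" by (simp add: uhp_def)
  note exps = local_exponents_structure[OF assms(1,2,3) i, folded e_def]
  obtain a where a: "e 1 = of_int a / 3" using exps(2) by blast
  obtain d2 where d2: "e 2 - e 1 = of_int d2" using exps(3) by (auto elim: Ints_cases)
  obtain d3 where d3: "e 3 - e 1 = of_int d3" using exps(4) by (auto elim: Ints_cases)
  define k where "k = zorder \<Phi> \<i>"
  \<comment> \<open>The order of vanishing $n$ at $\mathrm i$ is $(k + a)/3$ plus one of \<open>0\<close>, \<open>d2\<close>, \<open>d3\<close>.\<close>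
  have order: "\<exists>n. (deriv ^^ n) (\<lambda>z. cdot c (Yhat z)) \<i> \<noteq> 0 \<and>
      3 * int n - k - a \<in> {0, 3 * d2, 3 * d3} \<and>
      (\<forall>\<epsilon>. A' *v c = \<epsilon> *s c \<longrightarrow> \<epsilon> = \<i> powi (- l) * (- 1) ^ n)" if c: "c \<noteq> 0" for c
  proof -
    obtain w where w: "w \<in> uhp" "cdot c (Yhat w) \<noteq> 0" using nz[OF c] by blast
    show ?thesis
    proof (rule order_is_local_exponent[OF assms(1,2) i \<Phi> holomorphic_cdot[OF hol] w ric[OF c i]])
      fix n g r
      assume n: "(deriv ^^ n) (\<lambda>z. cdot c (Yhat z)) \<i> \<noteq> 0" and r: "r > 0"
        and g: "g holomorphic_on ball \<i> r" "\<And>w. w \<in> ball \<i> r \<Longrightarrow> g w \<noteq> 0"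
          "\<And>w. w \<in> ball \<i> r \<Longrightarrow> cdot c (Yhat w) = (w - \<i>) ^ n * g w"
        and root: "poly (indicial_poly Q2 Q3 \<i>) (of_int (3 * int n - zorder \<Phi> \<i>) / 3) = 0"
      have "of_int (3 * int n - k) / 3 \<in> {complex_of_real (e 1), of_real (e 2), of_real (e 3)}"
        using cubic_root_is_ordered_root[OF indicial_poly_cubic exps(1) root]
        unfolding e_def local_exponent_def k_def .
      hence "of_real (of_int (3 * int n - k) / 3) \<in> complex_of_real ` {e 1, e 2, e 3}" by simp
      hence "of_int (3 * int n - k) / 3 \<in> {e 1, e 2, e 3}"
        by (auto simp only: image_iff of_real_eq_iff)
      hence "real_of_int (3 * int n - k - a) \<in> {of_int 0, of_int (3 * d2), of_int (3 * d3)}"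
        using a d2 d3 by (auto simp: field_simps)
      hence "3 * int n - k - a \<in> {0, 3 * d2, 3 * d3}" by (simp only: insert_iff of_int_eq_iff empty_iff)
      moreover have "\<epsilon> = \<i> powi (- l) * (- 1) ^ n" if "A' *v c = \<epsilon> *s c" for \<epsilon>
      proof (rule slash_S_eigenfunction_order[OF r g(1) _ g(3)])
        show "g \<i> \<noteq> 0" using g(2) r by simp
        show "z powi (- l) * cdot c (Yhat (- 1 / z)) = \<epsilon> * cdot c (Yhat z)" if "z \<in> uhp" for z
          using actA[OF that] \<open>A' *v c = \<epsilon> *s c\<close> by (simp add: cdot_scale)
      qed
      ultimately show ?thesis using n by blast
    qed
  qed
  have mset: "mset_cong {#3 * e 1, 3 * e 2, 3 * e 3#} {#0, 0, 1#} 2 \<longleftrightarrow> \<not> (even d2 \<and> even d3)"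
  proof -
    have *: "3 * e 1 = of_int a" "3 * e 2 = of_int (a + 3 * d2)" "3 * e 3 = of_int (a + 3 * d3)"
      using a d2 d3 by (simp_all add: field_simps)
    have "real_of_int (a + (a + 3 * d2) + (a + 3 * d3)) = of_int 9"
      using exps(5) * by (simp add: field_simps)
    hence "a + (a + 3 * d2) + (a + 3 * d3) = 9" by (simp only: of_int_eq_iff)
    hence "odd (a + (a + 3 * d2) + (a + 3 * d3))" by simp
    from mset_cong_parity_iff[OF this] show ?thesis unfolding * by simp
  qed
  \<comment> \<open>Each of the three orders occurs: in dimension three the Taylor coefficients that belong to the
    other two can be made to vanish.\<close>
  have attained: "\<exists>c n. c \<noteq> 0 \<and> 3 * int n - k - a = 3 * d \<and>
      (\<forall>\<epsilon>. A' *v c = \<epsilon> *s c \<longrightarrow> \<epsilon> = \<i> powi (- l) * (- 1) ^ n)"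
    if "{0, d2, d3} = {d, d', d''}" for d d' d''
  proof -
    define D where "D m = (\<chi> i. (deriv ^^ m) (\<lambda>z. Yhat z $ i) \<i>)" for m
    have D: "(deriv ^^ m) (\<lambda>z. cdot c (Yhat z)) \<i> = cdot c (D m)" for m c
      unfolding D_def by (rule higher_deriv_cdot[OF hol open_uhp i])
    \<comment> \<open>the order of vanishing that belongs to the difference of exponents \<open>d\<close>\<close>
    define m where "m d = nat ((k + a + 3 * d) div 3)" for d
    obtain c where c: "c \<noteq> 0" "cdot c (D (m d')) = 0" "cdot c (D (m d'')) = 0"
      by (rule exists_common_annihilator)
    obtain n where n: "cdot c (D n) \<noteq> 0" "3 * int n - k - a \<in> {0, 3 * d2, 3 * d3}"
      "\<forall>\<epsilon>. A' *v c = \<epsilon> *s c \<longrightarrow> \<epsilon> = \<i> powi (- l) * (- 1) ^ n"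
      using order[OF c(1)] unfolding D by blast
    have "\<exists>x\<in>{d, d', d''}. 3 * int n - k - a = 3 * x" unfolding that[symmetric] using n(2) by auto
    then obtain x where x: "x \<in> {d, d', d''}" "3 * int n - k - a = 3 * x" ..
    have "k + a + 3 * x = 3 * int n" using x(2) by simp
    hence "m x = n" by (simp add: m_def)
    hence "x = d" using x(1) c(2,3) n(1) by auto
    thus ?thesis using c(1) x(2) n(3) by blast
  qed
  have scalar_iff: "A = mat 1 \<longleftrightarrow> even d2 \<and> even d3"
  proof
    assume A1: "A = mat 1"
    hence eps: "A' *v c = 1 *s c" for c by (simp add: A'_def transpose_mat)
    obtain n1 where n1: "3 * int n1 - k - a = 3 * 0" "1 = \<i> powi (- l) * (- 1) ^ n1"
      using attained[of 0 d2 d3] eps by blast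
    obtain n2 where n2: "3 * int n2 - k - a = 3 * d2" "1 = \<i> powi (- l) * (- 1) ^ n2"
      using attained[of d2 0 d3] eps by blast
    obtain n3 where n3: "3 * int n3 - k - a = 3 * d3" "1 = \<i> powi (- l) * (- 1) ^ n3"
      using attained[of d3 0 d2] eps by blast
    have "(- 1 :: complex) ^ n1 = (- 1) ^ n2" "(- 1 :: complex) ^ n1 = (- 1) ^ n3"
      using n1(2) n2(2) n3(2) by (metis mult_cancel_left mult_zero_left zero_neq_one)+
    hence par: "even n1 = even n2" "even n1 = even n3"
      by (metis (no_types) neg_one_even_power neg_one_odd_power one_neq_neg_one)+
    have "d2 = int n2 - int n1" "d3 = int n3 - int n1" using n1(1) n2(1) n3(1) by linarith+
    thus "even d2 \<and> even d3" using par by simp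
  next
    assume ev: "even d2 \<and> even d3"
    show "A = mat 1"
    proof (rule ccontr)
      assume A1: "A \<noteq> mat 1"
      have Am: "A \<noteq> - mat 1"
      proof
        assume "A = - mat 1"
        hence "det A = -1" by (simp add: det_3 mat_def)
        with detA show False by simp
      qed
      have AT2: "A' ** A' = mat 1"
        unfolding A'_def by (metis A2 matrix_transpose_mul transpose_mat)
      have AT: "A' *v (A' *v c) = c" for c
        by (simp add: matrix_vector_mul_assoc AT2)
      have "\<exists>c. A' *v c - c \<noteq> 0"
      proof (rule ccontr)
        assume "\<not> ?thesis"
        hence "A' = mat 1" by (simp add: matrix_eq)
        hence "A = mat 1" unfolding A_eq by (simp add: transpose_mat)
        with A1 show False by contradiction
      qed
      \<comment> \<open>Eigenfunctions for both signs then have orders of different parity.\<close>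
      then obtain c where c: "A' *v c - c \<noteq> 0" by blast
      have "\<exists>c. A' *v c + c \<noteq> 0"
      proof (rule ccontr)
        assume "\<not> ?thesis"
        hence *: "A' *v c = - c" for c by (simp add: eq_neg_iff_add_eq_0)
        have "(- mat 1) *v c = - c" for c :: "complex^3"
          by (simp add: matrix_vector_mult_def mat_def vec_eq_iff sum_3 forall_3)
        hence "A' = - mat 1" using * by (simp add: matrix_eq)
        hence "A = - mat 1" unfolding A_eq by (simp add: transpose_def mat_def vec_eq_iff)
        with Am show False by contradiction
      qed
      then obtain c' where c': "A' *v c' + c' \<noteq> 0" by blast
      have "A' *v (A' *v c - c) = (- 1) *s (A' *v c - c)"
        by (simp add: matrix_vector_mult_diff_distrib AT vec_eq_iff)
      then obtain n where n: "3 * int n - k - a \<in> {0, 3 * d2, 3 * d3}" "- 1 = \<i> powi (- l) * (- 1) ^ n"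
        using order[OF c] by blast
      have "A' *v (A' *v c' + c') = 1 *s (A' *v c' + c')"
        by (simp add: matrix_vector_right_distrib AT add.commute)
      then obtain n' where n': "3 * int n' - k - a \<in> {0, 3 * d2, 3 * d3}" "1 = \<i> powi (- l) * (- 1) ^ n'"
        using order[OF c'] by blast
      have ev': "even x" if "x \<in> {0, 3 * d2, 3 * d3}" for x using that ev by auto
      have "even (3 * int n - k - a)" "even (3 * int n' - k - a)"
        using ev'[OF n(1)] ev'[OF n'(1)] .
      hence "even n = even n'" by presburger
      hence "(- 1 :: complex) ^ n = (- 1) ^ n'" by (cases "even n") simp_all
      hence "(- 1 :: complex) = 1" using n(2) n'(2) by simp
      thus False by simp
    qed
  qed
  have "irreducible_rep R \<longleftrightarrow> A \<noteq> mat 1"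
    unfolding A_def by (rule irreducible_iff_S_nontrivial[OF R_mult neg_one eigB[unfolded B_def]])
  thus ?thesis using mset scalar_iff unfolding e_def by simp
qed

end
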